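(* Let $X$ denote a strictly convex $C^{(3)}$ curve in the plane $\mathbb{R}^2$. Then the following are equivalent. 1) For all $P\in X$ and sufficiently small $h>0$, $S_P(h)=\lambda(P)W_P(h)$, where $\lambda(P)$ is a function of $P$. 2) For all $P\in X$ and sufficiently small $h>0$, $S_P(h)=\frac{8}{9}W_P(h)$. 3) $X$ is an open part of a parabola.
   Context: All curves are of class $C^{(3)}$ and connected. A regular plane curve $X:I\to\mathbb{R}^2$ on an open interval $I$ is convex if for all $t\in I$ the trace $X(I)$ lies entirely in one of the closed half-planes determined by the tangent line at $X(t)$. A simple convex curve $X$ in $\mathbb{R}^2$ is called strictly convex if it is of class $C^{(3)}$ and has positive curvature $\kappa$ with respect to the unit normal $N$ pointing to the convex side, i.e. $\kappa(s)=\langle X''(s),N(X(s))\rangle>0$ for an arclength parametrization $X(s)$. For $P\in X$ and sufficiently small $h>0$, let $\ell$ be the tangent line of $X$ at $P$, let $m$ be the line through $P+hN(P)$ parallel to $\ell$, and let $A_1,A_2$ be the points where $m$ intersects $X$. Let $\ell_1,\ell_2$ be the tangent lines of $X$ at $A_1,A_2$, and let $B_1=\ell\cap\ell_1$, $B_2=\ell\cap\ell_2$. $S_P(h)$ is the area of the region bounded by $X$ and the chord $A_1A_2$. $W_P(h)$ is the area of the trapezoid $A_1A_2B_2B_1$. "For all $P\in X$ and sufficiently small $h>0$" means: for every $P\in X$ there is $h_0(P)>0$ such that the property holds for all $0<h<h_0(P)$. An open part of a parabola is a connected (relatively) open arc of a parabola, of arbitrary position in the plane. *)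

theory Defs
  imports "HOL-Analysis.Analysis"
begin

section \<open>Regular curves of class C3\<close>

definition open_interval :: "real set \<Rightarrow> bool" where
  "open_interval I \<longleftrightarrow> open I \<and> is_interval I \<and> I \<noteq> {}"

definition C3_on :: "(real \<Rightarrow> 'a::real_normed_vector) \<Rightarrow> real set \<Rightarrow> bool" where
  "C3_on X I \<longleftrightarrow> (\<exists>X1 X2 X3.
     (\<forall>t\<in>I. (X has_vector_derivative X1 t) (at t)) \<and>
     (\<forall>t\<in>I. (X1 has_vector_derivative X2 t) (at t)) \<and>
     (\<forall>t\<in>I. (X2 has_vector_derivative X3 t) (at t)) \<and>
     continuous_on I X3)"

abbreviation velocity :: "(real \<Rightarrow> 'a::real_normed_vector) \<Rightarrow> real \<Rightarrow> 'a" where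
  "velocity X t \<equiv> vector_derivative X (at t)"

definition regular_C3_curve :: "(real \<Rightarrow> real^2) \<Rightarrow> real set \<Rightarrow> bool" where
  "regular_C3_curve X I \<longleftrightarrow> open_interval I \<and> C3_on X I \<and> (\<forall>t\<in>I. velocity X t \<noteq> 0)"

definition line :: "real^2 \<Rightarrow> real^2 \<Rightarrow> (real^2) set" where
  "line p v = {p + c *\<^sub>R v | c. True}"

definition tangent_line :: "(real \<Rightarrow> real^2) \<Rightarrow> real \<Rightarrow> (real^2) set" where
  "tangent_line X t = line (X t) (velocity X t)"

section \<open>Convexity and strict convexity\<close>

text \<open>The vector \<open>n\<close> is a unit normal at \<open>X t\<close>, and the trace lies in the closed half-plane
  bounded by the tangent line at \<open>X t\<close> into which \<open>n\<close> points.\<close>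

definition is_convex_side_normal ::
    "(real \<Rightarrow> real^2) \<Rightarrow> real set \<Rightarrow> real \<Rightarrow> real^2 \<Rightarrow> bool" where
  "is_convex_side_normal X I t n \<longleftrightarrow>
     norm n = 1 \<and> n \<bullet> velocity X t = 0 \<and> (\<forall>s\<in>I. (X s - X t) \<bullet> n \<ge> 0)"

definition convex_curve :: "(real \<Rightarrow> real^2) \<Rightarrow> real set \<Rightarrow> bool" where
  "convex_curve X I \<longleftrightarrow> (\<forall>t\<in>I. \<exists>n. is_convex_side_normal X I t n)"

text \<open>For a convex curve this normal is unique unless the trace lies in a straight line, in which
  case the curvature vanishes whatever the choice of normal.\<close>

definition convex_normal :: "(real \<Rightarrow> real^2) \<Rightarrow> real set \<Rightarrow> real \<Rightarrow> real^2" where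
  "convex_normal X I t = (THE n. is_convex_side_normal X I t n)"

definition arclength_reparametrization ::
    "(real \<Rightarrow> real^2) \<Rightarrow> real set \<Rightarrow> (real \<Rightarrow> real) \<Rightarrow> real set \<Rightarrow> bool" where
  "arclength_reparametrization X I \<phi> J \<longleftrightarrow>
     open_interval J \<and> bij_betw \<phi> J I \<and> C3_on \<phi> J \<and>
     (\<forall>s\<in>J. velocity \<phi> s \<noteq> 0 \<and> norm (velocity (X \<circ> \<phi>) s) = 1)"

text \<open>Curvature with respect to the normal pointing to the convex side; meaningful for a curve
  \<open>Y\<close> parametrized by arclength.\<close>

definition curvature :: "(real \<Rightarrow> real^2) \<Rightarrow> real set \<Rightarrow> real \<Rightarrow> real" where
  "curvature Y J s = velocity (velocity Y) s \<bullet> convex_normal Y J s"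

definition strictly_convex_curve :: "(real \<Rightarrow> real^2) \<Rightarrow> real set \<Rightarrow> bool" where
  "strictly_convex_curve X I \<longleftrightarrow>
     regular_C3_curve X I \<and> inj_on X I \<and> convex_curve X I \<and>
     (\<exists>\<phi> J. arclength_reparametrization X I \<phi> J \<and> (\<forall>s\<in>J. curvature (X \<circ> \<phi>) J s > 0))"

section \<open>The segment and the trapezoid cut off at distance h\<close>

text \<open>Throughout, \<open>P = X t\<close>. The line \<open>m\<close> is \<open>parallel_line X I t h\<close>. For a strictly convex curve
  and small \<open>h > 0\<close> it meets the trace in exactly two points, one on each side of \<open>P\<close> along the
  curve; \<open>param1\<close> and \<open>param2\<close> are their parameters.\<close>

definition parallel_line :: "(real \<Rightarrow> real^2) \<Rightarrow> real set \<Rightarrow> real \<Rightarrow> real \<Rightarrow> (real^2) set" where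
  "parallel_line X I t h = line (X t + h *\<^sub>R convex_normal X I t) (velocity X t)"

definition param1 :: "(real \<Rightarrow> real^2) \<Rightarrow> real set \<Rightarrow> real \<Rightarrow> real \<Rightarrow> real" where
  "param1 X I t h = (THE a. a \<in> I \<and> a < t \<and> X a \<in> parallel_line X I t h)"

definition param2 :: "(real \<Rightarrow> real^2) \<Rightarrow> real set \<Rightarrow> real \<Rightarrow> real \<Rightarrow> real" where
  "param2 X I t h = (THE a. a \<in> I \<and> t < a \<and> X a \<in> parallel_line X I t h)"

definition tangent_intersection :: "(real \<Rightarrow> real^2) \<Rightarrow> real \<Rightarrow> real \<Rightarrow> real^2" where
  "tangent_intersection X t a = (THE B. tangent_line X t \<inter> tangent_line X a = {B})"

definition S_area :: "(real \<Rightarrow> real^2) \<Rightarrow> real set \<Rightarrow> real \<Rightarrow> real \<Rightarrow> real" where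
  "S_area X I t h =
     (let a1 = param1 X I t h; a2 = param2 X I t h in
      measure lebesgue (inside (X ` {a1..a2} \<union> closed_segment (X a1) (X a2))))"

text \<open>The trapezoid is convex, hence the convex hull of its four vertices.\<close>

definition W_area :: "(real \<Rightarrow> real^2) \<Rightarrow> real set \<Rightarrow> real \<Rightarrow> real \<Rightarrow> real" where
  "W_area X I t h =
     (let a1 = param1 X I t h; a2 = param2 X I t h;
          B1 = tangent_intersection X t a1; B2 = tangent_intersection X t a2 in
      measure lebesgue (convex hull {X a1, X a2, B2, B1}))"

section \<open>Parabolas\<close>

text \<open>Focus \<open>F\<close>, directrix \<open>line p v\<close>.\<close>

definition is_parabola :: "(real^2) set \<Rightarrow> bool" where
  "is_parabola C \<longleftrightarrow> (\<exists>F p v. v \<noteq> 0 \<and> F \<notin> line p v \<and>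
     C = {Q. dist Q F = infdist Q (line p v)})"

definition open_part_of_parabola :: "(real^2) set \<Rightarrow> bool" where
  "open_part_of_parabola A \<longleftrightarrow>
     (\<exists>C. is_parabola C \<and> openin (top_of_set C) A \<and> connected A \<and> A \<noteq> {})"

end

theory Submission
  imports Defs
begin

text \<open>
  The proof works in affine arclength. Let \<open>w\<close> be the determinant of \<open>X'\<close> and \<open>X''\<close>, which has constant
  sign, put \<open>r = |w| powr (1/3)\<close> and let \<open>\<sigma>\<close> be an antiderivative of \<open>r\<close>. Then \<open>V = X' / r\<close> and
  \<open>A = V' / r\<close> are the first two derivatives of the curve with respect to \<open>\<sigma>\<close>, and their determinant is
  1 up to a constant sign (\<open>affine_frame_exists\<close>). If the affine normal \<open>A\<close> is constant, then \<open>X\<close> is a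
  quadratic polynomial in \<open>\<sigma>\<close>, that is, an arc of a parabola (\<open>open_part_of_parabola_if_A_constant\<close>).

  Fix a point \<open>X t\<close>. In the coordinates with respect to the frame \<open>(V t, A t)\<close>, which preserve area, let
  \<open>chord t k\<close> be the length of the chord at height \<open>k\<close> over the tangent; here \<open>k\<close> is \<open>|V t|\<close> times the
  Euclidean height. Then \<open>S\<close> is the integral of \<open>chord t\<close> over \<open>{0..k}\<close>, and
  \<open>W = k * chord t k - k\<^sup>2 * chord' t k / 2\<close> (\<open>S_area_eq\<close>, \<open>W_area_eq\<close>). For \<open>\<kappa> = sqrt (2 * k)\<close> tending to 0
  one has \<open>S \<sim> 2/3 \<kappa>\<^sup>3\<close> and \<open>W \<sim> 3/4 \<kappa>\<^sup>3\<close>, so a constant ratio of the areas must be \<open>8/9\<close>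
  (\<open>area_ratio\<close>). The equation \<open>S = 8/9 W\<close> is an Euler equation for \<open>S\<close> with the double exponent \<open>3/2\<close>,
  and the asymptotics leave only \<open>chord t k = 2 * \<kappa>\<close> (\<open>chord_of_area_equation\<close>).

  The range of heights in which this holds is not uniform in \<open>t\<close>, and \<open>A\<close> is merely continuous, so no
  further derivatives of the curve are at hand. But two derivatives with respect to \<open>k\<close> are, and they
  show that the end points \<open>X p\<close>, \<open>X q\<close> of the chord satisfy \<open>V p + V q - 2 V t = o(\<kappa>\<^sup>2)\<close> and
  \<open>\<sigma> p + \<sigma> q - 2 \<sigma> t = o(\<kappa>\<^sup>2)\<close> (\<open>second_differences\<close>): as a function of \<open>\<sigma>\<close>, the field \<open>V\<close> has a
  vanishing generalized second derivative at every point. By a theorem of Schwarz \<open>V\<close> is affine in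
  \<open>\<sigma>\<close> (\<open>schwarz_affine\<close>), so \<open>A\<close> is constant.

  Conversely, the coordinates at \<open>t\<close> of a curve on a parabola satisfy \<open>(\<alpha> x + \<beta> y)\<^sup>2 + \<mu> y = 0\<close>
  (\<open>parabola_equation\<close>). So \<open>chord t k\<close> is proportional to \<open>sqrt k\<close>, and \<open>S = 8/9 W\<close> follows from the
  two formulas for the areas.
\<close>

section \<open>The signed area form\<close>

text \<open>The determinant of two vectors up to a sign \<open>e = \<plusminus>1\<close>. The sign is chosen once per curve, so that
  curves of both orientations are treated alike without reparametrization.\<close>

definition crs :: "real \<Rightarrow> real^2 \<Rightarrow> real^2 \<Rightarrow> real" where
  "crs e u v = e * (u$1 * v$2 - u$2 * v$1)"

lemma bounded_bilinear_crs: "bounded_bilinear (crs e)"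
proof -
  have "bilinear (crs e)"
    unfolding bilinear_def
    by (auto intro!: linearI simp: crs_def algebra_simps)
  then show ?thesis
    by (simp add: bilinear_conv_bounded_bilinear)
qed

interpretation crs: bounded_bilinear "crs e" for e
  by (rule bounded_bilinear_crs)

lemma crs_self [simp]: "crs e u u = 0"
  by (simp add: crs_def)

lemma crs_skew: "crs e u v = - crs e v u"
  by (simp add: crs_def algebra_simps)

lemma crs_right_deriv:
  assumes "(f has_vector_derivative f') (at t)"
  shows "((\<lambda>s. crs e u (f s)) has_real_derivative crs e u f') (at t)"
  using bounded_linear.has_vector_derivative[OF crs.bounded_linear_right assms]
  by (simp add: has_real_derivative_iff_has_vector_derivative)

lemma crs_left_deriv:
  assumes "(f has_vector_derivative f') (at t)"
  shows "((\<lambda>s. crs e (f s) u) has_real_derivative crs e f' u) (at t)"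
  using bounded_linear.has_vector_derivative[OF crs.bounded_linear_left assms]
  by (simp add: has_real_derivative_iff_has_vector_derivative)

lemma crs_deriv:
  assumes "(f has_vector_derivative f') (at t)" "(g has_vector_derivative g') (at t)"
  shows "((\<lambda>s. crs e (f s) (g s)) has_real_derivative crs e (f t) g' + crs e f' (g t)) (at t)"
  using bounded_bilinear.has_vector_derivative[OF bounded_bilinear_crs assms]
  by (simp add: has_real_derivative_iff_has_vector_derivative)

lemma crs_expand:
  assumes e: "e = 1 \<or> e = -1" and 1: "crs e u w = 1"
  shows "z = crs e z w *\<^sub>R u + crs e u z *\<^sub>R w"
proof -
  have ee: "e * e = 1" using e by auto
  have D: "e * (u$1 * w$2 - u$2 * w$1) = 1" using 1 by (simp add: crs_def)
  have "z$1 = crs e z w * u$1 + crs e u z * w$1" "z$2 = crs e z w * u$2 + crs e u z * w$2"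
    using D unfolding crs_def by algebra+
  then show ?thesis by (simp add: vec_eq_iff forall_2)
qed

lemma open_real_between:
  assumes "open I" "(s::real) \<in> I"
  shows "\<exists>a\<in>I. \<exists>b\<in>I. a < s \<and> s < b"
proof -
  obtain d where "d > 0" "ball s d \<subseteq> I" by (rule openE[OF assms])
  then show ?thesis
    by (intro bexI[of _ "s - d / 2"] bexI[of _ "s + d / 2"]) (auto simp: subset_iff dist_real_def)
qed

section \<open>Curves with an affine frame\<close>

text \<open>A convex curve with its affine tangent field \<open>V\<close> and affine normal \<open>A\<close>: with respect to the affine
  arclength \<open>\<sigma>\<close> they are the first and second derivatives of \<open>X\<close>. The original parameter is kept, with
  speed \<open>r = \<sigma>'\<close>. The sign \<open>e\<close> is such that the curve lies on the nonnegative side of its tangents.\<close>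

locale affine_frame_curve =
  fixes e :: real and I :: "real set" and X V A :: "real \<Rightarrow> real^2" and r \<sigma> :: "real \<Rightarrow> real"
  assumes sign: "e = 1 \<or> e = -1"
    and open_I: "open I" and interval_I: "is_interval I"
    and X_deriv: "t \<in> I \<Longrightarrow> (X has_vector_derivative r t *\<^sub>R V t) (at t)"
    and V_deriv: "t \<in> I \<Longrightarrow> (V has_vector_derivative r t *\<^sub>R A t) (at t)"
    and \<sigma>_deriv: "t \<in> I \<Longrightarrow> (\<sigma> has_real_derivative r t) (at t)"
    and r_pos: "t \<in> I \<Longrightarrow> 0 < r t"
    and A_cont: "continuous_on I A"
    and crs_VA: "t \<in> I \<Longrightarrow> crs e (V t) (A t) = 1"
    and support: "t \<in> I \<Longrightarrow> s \<in> I \<Longrightarrow> 0 \<le> crs e (V t) (X s - X t)"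
    and inj: "inj_on X I"
begin

lemma between_in_I: "a \<in> I \<Longrightarrow> b \<in> I \<Longrightarrow> a \<le> u \<Longrightarrow> u \<le> b \<Longrightarrow> u \<in> I"
  using interval_I unfolding is_interval_1 by blast

lemma V_nonzero: "t \<in> I \<Longrightarrow> V t \<noteq> 0"
  using crs_VA[of t] by (auto simp: crs.zero_left)

text \<open>If another point lay on the tangent at \<open>t\<close>, then it would be on the wrong side of the tangents at
  parameters near \<open>t\<close>, because these turn at a positive rate.\<close>

lemma support_strict:
  assumes t: "t \<in> I" and s: "s \<in> I" and ne: "s \<noteq> t"
  shows "0 < crs e (V t) (X s - X t)"
proof (rule ccontr)
  assume "\<not> ?thesis"
  with support[OF t s] have 0: "crs e (V t) (X s - X t) = 0" by simp
  define c where "c = crs e (X s - X t) (A t)"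
  have c: "X s - X t = c *\<^sub>R V t"
    using crs_expand[OF sign crs_VA[OF t], of "X s - X t"] 0 by (simp add: c_def)
  have "c \<noteq> 0"
    using c ne inj t s by (auto simp: inj_on_def)
  let ?g = "\<lambda>u. crs e (V u) (X s - X u)"
  have "((\<lambda>u. X s - X u) has_vector_derivative - (r t *\<^sub>R V t)) (at t)"
    by (auto intro!: derivative_eq_intros X_deriv t)
  from crs_deriv[OF V_deriv[OF t] this, of e]
  have der: "(?g has_real_derivative - c * r t) (at t)"
    using crs_skew[of e "A t" "V t"] crs_VA[OF t]
    by (simp add: c crs.scaleR_left crs.scaleR_right crs.minus_right algebra_simps)
  obtain d where d: "d > 0" "ball t d \<subseteq> I"
    using open_I t open_contains_ball by blast
  have "- c * r t = 0"
  proof (rule DERIV_local_min[OF der d(1)], intro allI impI)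
    fix y assume "\<bar>t - y\<bar> < d"
    then have "y \<in> I" using d(2) by (auto simp: dist_real_def)
    then show "?g t \<le> ?g y" using support[of y s] s 0 by simp
  qed
  with \<open>c \<noteq> 0\<close> r_pos[OF t] show False by simp
qed

text \<open>Three points of the curve are positively oriented: seen from \<open>X a\<close>, the direction of \<open>X s\<close> turns
  monotonically and stays in the open half-plane over the tangent at \<open>a\<close>, so the cotangent of its
  angle with that tangent is strictly decreasing.\<close>

lemma orientation:
  assumes a: "a \<in> I" and c: "c \<in> I" and ab: "a < b" and bc: "b < c"
  shows "0 < crs e (X b - X a) (X c - X a)"
proof -
  define z where "z = (\<lambda>s. X s - X a)"
  let ?n = "\<lambda>s. V a \<bullet> z s" and ?d = "\<lambda>s. crs e (V a) (z s)"
  have inI: "s \<in> I" if "b \<le> s" "s \<le> c" for s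
    using between_in_I[OF a c, of s] that ab bc by auto
  have dpos: "0 < ?d s" if "b \<le> s" "s \<le> c" for s
    using support_strict[OF a inI[OF that]] that ab by (auto simp: z_def)
  have id: "(V a \<bullet> q) * crs e (V a) p - (V a \<bullet> p) * crs e (V a) q
      = - ((V a \<bullet> V a) * crs e p q)" for p q
    by (simp add: crs_def inner_vec_def sum_2 algebra_simps)
  have "\<exists>D. ((\<lambda>s. ?n s / ?d s) has_real_derivative D) (at s) \<and> D < 0"
    if s: "b \<le> s" "s \<le> c" for s
  proof -
    have z': "(z has_vector_derivative r s *\<^sub>R V s) (at s)"
      unfolding z_def by (auto intro!: derivative_eq_intros X_deriv inI s)
    have n': "(?n has_real_derivative V a \<bullet> (r s *\<^sub>R V s)) (at s)"
      using bounded_linear.has_vector_derivative[OF bounded_linear_inner_right z', of "V a"]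
      by (simp add: has_real_derivative_iff_has_vector_derivative)
    have d': "(?d has_real_derivative crs e (V a) (r s *\<^sub>R V s)) (at s)"
      by (rule crs_right_deriv[OF z'])
    have "((\<lambda>s. ?n s / ?d s) has_real_derivative
        ((V a \<bullet> (r s *\<^sub>R V s)) * ?d s - ?n s * crs e (V a) (r s *\<^sub>R V s)) / (?d s * ?d s)) (at s)"
      by (rule DERIV_divide[OF n' d']) (use dpos[OF s] in auto)
    moreover have "(V a \<bullet> (r s *\<^sub>R V s)) * ?d s - ?n s * crs e (V a) (r s *\<^sub>R V s)
        = - (r s * ((V a \<bullet> V a) * crs e (z s) (V s)))"
      unfolding id by (simp add: crs.scaleR_right)
    moreover have "crs e (z s) (V s) = crs e (V s) (X a - X s)"
      by (simp add: z_def crs_def algebra_simps)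
    moreover have "0 < crs e (V s) (X a - X s)"
      using support_strict[OF inI[OF s] a] ab s by auto
    ultimately show ?thesis
      using r_pos[OF inI[OF s]] V_nonzero[OF a] dpos[OF s]
      by (auto intro!: exI divide_neg_pos mult_pos_pos)
  qed
  then have "?n c / ?d c < ?n b / ?d b"
    by (intro DERIV_neg_imp_decreasing[OF bc]) blast
  then have "?n c * ?d b - ?n b * ?d c < 0"
    using dpos[of b] dpos[of c] bc by (simp add: field_simps)
  then have "0 < (V a \<bullet> V a) * crs e (z b) (z c)"
    using id[of "z c" "z b"] by simp
  then show ?thesis
    using inner_ge_zero[of "V a"] by (auto simp: z_def zero_less_mult_iff)
qed

text \<open>Away from \<open>t\<close> the curve does not return to small heights over the tangent at \<open>t\<close>. In the basis
  \<open>X a - X t\<close>, \<open>X c - X t\<close> the remaining points have positive coordinates of sum more than 1.\<close>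

lemma height_away:
  assumes I: "a \<in> I" "c \<in> I" "s \<in> I" and ac: "a < t" "t < c" and s: "s < a \<or> c < s"
  shows "min (crs e (V t) (X a - X t)) (crs e (V t) (X c - X t)) \<le> crs e (V t) (X s - X t)"
proof -
  have t: "t \<in> I" using between_in_I[OF I(1,2)] ac by auto
  define z a' c' where "z = X s - X t" and "a' = X a - X t" and "c' = X c - X t"
  note defs = z_def a'_def c'_def
  have D: "0 < crs e c' a'"
    using orientation[OF I(1,2) ac] by (simp add: defs crs_def algebra_simps)
  have "0 < crs e c' z \<and> 0 < crs e z a' \<and> 0 < crs e c' z + crs e z a' - crs e c' a'"
  proof (cases "s < a")
    case True
    then show ?thesis
      using orientation[of s c t] orientation[of s t a] orientation[of s c a] I t ac
      by (simp add: defs crs_def algebra_simps)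
  next
    case False
    then show ?thesis
      using orientation[of t s c] orientation[of a s t] orientation[of a s c] I t ac s
      by (simp add: defs crs_def algebra_simps)
  qed
  then have 1: "0 < crs e c' z" "0 < crs e z a'"
    and 3: "0 < crs e c' z + crs e z a' - crs e c' a'"
    by auto
  define \<alpha> \<gamma> where "\<alpha> = crs e c' z / crs e c' a'" and "\<gamma> = crs e z a' / crs e c' a'"
  have pos: "0 < \<alpha>" "0 < \<gamma>" "1 < \<alpha> + \<gamma>"
    using D 1 3 by (auto simp: \<alpha>_def \<gamma>_def field_simps)
  have "crs e c' a' * crs e (V t) z = crs e c' z * crs e (V t) a' + crs e z a' * crs e (V t) c'"
    by (simp add: crs_def algebra_simps)
  then have z: "crs e (V t) z = \<alpha> * crs e (V t) a' + \<gamma> * crs e (V t) c'"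
    using D by (simp add: \<alpha>_def \<gamma>_def field_simps)
  define m where "m = min (crs e (V t) a') (crs e (V t) c')"
  have m0: "0 \<le> m" using support[OF t I(1)] support[OF t I(2)] by (simp add: m_def defs)
  have "m \<le> (\<alpha> + \<gamma>) * m" using m0 pos by (simp add: mult_le_cancel_right1)
  also have "\<dots> \<le> crs e (V t) z"
    unfolding z distrib_right using pos
    by (intro add_mono mult_left_mono) (auto simp: m_def)
  finally show ?thesis by (simp add: m_def defs)
qed

end

section \<open>Affine coordinates at a point\<close>

context affine_frame_curve
begin

text \<open>The coordinates of \<open>X s - X t\<close> and of \<open>V s\<close> in the frame \<open>(V t, A t)\<close>. The second coordinate \<open>yc\<close>
  is \<open>|V t|\<close> times the Euclidean height over the tangent at \<open>t\<close>.\<close>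

definition xc :: "real \<Rightarrow> real \<Rightarrow> real" where
  "xc t s = crs e (X s - X t) (A t)"

definition yc :: "real \<Rightarrow> real \<Rightarrow> real" where
  "yc t s = crs e (V t) (X s - X t)"

definition vc :: "real \<Rightarrow> real \<Rightarrow> real" where
  "vc t s = crs e (V s) (A t)"

definition dc :: "real \<Rightarrow> real \<Rightarrow> real" where
  "dc t s = crs e (V t) (V s)"

lemma coords_self [simp]: "xc t t = 0" "yc t t = 0" "dc t t = 0"
  by (simp_all add: xc_def yc_def dc_def crs.zero_left crs.zero_right)

lemma vc_self [simp]: "t \<in> I \<Longrightarrow> vc t t = 1"
  by (simp add: vc_def crs_VA)

lemma X_coords: "t \<in> I \<Longrightarrow> X s - X t = xc t s *\<^sub>R V t + yc t s *\<^sub>R A t"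
  unfolding xc_def yc_def by (rule crs_expand[OF sign crs_VA])

lemma V_coords: "t \<in> I \<Longrightarrow> V s = vc t s *\<^sub>R V t + dc t s *\<^sub>R A t"
  unfolding vc_def dc_def by (rule crs_expand[OF sign crs_VA])

lemma xc_deriv: "s \<in> I \<Longrightarrow> (xc t has_real_derivative r s * vc t s) (at s)"
proof -
  assume s: "s \<in> I"
  have "((\<lambda>s. X s - X t) has_vector_derivative r s *\<^sub>R V s) (at s)"
    by (auto intro!: derivative_eq_intros X_deriv s)
  from crs_left_deriv[OF this, of e "A t"] show ?thesis
    by (simp add: xc_def[abs_def] vc_def crs.scaleR_left)
qed

lemma yc_deriv: "s \<in> I \<Longrightarrow> (yc t has_real_derivative r s * dc t s) (at s)"
proof -
  assume s: "s \<in> I"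
  have "((\<lambda>s. X s - X t) has_vector_derivative r s *\<^sub>R V s) (at s)"
    by (auto intro!: derivative_eq_intros X_deriv s)
  from crs_right_deriv[OF this, of e "V t"] show ?thesis
    by (simp add: yc_def[abs_def] dc_def crs.scaleR_right)
qed

lemma vc_deriv: "s \<in> I \<Longrightarrow> (vc t has_real_derivative r s * crs e (A s) (A t)) (at s)"
  using crs_left_deriv[OF V_deriv[of s], of e "A t"] by (simp add: vc_def[abs_def] crs.scaleR_left)

lemma dc_deriv: "s \<in> I \<Longrightarrow> (dc t has_real_derivative r s * crs e (V t) (A s)) (at s)"
  using crs_right_deriv[OF V_deriv[of s], of e "V t"] by (simp add: dc_def[abs_def] crs.scaleR_right)

lemma yc_cont: "continuous_on I (yc t)"
  by (rule DERIV_continuous_on[OF has_field_derivative_at_within[OF yc_deriv]])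

lemma xc_cont: "continuous_on I (xc t)"
  by (rule DERIV_continuous_on[OF has_field_derivative_at_within[OF xc_deriv]])

lemma yc_pos: "t \<in> I \<Longrightarrow> s \<in> I \<Longrightarrow> s \<noteq> t \<Longrightarrow> 0 < yc t s"
  unfolding yc_def by (rule support_strict)

lemma \<sigma>_mono: "a \<in> I \<Longrightarrow> b \<in> I \<Longrightarrow> a < b \<Longrightarrow> \<sigma> a < \<sigma> b"
  by (rule DERIV_pos_imp_increasing) (meson between_in_I \<sigma>_deriv r_pos)+

lemma \<sigma>_cont: "continuous_on I \<sigma>"
  by (rule DERIV_continuous_on[OF has_field_derivative_at_within[OF \<sigma>_deriv]])

lemma \<sigma>_mean_value_less:
  assumes ab: "a \<in> I" "b \<in> I" "a < b"
    and F: "\<And>u. u \<in> I \<Longrightarrow> (F has_real_derivative r u * G u) (at u)"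
  shows "\<exists>c. a < c \<and> c < b \<and> F b - F a = (\<sigma> b - \<sigma> a) * G c"
proof -
  have inI: "u \<in> I" if "a \<le> u" "u \<le> b" for u using between_in_I[OF ab(1,2)] that by auto
  have "\<exists>c. a < c \<and> c < b \<and> (F b - F a) * r c = (\<sigma> b - \<sigma> a) * (r c * G c)"
    by (rule GMVT'[OF ab(3)])
      (use F \<sigma>_deriv inI in \<open>auto intro: DERIV_isCont\<close>)
  then obtain c where c: "a < c" "c < b" "(F b - F a) * r c = (\<sigma> b - \<sigma> a) * (r c * G c)"
    by blast
  have "r c > 0" using r_pos inI c by simp
  with c show ?thesis by (intro exI[of _ c]) auto
qed

text \<open>Cauchy's mean value theorem with \<open>\<sigma>\<close> as the reference function, on either side of \<open>t\<close>.\<close>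

lemma \<sigma>_mean_value:
  assumes I: "t \<in> I" "s \<in> I"
    and F: "\<And>u. u \<in> I \<Longrightarrow> (F has_real_derivative r u * G u) (at u)"
  shows "\<exists>c\<in>I. \<bar>c - t\<bar> \<le> \<bar>s - t\<bar> \<and> \<bar>\<sigma> c - \<sigma> t\<bar> \<le> \<bar>\<sigma> s - \<sigma> t\<bar> \<and> F s - F t = (\<sigma> s - \<sigma> t) * G c"
proof (cases s t rule: linorder_cases)
  case less
  obtain c where c: "s < c" "c < t" "F t - F s = (\<sigma> t - \<sigma> s) * G c"
    using \<sigma>_mean_value_less[OF I(2,1) less F] by auto
  have "c \<in> I" using between_in_I[OF I(2,1)] c by auto
  then show ?thesis
    using c \<sigma>_mono[of s c] \<sigma>_mono[of c t] I by (intro bexI[of _ c]) (auto simp: algebra_simps)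
next
  case equal
  then show ?thesis using I by (intro bexI[of _ t]) auto
next
  case greater
  obtain c where c: "t < c" "c < s" "F s - F t = (\<sigma> s - \<sigma> t) * G c"
    using \<sigma>_mean_value_less[OF I(1,2) greater F] by auto
  have "c \<in> I" using between_in_I[OF I(1,2)] c by auto
  then show ?thesis
    using c \<sigma>_mono[of t c] \<sigma>_mono[of c s] I by (intro bexI[of _ c]) auto
qed

text \<open>Since \<open>A\<close> is only continuous, \<open>crs e (V t) (A s) = 1 + o(\<sigma> s - \<sigma> t)\<close> is not a Taylor
  expansion: it follows from the normalization \<open>crs e (V s) (A s) = 1\<close>. Integrating it twice with
  respect to \<open>\<sigma>\<close> gives the estimates for \<open>dc\<close> and \<open>yc\<close>.\<close>

lemma local_expansion:
  assumes t: "t \<in> I" and \<epsilon>: "0 < \<epsilon>"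
  shows "\<exists>\<delta>>0. \<forall>s. \<bar>s - t\<bar> < \<delta> \<longrightarrow> s \<in> I \<and>
    \<bar>vc t s - 1\<bar> \<le> \<epsilon> * \<bar>\<sigma> s - \<sigma> t\<bar> \<and> \<bar>dc t s - (\<sigma> s - \<sigma> t)\<bar> \<le> \<epsilon> * \<bar>\<sigma> s - \<sigma> t\<bar>^2 \<and>
    \<bar>xc t s - (\<sigma> s - \<sigma> t)\<bar> \<le> \<epsilon> * \<bar>\<sigma> s - \<sigma> t\<bar>^2 \<and>
    \<bar>yc t s - (\<sigma> s - \<sigma> t)^2 / 2\<bar> \<le> \<epsilon> * \<bar>\<sigma> s - \<sigma> t\<bar>^3"
proof -
  obtain d0 where d0: "d0 > 0" "ball t d0 \<subseteq> I"
    using open_I t open_contains_ball by blast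
  have "continuous (at t) A"
    using A_cont open_I t continuous_on_eq_continuous_at by blast
  then have A_t: "(A \<longlongrightarrow> A t) (at t)" by (simp add: isCont_def)
  have lim: "((\<lambda>p. crs e (A (fst p)) (A (snd p))) \<longlongrightarrow> crs e (A t) (A t)) (nhds (t, t))"
  proof (rule crs.tendsto)
    have A_n: "(A \<longlongrightarrow> A t) (nhds t)" using A_t by (simp add: tendsto_at_iff_tendsto_nhds)
    show "((\<lambda>p. A (fst p)) \<longlongrightarrow> A t) (nhds (t, t))"
      using tendsto_fst[OF filterlim_ident, of "(t, t)"] by (intro filterlim_compose[OF A_n]) simp
    show "((\<lambda>p. A (snd p)) \<longlongrightarrow> A t) (nhds (t, t))"
      using tendsto_snd[OF filterlim_ident, of "(t, t)"] by (intro filterlim_compose[OF A_n]) simp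
  qed
  then have "\<forall>\<^sub>F p in nhds t \<times>\<^sub>F nhds t. \<bar>crs e (A (fst p)) (A (snd p))\<bar> < \<epsilon>"
    using \<epsilon> tendstoD[OF lim \<epsilon>] by (simp add: nhds_prod dist_real_def)
  then obtain P where P: "eventually P (nhds t)" "\<And>u u'. P u \<Longrightarrow> P u' \<Longrightarrow> \<bar>crs e (A u) (A u')\<bar> < \<epsilon>"
    unfolding eventually_prod_same by auto
  then obtain d1 where d1: "d1 > 0" "\<And>u. \<bar>u - t\<bar> < d1 \<Longrightarrow> P u"
    unfolding eventually_nhds_metric dist_real_def by auto
  define \<delta> where "\<delta> = min d0 d1"
  have nearI: "u \<in> I" if "\<bar>u - t\<bar> < \<delta>" for u
    using that d0 by (auto simp: \<delta>_def subset_iff dist_real_def)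
  have nearA: "\<bar>crs e (A u) (A u')\<bar> \<le> \<epsilon>" if "\<bar>u - t\<bar> < \<delta>" "\<bar>u' - t\<bar> < \<delta>" for u u'
    using P(2)[OF d1(2) d1(2), of u u'] that by (simp add: \<delta>_def)
  have v: "\<bar>vc t s - 1\<bar> \<le> \<epsilon> * \<bar>\<sigma> s - \<sigma> t\<bar>" if s: "\<bar>s - t\<bar> < \<delta>" for s
  proof -
    obtain c where c: "\<bar>c - t\<bar> \<le> \<bar>s - t\<bar>" "vc t s - vc t t = (\<sigma> s - \<sigma> t) * crs e (A c) (A t)"
      using \<sigma>_mean_value[OF t nearI[OF s], of "vc t", OF vc_deriv] by blast
    have "\<bar>crs e (A c) (A t)\<bar> \<le> \<epsilon>" using nearA[of c t] c s \<open>0 < d1\<close> by auto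
    then have "\<bar>\<sigma> s - \<sigma> t\<bar> * \<bar>crs e (A c) (A t)\<bar> \<le> \<bar>\<sigma> s - \<sigma> t\<bar> * \<epsilon>"
      by (intro mult_left_mono) auto
    then show ?thesis using c t by (simp add: abs_mult mult.commute)
  qed
  have VA: "\<bar>crs e (V t) (A s) - 1\<bar> \<le> \<epsilon> * \<bar>\<sigma> s - \<sigma> t\<bar>" if s: "\<bar>s - t\<bar> < \<delta>" for s
  proof -
    have "((\<lambda>u. crs e (V u) (A s)) has_real_derivative r u * crs e (A u) (A s)) (at u)" if "u \<in> I" for u
      using crs_left_deriv[OF V_deriv[OF that], of e "A s"] by (simp add: crs.scaleR_left)
    from \<sigma>_mean_value[OF t nearI[OF s], of "\<lambda>u. crs e (V u) (A s)", OF this]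
    obtain c where c: "\<bar>c - t\<bar> \<le> \<bar>s - t\<bar>"
      "crs e (V s) (A s) - crs e (V t) (A s) = (\<sigma> s - \<sigma> t) * crs e (A c) (A s)"
      by blast
    have "\<bar>crs e (A c) (A s)\<bar> \<le> \<epsilon>" using nearA[of c s] c s by auto
    then have "\<bar>\<sigma> s - \<sigma> t\<bar> * \<bar>crs e (A c) (A s)\<bar> \<le> \<bar>\<sigma> s - \<sigma> t\<bar> * \<epsilon>"
      by (intro mult_left_mono) auto
    moreover have "\<bar>crs e (V t) (A s) - 1\<bar> = \<bar>\<sigma> s - \<sigma> t\<bar> * \<bar>crs e (A c) (A s)\<bar>"
      using c(2) crs_VA[OF nearI[OF s]] unfolding abs_mult[symmetric] by linarith
    ultimately show ?thesis by (simp add: mult.commute)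
  qed
  have step: "\<bar>F s - F t\<bar> \<le> \<epsilon> * \<bar>\<sigma> s - \<sigma> t\<bar>^Suc n"
    if s: "\<bar>s - t\<bar> < \<delta>" and F: "\<And>u. u \<in> I \<Longrightarrow> (F has_real_derivative r u * G u) (at u)"
      and G: "\<And>u. \<bar>u - t\<bar> < \<delta> \<Longrightarrow> \<bar>G u\<bar> \<le> \<epsilon> * \<bar>\<sigma> u - \<sigma> t\<bar>^n" for F G n s
  proof -
    obtain c where c: "\<bar>c - t\<bar> \<le> \<bar>s - t\<bar>" "\<bar>\<sigma> c - \<sigma> t\<bar> \<le> \<bar>\<sigma> s - \<sigma> t\<bar>"
      "F s - F t = (\<sigma> s - \<sigma> t) * G c"
      using \<sigma>_mean_value[OF t nearI[OF s], of F, OF F] by blast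
    have "\<bar>G c\<bar> \<le> \<epsilon> * \<bar>\<sigma> c - \<sigma> t\<bar>^n" using G[of c] c s by auto
    also have "\<dots> \<le> \<epsilon> * \<bar>\<sigma> s - \<sigma> t\<bar>^n" using \<epsilon> c(2) by (intro mult_left_mono power_mono) auto
    finally have "\<bar>\<sigma> s - \<sigma> t\<bar> * \<bar>G c\<bar> \<le> \<bar>\<sigma> s - \<sigma> t\<bar> * (\<epsilon> * \<bar>\<sigma> s - \<sigma> t\<bar>^n)"
      by (intro mult_left_mono) auto
    then show ?thesis using c(3) by (simp add: abs_mult mult_ac)
  qed
  have x: "\<bar>xc t s - (\<sigma> s - \<sigma> t)\<bar> \<le> \<epsilon> * \<bar>\<sigma> s - \<sigma> t\<bar>^2" if s: "\<bar>s - t\<bar> < \<delta>" for s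
  proof -
    have "((\<lambda>u. xc t u - \<sigma> u) has_real_derivative r u * (vc t u - 1)) (at u)" if "u \<in> I" for u
      using DERIV_diff[OF xc_deriv[OF that] \<sigma>_deriv[OF that]] by (simp add: algebra_simps)
    from step[OF s this, of 1] v show ?thesis by (simp add: numeral_2_eq_2 algebra_simps)
  qed
  have d: "\<bar>dc t s - (\<sigma> s - \<sigma> t)\<bar> \<le> \<epsilon> * \<bar>\<sigma> s - \<sigma> t\<bar>^2" if s: "\<bar>s - t\<bar> < \<delta>" for s
  proof -
    have "((\<lambda>u. dc t u - \<sigma> u) has_real_derivative r u * (crs e (V t) (A u) - 1)) (at u)"
      if "u \<in> I" for u
      using DERIV_diff[OF dc_deriv[OF that] \<sigma>_deriv[OF that]] by (simp add: algebra_simps)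
    from step[OF s this, of 1] VA show ?thesis by (simp add: numeral_2_eq_2 algebra_simps)
  qed
  have y: "\<bar>yc t s - (\<sigma> s - \<sigma> t)^2 / 2\<bar> \<le> \<epsilon> * \<bar>\<sigma> s - \<sigma> t\<bar>^3" if s: "\<bar>s - t\<bar> < \<delta>" for s
  proof -
    have "((\<lambda>u. yc t u - (\<sigma> u - \<sigma> t)^2 / 2) has_real_derivative r u * (dc t u - (\<sigma> u - \<sigma> t))) (at u)"
      if "u \<in> I" for u
      by (auto intro!: derivative_eq_intros yc_deriv \<sigma>_deriv that simp: field_simps)
    from step[OF s this, of 2] d show ?thesis by (simp add: numeral_3_eq_3 numeral_2_eq_2)
  qed
  show ?thesis
    using v d x y nearI \<open>0 < d0\<close> \<open>0 < d1\<close> by (intro exI[of _ \<delta>]) (auto simp: \<delta>_def)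
qed

end

section \<open>The two branches of the height function\<close>

lemma inverse_branch:
  fixes f f' g :: "real \<Rightarrow> real"
  assumes der: "\<And>s. s \<in> {a..b} \<Longrightarrow> (f has_real_derivative f' s) (at s)"
    and inj: "inj_on f {a..b}"
    and g: "\<And>k. 0 \<le> k \<Longrightarrow> k < K \<Longrightarrow> g k \<in> {a..b} \<and> f (g k) = k"
  shows "continuous_on {0..<K} g"
    and "\<And>k. 0 < k \<Longrightarrow> k < K \<Longrightarrow> f' (g k) \<noteq> 0 \<Longrightarrow> (g has_real_derivative 1 / f' (g k)) (at k)"
proof -
  have "continuous_on {a..b} f"
    using der by (meson DERIV_continuous_on has_field_derivative_at_within)
  then have "continuous_on (f ` {a..b}) (inv_into {a..b} f)"
    by (rule continuous_on_inv) (use inj in auto)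
  moreover have "{0..<K} \<subseteq> f ` {a..b}"
  proof
    fix k assume "k \<in> {0..<K}"
    then show "k \<in> f ` {a..b}" using g[of k] by (intro image_eqI[of k f "g k"]) auto
  qed
  ultimately have "continuous_on {0..<K} (inv_into {a..b} f)"
    using continuous_on_subset by blast
  moreover have "inv_into {a..b} f k = g k" if "k \<in> {0..<K}" for k
    using g[of k] inv_into_f_f[OF inj, of "g k"] that by auto
  ultimately show cont: "continuous_on {0..<K} g"
    by (metis (no_types, lifting) continuous_on_cong)
  fix k assume k: "0 < k" "k < K" and nz: "f' (g k) \<noteq> 0"
  have "isCont g k"
    using cont k by (intro continuous_on_interior[of "{0..<K}"]) auto
  then have "(g has_real_derivative inverse (f' (g k))) (at k)"
    by (intro DERIV_inverse_function[of f _ _ _ 0 K] der nz k) (use g k in auto)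
  then show "(g has_real_derivative 1 / f' (g k)) (at k)"
    by (simp add: inverse_eq_divide)
qed

context affine_frame_curve
begin

text \<open>The parameters at which the curve reaches height \<open>k\<close> over its tangent at \<open>t\<close>, before and
  after \<open>t\<close>.\<close>

definition sl :: "real \<Rightarrow> real \<Rightarrow> real" where
  "sl t k = (THE s. s \<in> I \<and> s \<le> t \<and> yc t s = k)"

definition sr :: "real \<Rightarrow> real \<Rightarrow> real" where
  "sr t k = (THE s. s \<in> I \<and> t \<le> s \<and> yc t s = k)"

text \<open>Below height \<open>K\<close> the curve consists of two monotone branches that are graphs over the
  tangent at \<open>t\<close>.\<close>

definition branch_height :: "real \<Rightarrow> real \<Rightarrow> bool" where
  "branch_height t K \<longleftrightarrow> (\<exists>a c. a \<in> I \<and> c \<in> I \<and> a < t \<and> t < c \<and> K = min (yc t a) (yc t c) \<and>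
     (\<forall>s\<in>{a..c}. 0 < vc t s) \<and> (\<forall>s\<in>{a..<t}. dc t s < 0) \<and> (\<forall>s\<in>{t<..c}. 0 < dc t s))"

lemma branch_height_exists:
  assumes t: "t \<in> I"
  shows "\<exists>K. branch_height t K"
proof -
  obtain \<delta> where \<delta>: "\<delta> > 0" and est: "\<And>s. \<bar>s - t\<bar> < \<delta> \<Longrightarrow> s \<in> I \<and>
    \<bar>vc t s - 1\<bar> \<le> 1 * \<bar>\<sigma> s - \<sigma> t\<bar> \<and> \<bar>dc t s - (\<sigma> s - \<sigma> t)\<bar> \<le> 1 * \<bar>\<sigma> s - \<sigma> t\<bar>^2"
    using local_expansion[OF t zero_less_one] by blast
  have "isCont \<sigma> t" using \<sigma>_deriv[OF t] by (rule DERIV_isCont)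
  then obtain \<eta> where \<eta>: "\<eta> > 0" "\<And>s. \<bar>s - t\<bar> < \<eta> \<Longrightarrow> \<bar>\<sigma> s - \<sigma> t\<bar> < 1 / 2"
    unfolding continuous_at_eps_delta dist_real_def
    by (metis half_gt_zero_iff zero_less_one)
  define \<rho> where "\<rho> = min \<delta> \<eta> / 2"
  have \<rho>: "0 < \<rho>" "\<rho> < \<delta>" "\<rho> < \<eta>" using \<delta> \<eta> by (auto simp: \<rho>_def)
  have sm: "\<bar>\<sigma> s - \<sigma> t\<bar> < 1 / 2" "s \<in> I" "\<bar>vc t s - 1\<bar> \<le> \<bar>\<sigma> s - \<sigma> t\<bar>"
    "\<bar>dc t s - (\<sigma> s - \<sigma> t)\<bar> \<le> \<bar>\<sigma> s - \<sigma> t\<bar> / 2" if "\<bar>s - t\<bar> \<le> \<rho>" for s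
  proof -
    show 1: "\<bar>\<sigma> s - \<sigma> t\<bar> < 1 / 2" and "s \<in> I" and "\<bar>vc t s - 1\<bar> \<le> \<bar>\<sigma> s - \<sigma> t\<bar>"
      using \<eta>(2)[of s] est[of s] that \<rho> by auto
    have "\<bar>\<sigma> s - \<sigma> t\<bar>^2 \<le> \<bar>\<sigma> s - \<sigma> t\<bar> * (1 / 2)"
      unfolding power2_eq_square using 1 by (intro mult_left_mono) auto
    then show "\<bar>dc t s - (\<sigma> s - \<sigma> t)\<bar> \<le> \<bar>\<sigma> s - \<sigma> t\<bar> / 2"
      using est[of s] that \<rho> by auto
  qed
  have "0 < vc t s" if "s \<in> {t - \<rho>..t + \<rho>}" for s
    using sm(1,3)[of s] that by (auto simp: abs_le_iff)
  moreover have "dc t s < 0" if "s \<in> {t - \<rho>..<t}" for s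
  proof -
    have "\<bar>s - t\<bar> \<le> \<rho>" using that by auto
    then show ?thesis
      using abs_le_D1[OF sm(4)[of s]] \<sigma>_mono[OF sm(2)[of s] t] that by auto
  qed
  moreover have "0 < dc t s" if "s \<in> {t<..t + \<rho>}" for s
  proof -
    have "\<bar>s - t\<bar> \<le> \<rho>" using that by auto
    then show ?thesis
      using abs_le_D2[OF sm(4)[of s]] \<sigma>_mono[OF t sm(2)[of s]] that by auto
  qed
  ultimately show ?thesis
    unfolding branch_height_def using sm(2)[of "t - \<rho>"] sm(2)[of "t + \<rho>"] \<rho>(1)
    by (intro exI[of _ "min (yc t (t - \<rho>)) (yc t (t + \<rho>))"] exI[of _ "t - \<rho>"] exI[of _ "t + \<rho>"]) auto
qed

context
  fixes t K :: real
  assumes t: "t \<in> I" and bh: "branch_height t K"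
begin

lemma branch_height_pos: "0 < K"
  using bh yc_pos[OF t] by (auto simp: branch_height_def)

lemma sr_branch:
  shows sr_props: "\<And>k. 0 \<le> k \<Longrightarrow> k < K \<Longrightarrow> sr t k \<in> I \<and> t \<le> sr t k \<and> yc t (sr t k) = k"
    and sr_unique: "\<And>s. s \<in> I \<Longrightarrow> t \<le> s \<Longrightarrow> yc t s < K \<Longrightarrow> sr t (yc t s) = s"
    and sr_cont: "continuous_on {0..<K} (sr t)"
    and sr_signs: "\<And>k. 0 < k \<Longrightarrow> k < K \<Longrightarrow> t < sr t k \<and> 0 < vc t (sr t k) \<and> 0 < dc t (sr t k) \<and> 0 < xc t (sr t k)"
    and sr_deriv: "\<And>k. 0 < k \<Longrightarrow> k < K \<Longrightarrow>
      (sr t has_real_derivative 1 / (r (sr t k) * dc t (sr t k))) (at k)"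
proof -
  from bh obtain a c where ac: "a \<in> I" "c \<in> I" "a < t" "t < c" "K = min (yc t a) (yc t c)"
    and v: "\<And>s. s \<in> {a..c} \<Longrightarrow> 0 < vc t s" and d: "\<And>s. s \<in> {t<..c} \<Longrightarrow> 0 < dc t s"
    unfolding branch_height_def by blast
  have inI: "s \<in> I" if "s \<in> {a..c}" for s using between_in_I[OF ac(1,2)] that by auto
  have mono: "yc t p < yc t q" if "t \<le> p" "p < q" "q \<le> c" for p q
  proof (rule DERIV_pos_imp_increasing_open[OF that(2)])
    show "\<exists>y. (yc t has_real_derivative y) (at s) \<and> 0 < y" if "p < s" "s < q" for s
      using yc_deriv[OF inI, of s] d[of s] r_pos[OF inI, of s] that \<open>t \<le> p\<close> \<open>q \<le> c\<close> ac
      by (intro exI[of _ "r s * dc t s"]) auto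
    show "continuous_on {p..q} (yc t)"
      using that inI ac by (intro continuous_on_subset[OF yc_cont]) auto
  qed
  have inj: "inj_on (yc t) {t..c}"
    by (rule linorder_inj_onI') (use mono in fastforce)
  have local: "s \<le> c" if "s \<in> I" "t \<le> s" "yc t s < K" for s
    using height_away[OF ac(1,2) that(1) ac(3,4)] that ac(3,5)
    by (cases "c < s") (auto simp: yc_def)
  have uniq: "p = q" if "p \<in> I" "t \<le> p" "q \<in> I" "t \<le> q" "yc t p = yc t q" "yc t q < K" for p q
    using inj_onD[OF inj that(5)] local[of p] local[of q] that by auto
  show uniq': "sr t (yc t s) = s" if "s \<in> I" "t \<le> s" "yc t s < K" for s
    unfolding sr_def by (rule the_equality) (use that uniq in auto)
  have props: "sr t k \<in> {t..c} \<and> yc t (sr t k) = k" if k: "0 \<le> k" "k < K" for k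
  proof -
    have "continuous_on {t..c} (yc t)"
      using inI ac by (intro continuous_on_subset[OF yc_cont]) auto
    then obtain s where "t \<le> s" "s \<le> c" "yc t s = k"
      using IVT'[of "yc t" t k c] k ac by auto
    with uniq'[of s] inI[of s] k ac show ?thesis by auto
  qed
  then show p: "sr t k \<in> I \<and> t \<le> sr t k \<and> yc t (sr t k) = k" if "0 \<le> k" "k < K" for k
    using inI[of "sr t k"] that ac by fastforce
  have der: "(yc t has_real_derivative r s * dc t s) (at s)" if "s \<in> {t..c}" for s
    using yc_deriv[OF inI, of s] that ac by auto
  note br = inverse_branch[OF der inj, of K "sr t"]
  show "continuous_on {0..<K} (sr t)" by (rule br(1)) (use props in auto)
  show sg: "t < sr t k \<and> 0 < vc t (sr t k) \<and> 0 < dc t (sr t k) \<and> 0 < xc t (sr t k)"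
    if k: "0 < k" "k < K" for k
  proof -
    have s: "t \<le> sr t k" "sr t k \<le> c" "yc t (sr t k) = k" using props[of k] k by auto
    then have lt: "t < sr t k" using k by (cases "sr t k = t") auto
    have "xc t t < xc t (sr t k)"
    proof (rule DERIV_pos_imp_increasing[OF lt])
      fix u assume "t \<le> u" "u \<le> sr t k"
      then show "\<exists>y. (xc t has_real_derivative y) (at u) \<and> 0 < y"
        using xc_deriv[OF inI, of u] v[of u] r_pos[OF inI, of u] s ac
        by (intro exI[of _ "r u * vc t u"]) auto
    qed
    then show ?thesis using lt v[of "sr t k"] d[of "sr t k"] s ac by auto
  qed
  fix k assume k: "0 < k" "k < K"
  show "(sr t has_real_derivative 1 / (r (sr t k) * dc t (sr t k))) (at k)"
    by (rule br(2)) (use props k sg[OF k] r_pos[of "sr t k"] p[of k] in auto)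
qed

lemma sl_branch:
  shows sl_props: "\<And>k. 0 \<le> k \<Longrightarrow> k < K \<Longrightarrow> sl t k \<in> I \<and> sl t k \<le> t \<and> yc t (sl t k) = k"
    and sl_unique: "\<And>s. s \<in> I \<Longrightarrow> s \<le> t \<Longrightarrow> yc t s < K \<Longrightarrow> sl t (yc t s) = s"
    and sl_cont: "continuous_on {0..<K} (sl t)"
    and sl_signs: "\<And>k. 0 < k \<Longrightarrow> k < K \<Longrightarrow> sl t k < t \<and> 0 < vc t (sl t k) \<and> dc t (sl t k) < 0 \<and> xc t (sl t k) < 0"
    and sl_deriv: "\<And>k. 0 < k \<Longrightarrow> k < K \<Longrightarrow>
      (sl t has_real_derivative 1 / (r (sl t k) * dc t (sl t k))) (at k)"
proof -
  from bh obtain a c where ac: "a \<in> I" "c \<in> I" "a < t" "t < c" "K = min (yc t a) (yc t c)"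
    and v: "\<And>s. s \<in> {a..c} \<Longrightarrow> 0 < vc t s" and d: "\<And>s. s \<in> {a..<t} \<Longrightarrow> dc t s < 0"
    unfolding branch_height_def by blast
  have inI: "s \<in> I" if "s \<in> {a..c}" for s using between_in_I[OF ac(1,2)] that by auto
  have mono: "yc t q < yc t p" if "a \<le> p" "p < q" "q \<le> t" for p q
  proof (rule DERIV_neg_imp_decreasing_open[OF that(2)])
    show "\<exists>y. (yc t has_real_derivative y) (at s) \<and> y < 0" if "p < s" "s < q" for s
      using yc_deriv[OF inI, of s] d[of s] r_pos[OF inI, of s] that \<open>a \<le> p\<close> \<open>q \<le> t\<close> ac
      by (intro exI[of _ "r s * dc t s"]) (auto simp: mult_pos_neg)
    show "continuous_on {p..q} (yc t)"
      using that inI ac by (intro continuous_on_subset[OF yc_cont]) auto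
  qed
  have inj: "inj_on (yc t) {a..t}"
    by (rule linorder_inj_onI') (use mono in fastforce)
  have local: "a \<le> s" if "s \<in> I" "s \<le> t" "yc t s < K" for s
    using height_away[OF ac(1,2) that(1) ac(3,4)] that ac(3,5)
    by (cases "s < a") (auto simp: yc_def)
  have uniq: "p = q" if "p \<in> I" "p \<le> t" "q \<in> I" "q \<le> t" "yc t p = yc t q" "yc t q < K" for p q
    using inj_onD[OF inj that(5)] local[of p] local[of q] that by auto
  show uniq': "sl t (yc t s) = s" if "s \<in> I" "s \<le> t" "yc t s < K" for s
    unfolding sl_def by (rule the_equality) (use that uniq in auto)
  have props: "sl t k \<in> {a..t} \<and> yc t (sl t k) = k" if k: "0 \<le> k" "k < K" for k
  proof -
    have "continuous_on {a..t} (yc t)"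
      using inI ac by (intro continuous_on_subset[OF yc_cont]) auto
    then obtain s where "a \<le> s" "s \<le> t" "yc t s = k"
      using IVT2'[of "yc t" t k a] k ac by auto
    with uniq'[of s] inI[of s] k ac show ?thesis by auto
  qed
  then show p: "sl t k \<in> I \<and> sl t k \<le> t \<and> yc t (sl t k) = k" if "0 \<le> k" "k < K" for k
    using inI[of "sl t k"] that ac by fastforce
  have der: "(yc t has_real_derivative r s * dc t s) (at s)" if "s \<in> {a..t}" for s
    using yc_deriv[OF inI, of s] that ac by auto
  note br = inverse_branch[OF der inj, of K "sl t"]
  show "continuous_on {0..<K} (sl t)" by (rule br(1)) (use props in auto)
  show sg: "sl t k < t \<and> 0 < vc t (sl t k) \<and> dc t (sl t k) < 0 \<and> xc t (sl t k) < 0"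
    if k: "0 < k" "k < K" for k
  proof -
    have s: "a \<le> sl t k" "sl t k \<le> t" "yc t (sl t k) = k" using props[of k] k by auto
    then have lt: "sl t k < t" using k by (cases "sl t k = t") auto
    have "xc t (sl t k) < xc t t"
    proof (rule DERIV_pos_imp_increasing[OF lt])
      fix u assume "sl t k \<le> u" "u \<le> t"
      then show "\<exists>y. (xc t has_real_derivative y) (at u) \<and> 0 < y"
        using xc_deriv[OF inI, of u] v[of u] r_pos[OF inI, of u] s ac
        by (intro exI[of _ "r u * vc t u"]) auto
    qed
    then show ?thesis using lt v[of "sl t k"] d[of "sl t k"] s ac by auto
  qed
  fix k assume k: "0 < k" "k < K"
  show "(sl t has_real_derivative 1 / (r (sl t k) * dc t (sl t k))) (at k)"
    by (rule br(2)) (use props k sg[OF k] r_pos[of "sl t k"] p[of k] in auto)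
qed

end

end

section \<open>Areas in unimodular affine coordinates\<close>

lemma distr_vec2_pair:
  "distr lborel borel (\<lambda>z::real^2. (z$1, z$2)) = (lborel :: (real \<times> real) measure)"
proof (rule lborel_eqI[symmetric])
  let ?f = "\<lambda>z::real^2. (z$1, z$2)"
  have m: "?f \<in> borel_measurable borel"
    by (intro borel_measurable_continuous_onI continuous_intros)
  fix l u :: "real \<times> real"
  assume lu: "\<And>b. b \<in> Basis \<Longrightarrow> l \<bullet> b \<le> u \<bullet> b"
  obtain l1 l2 u1 u2 where l: "l = (l1, l2)" and u: "u = (u1, u2)" by (metis surj_pair)
  have le: "l1 \<le> u1" "l2 \<le> u2"
    using lu[of "(1, 0)"] lu[of "(0, 1)"] by (auto simp: l u Basis_prod_def)
  have B: "(Basis :: (real^2) set) = {axis 1 1, axis 2 1}"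
    by (auto simp: Basis_vec_def UNIV_2)
  have ne: "axis 1 1 \<noteq> (axis 2 1 :: real^2)"
    by (simp add: axis_eq_axis)
  have "?f -` box l u = box (vector [l1, l2]) (vector [u1, u2])"
    by (auto simp: mem_box(1)[of _ "(l1, l2)"] mem_box_cart forall_2 l u Basis_prod_def)
  then have "emeasure (distr lborel borel ?f) (box l u)
      = emeasure lborel (box (vector [l1, l2] :: real^2) (vector [u1, u2]))"
    using m by (simp add: emeasure_distr)
  also have "\<dots> = ennreal ((u1 - l1) * (u2 - l2))"
    using le by (subst emeasure_lborel_box) (auto simp: B ne inner_axis)
  also have "(u1 - l1) * (u2 - l2) = (\<Prod>b\<in>Basis. (u - l) \<bullet> b)"
    by (simp add: l u Basis_prod_def)
  finally show "emeasure (distr lborel borel ?f) (box l u) = (\<Prod>b\<in>Basis. (u - l) \<bullet> b)" .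
qed simp

text \<open>The coordinates of \<open>Q - P\<close> in the basis \<open>(u, w)\<close> preserve area, since the determinant of the
  basis is \<open>\<plusminus>1\<close>.\<close>

lemma measure_affine_coords:
  fixes B :: "(real \<times> real) set"
  assumes e: "e = 1 \<or> e = -1" and 1: "crs e u w = 1" and B: "B \<in> sets borel" "bounded B"
  shows "measure lebesgue {Q. (crs e (Q - P) w, crs e u (Q - P)) \<in> B} = measure lborel B"
proof -
  let ?f = "\<lambda>z::real^2. (z$1, z$2)"
  have m: "?f \<in> borel_measurable borel"
    by (intro borel_measurable_continuous_onI continuous_intros)
  define Z where "Z = ?f -` B"
  have Zb: "Z \<in> sets borel" using measurable_sets[OF m B(1)] by (simp add: Z_def)
  have "measure lborel B = measure (distr lborel borel ?f) B"
    by (simp add: distr_vec2_pair)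
  also have "\<dots> = measure lborel Z"
    using m B by (simp add: measure_distr Z_def)
  also have "\<dots> = measure lebesgue Z"
    using Zb by (simp add: measure_completion)
  finally have mZ: "measure lebesgue Z = measure lborel B" by simp
  have "bounded Z"
  proof -
    obtain b where b: "\<And>p. p \<in> B \<Longrightarrow> norm p \<le> b" using B(2) by (auto simp: bounded_iff)
    have "norm z \<le> b" if "z \<in> Z" for z
    proof -
      have "norm z = norm (?f z)"
        by (simp add: norm_vec_def L2_set_def sum_2 norm_Pair)
      then show ?thesis using b[of "?f z"] that by (simp add: Z_def)
    qed
    then show ?thesis by (auto simp: bounded_iff)
  qed
  then have Zl: "Z \<in> lmeasurable"
    using Zb by (intro bounded_set_imp_lmeasurable) auto
  let ?L = "\<lambda>z::real^2. z$1 *\<^sub>R u + z$2 *\<^sub>R w"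
  have lin: "linear ?L"
    by (auto intro!: linearI simp: algebra_simps)
  have "det (matrix ?L) = u$1 * w$2 - u$2 * w$1"
    by (simp add: det_2 matrix_def axis_def)
  then have det: "\<bar>det (matrix ?L)\<bar> = 1"
    using 1 e by (auto simp: crs_def)
  have "{Q. (crs e (Q - P) w, crs e u (Q - P)) \<in> B} = (+) P ` ?L ` Z"
  proof (intro set_eqI iffI)
    fix Q assume "Q \<in> {Q. (crs e (Q - P) w, crs e u (Q - P)) \<in> B}"
    then have "vector [crs e (Q - P) w, crs e u (Q - P)] \<in> Z"
      by (simp add: Z_def)
    moreover have "Q = P + ?L (vector [crs e (Q - P) w, crs e u (Q - P)])"
      using crs_expand[OF e 1, of "Q - P"] by simp
    ultimately show "Q \<in> (+) P ` ?L ` Z" by blast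
  next
    fix Q assume "Q \<in> (+) P ` ?L ` Z"
    then obtain z where z: "z \<in> Z" "Q = P + ?L z" by blast
    have "crs e (?L z) w = z$1" "crs e u (?L z) = z$2"
      using 1 by (simp_all add: crs.add_left crs.add_right crs.scaleR_left crs.scaleR_right)
    then show "Q \<in> {Q. (crs e (Q - P) w, crs e u (Q - P)) \<in> B}"
      using z by (simp add: Z_def)
  qed
  then have "measure lebesgue {Q. (crs e (Q - P) w, crs e u (Q - P)) \<in> B} = measure lebesgue (?L ` Z)"
    by (simp only: measure_translation)
  also have "\<dots> = measure lebesgue Z"
    using measure_linear_image[OF lin Zl] det by simp
  finally show ?thesis using mZ by simp
qed

text \<open>Cavalieri's principle, slicing parallel to the first axis. Both the open and the closed
  region between two graphs qualify as \<open>B\<close>.\<close>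

lemma measure_between_graphs:
  fixes f g :: "real \<Rightarrow> real"
  assumes ab: "a < b" and B: "B \<in> sets borel"
    and lower: "\<And>x y. a < y \<Longrightarrow> y < b \<Longrightarrow> f y < x \<Longrightarrow> x < g y \<Longrightarrow> (x, y) \<in> B"
    and upper: "\<And>x y. (x, y) \<in> B \<Longrightarrow> a \<le> y \<and> y \<le> b \<and> f y \<le> x \<and> x \<le> g y"
    and le: "\<And>y. a \<le> y \<Longrightarrow> y \<le> b \<Longrightarrow> f y \<le> g y"
    and int: "((\<lambda>y. g y - f y) has_integral J) {a..b}"
  shows "measure lborel B = J"
proof -
  have J: "0 \<le> J" using has_integral_nonneg[OF int] le by auto
  have "emeasure lborel B = emeasure (lborel \<Otimes>\<^sub>M lborel) B" by (simp add: lborel_prod)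
  also have "\<dots> = (\<integral>\<^sup>+y. emeasure lborel ((\<lambda>x. (x, y)) -` B) \<partial>lborel)"
    by (rule lborel_pair.emeasure_pair_measure_alt2) (simp only: lborel_prod sets_lborel B)
  also have "\<dots> = (\<integral>\<^sup>+y. ennreal (indicator {a..b} y * (g y - f y)) \<partial>lborel)"
  proof (rule nn_integral_cong_AE)
    have "AE y in lborel. y \<noteq> a" "AE y in lborel. y \<noteq> b"
      by (rule AE_lborel_singleton)+
    then show "AE y in lborel. emeasure lborel ((\<lambda>x. (x, y)) -` B)
        = ennreal (indicator {a..b} y * (g y - f y))"
    proof eventually_elim
      case (elim y)
      show ?case
      proof (cases "a < y \<and> y < b")
        case True
        have "emeasure lborel ((\<lambda>x. (x, y)) -` B) = ennreal (g y - f y)"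
        proof (rule antisym)
          have "(\<lambda>x. (x, y)) -` B \<in> sets borel"
            using measurable_sets[of "\<lambda>x. (x, y)" borel borel B] B by simp
          have "emeasure lborel ((\<lambda>x. (x, y)) -` B) \<le> emeasure lborel {f y..g y}"
            by (rule emeasure_mono) (use upper in auto)
          also have "\<dots> = ennreal (g y - f y)" using le[of y] True by simp
          finally show "emeasure lborel ((\<lambda>x. (x, y)) -` B) \<le> ennreal (g y - f y)" .
          have "ennreal (g y - f y) = emeasure lborel {f y<..<g y}" using le[of y] True by simp
          also have "\<dots> \<le> emeasure lborel ((\<lambda>x. (x, y)) -` B)"
            by (rule emeasure_mono) (use lower True \<open>(\<lambda>x. (x, y)) -` B \<in> sets borel\<close> in auto)
          finally show "ennreal (g y - f y) \<le> emeasure lborel ((\<lambda>x. (x, y)) -` B)" .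
        qed
        then show ?thesis using True by simp
      next
        case False
        then have out: "y < a \<or> b < y" using elim by auto
        then have "(\<lambda>x. (x, y)) -` B = {}" using upper by fastforce
        then show ?thesis using out by auto
      qed
    qed
  qed
  also have "\<dots> = ennreal J"
    by (rule nn_integral_has_integral_lebesgue[OF _ int]) (use le in auto)
  finally show ?thesis using J by (simp add: measure_def)
qed

lemma ray_not_inside:
  fixes u :: "'a::real_normed_vector"
  assumes u: "u \<noteq> 0" and ray: "\<And>c. 0 \<le> c \<Longrightarrow> Q + c *\<^sub>R u \<notin> C"
  shows "Q \<notin> inside C"
proof
  assume "Q \<in> inside C"
  then have bd: "bounded (connected_component_set (- C) Q)" by (simp add: inside_def)
  let ?R = "(\<lambda>c. Q + c *\<^sub>R u) ` {0..}"
  have "connected ?R"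
    by (intro connected_continuous_image continuous_intros convex_connected) auto
  moreover have "Q \<in> ?R" by (auto intro!: image_eqI[of _ _ 0])
  ultimately have "?R \<subseteq> connected_component_set (- C) Q"
    using ray by (intro connected_component_maximal) auto
  then have "bounded ?R" using bd bounded_subset by blast
  then obtain b where b: "\<And>c. 0 \<le> c \<Longrightarrow> norm (Q + c *\<^sub>R u) \<le> b"
    by (auto simp: bounded_iff)
  define c where "c = (\<bar>b\<bar> + norm Q + 1) / norm u"
  have c: "0 \<le> c" "norm (c *\<^sub>R u) = \<bar>b\<bar> + norm Q + 1"
    using u by (auto simp: c_def divide_nonneg_pos)
  have "norm (c *\<^sub>R u) \<le> norm (Q + c *\<^sub>R u) + norm Q"
    by (metis add_diff_cancel_left' norm_triangle_ineq4)
  then show False using b[OF c(1)] c(2) by linarith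
qed

text \<open>The Jordan curve formed by two graphs over the second axis that start at a common point, and
  the horizontal chord joining their end points. Horizontal rays witness the exterior.\<close>

lemma
  fixes f g :: "real \<Rightarrow> real" and u w P :: "real^2"
  assumes e: "e = 1 \<or> e = -1" and 1: "crs e u w = 1" and k: "0 < k"
    and contf: "continuous_on {0..k} f" and contg: "continuous_on {0..k} g"
    and start: "f 0 = g 0" and le: "\<And>y. 0 \<le> y \<Longrightarrow> y \<le> k \<Longrightarrow> f y \<le> g y"
  defines "x \<equiv> \<lambda>Q. crs e (Q - P) w" and "y \<equiv> \<lambda>Q. crs e u (Q - P)"
  defines "C \<equiv> {Q. 0 \<le> y Q \<and> y Q \<le> k \<and> f (y Q) \<le> x Q \<and> x Q \<le> g (y Q) \<and>
      (x Q = f (y Q) \<or> x Q = g (y Q) \<or> y Q = k)}"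
  shows inside_between_graphs:
      "inside C = {Q. 0 < y Q \<and> y Q < k \<and> f (y Q) < x Q \<and> x Q < g (y Q)}" (is "_ = ?F")
    and measure_inside_between_graphs:
      "measure lebesgue (inside C) = integral {0..k} (\<lambda>y. g y - f y)"
proof -
  define cl where "cl = (\<lambda>s. max 0 (min k s))"
  have cl: "cl s \<in> {0..k}" "0 \<le> s \<Longrightarrow> s \<le> k \<Longrightarrow> cl s = s" for s using k by (auto simp: cl_def)
  have clc: "continuous_on UNIV cl" unfolding cl_def by (intro continuous_intros)
  have contf': "continuous_on UNIV (\<lambda>s. f (cl s))"
    by (rule continuous_on_compose2[OF contf clc]) (use cl in auto)
  have contg': "continuous_on UNIV (\<lambda>s. g (cl s))"
    by (rule continuous_on_compose2[OF contg clc]) (use cl in auto)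
  have cx: "continuous_on UNIV x" and cy: "continuous_on UNIV y"
    unfolding x_def y_def
    by (intro crs.continuous_on continuous_intros)+
  have fy: "continuous_on UNIV (\<lambda>Q. f (cl (y Q)))" and gy: "continuous_on UNIV (\<lambda>Q. g (cl (y Q)))"
    using continuous_on_compose2[OF contf' cy] continuous_on_compose2[OF contg' cy] by auto
  let ?G = "{Q. 0 \<le> y Q \<and> y Q \<le> k \<and> f (cl (y Q)) \<le> x Q \<and> x Q \<le> g (cl (y Q))}"
  have Feq: "?F = {Q. 0 < y Q \<and> y Q < k \<and> f (cl (y Q)) < x Q \<and> x Q < g (cl (y Q))}"
    using cl(2) by (auto simp: less_imp_le)
  have openF: "open ?F"
    unfolding Feq by (intro open_Collect_conj open_Collect_less cx cy fy gy continuous_intros)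
  have closedG: "closed ?G"
    by (intro closed_Collect_conj closed_Collect_le cx cy fy gy continuous_intros)
  have "?F \<subseteq> ?G" unfolding Feq by auto
  then have "closure ?F \<subseteq> ?G" using closedG closure_minimal by blast
  moreover have "?G - ?F \<subseteq> C"
  proof
    fix Q assume Q: "Q \<in> ?G - ?F"
    then have *: "0 \<le> y Q" "y Q \<le> k" "f (y Q) \<le> x Q" "x Q \<le> g (y Q)" using cl(2) by auto
    moreover have "x Q = f (y Q) \<or> x Q = g (y Q) \<or> y Q = k"
    proof (cases "y Q = 0")
      case True then show ?thesis using * start by auto
    next
      case False then show ?thesis using * Q by fastforce
    qed
    ultimately show "Q \<in> C" by (simp add: C_def)
  qed
  ultimately have frontier: "frontier ?F \<subseteq> C"
    using openF by (auto simp: frontier_def interior_open)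
  obtain M where M: "\<And>s. 0 \<le> s \<Longrightarrow> s \<le> k \<Longrightarrow> \<bar>f s\<bar> \<le> M \<and> \<bar>g s\<bar> \<le> M"
  proof -
    have "bounded (f ` {0..k})" "bounded (g ` {0..k})"
      using contf contg by (auto intro!: compact_imp_bounded compact_continuous_image)
    then obtain Mf Mg where "\<forall>s\<in>{0..k}. \<bar>f s\<bar> \<le> Mf" "\<forall>s\<in>{0..k}. \<bar>g s\<bar> \<le> Mg"
      unfolding bounded_iff by auto
    then show ?thesis using that[of "max Mf Mg"] by (meson atLeastAtMost_iff max.coboundedI1 max.coboundedI2)
  qed
  let ?B = "{p::real\<times>real. 0 < snd p \<and> snd p < k \<and> f (cl (snd p)) < fst p \<and> fst p < g (cl (snd p))}"
  have B_sub: "?B \<subseteq> {-M..M} \<times> {0..k}"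
  proof clarify
    fix a b assume "0 < snd (a, b)" "snd (a, b) < k" "f (cl (snd (a, b))) < fst (a, b)" "fst (a, b) < g (cl (snd (a, b)))"
    moreover from this have "cl b = b" using cl(2)[of b] by auto
    ultimately show "a \<in> {-M..M} \<and> b \<in> {0..k}" using M[of b] by auto
  qed
  have bB: "bounded ?B"
    by (rule bounded_subset[OF _ B_sub]) (intro bounded_Times; simp)
  have F_B: "?F = {Q. (x Q, y Q) \<in> ?B}" unfolding Feq by simp
  have bF: "bounded ?F"
  proof -
    have "?F \<subseteq> (\<lambda>p. P + (fst p *\<^sub>R u + snd p *\<^sub>R w)) ` ({-M..M} \<times> {0..k})"
    proof
      fix Q assume "Q \<in> ?F"
      then have "(x Q, y Q) \<in> {-M..M} \<times> {0..k}" using B_sub F_B by blast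
      moreover have "Q = P + (x Q *\<^sub>R u + y Q *\<^sub>R w)"
        using crs_expand[OF e 1, of "Q - P"] by (simp add: x_def y_def)
      ultimately show "Q \<in> (\<lambda>p. P + (fst p *\<^sub>R u + snd p *\<^sub>R w)) ` ({-M..M} \<times> {0..k})"
        by (metis (no_types, lifting) fst_conv image_eqI snd_conv)
    qed
    moreover have "compact ((\<lambda>p. P + (fst p *\<^sub>R u + snd p *\<^sub>R w)) ` ({-M..M} \<times> {0..k}))"
      by (intro compact_continuous_image continuous_intros compact_Times compact_Icc)
    ultimately show ?thesis using bounded_subset compact_imp_bounded by blast
  qed
  have u0: "u \<noteq> 0" using 1 by (auto simp: crs.zero_left)
  have shift: "x (Q + c *\<^sub>R u) = x Q + c" "y (Q + c *\<^sub>R u) = y Q" for Q c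
  proof -
    have *: "Q + c *\<^sub>R u - P = (Q - P) + c *\<^sub>R u" by simp
    show "x (Q + c *\<^sub>R u) = x Q + c" "y (Q + c *\<^sub>R u) = y Q"
      unfolding x_def y_def * using 1
      by (simp_all add: crs.add_left crs.add_right crs.scaleR_left crs.scaleR_right)
  qed
  show ins: "inside C = ?F"
  proof (intro set_eqI iffI)
    fix Q assume Q: "Q \<in> ?F"
    have nC: "Q \<notin> C" using Q by (auto simp: C_def)
    let ?K = "connected_component_set (- C) Q"
    have "Q \<in> ?K" using nC by simp
    then have "?K \<subseteq> ?F"
      using connected_Int_frontier[of ?K ?F] frontier Q connected_component_subset[of "- C" Q]
      by blast
    then show "Q \<in> inside C" using nC bF bounded_subset by (auto simp: inside_def)
  next
    fix Q assume "Q \<in> inside C"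
    then have nC: "Q \<notin> C" and ray: "\<And>v. v \<noteq> 0 \<Longrightarrow> \<exists>c\<ge>0. Q + c *\<^sub>R v \<in> C"
      using ray_not_inside[of _ Q C] by (auto simp: inside_def)
    obtain c where c: "0 \<le> c" "Q + c *\<^sub>R u \<in> C" using ray[OF u0] by blast
    obtain d where "0 \<le> d" "Q + d *\<^sub>R (- u) \<in> C" using ray[of "- u"] u0 by auto
    then have d: "0 \<le> d" "Q + (- d) *\<^sub>R u \<in> C" by auto
    have "0 \<le> y Q" "y Q \<le> k" "x Q + c \<le> g (y Q)" "f (y Q) \<le> x Q - d"
      using c(2) d(2) unfolding C_def mem_Collect_eq shift by auto
    then have *: "0 \<le> y Q" "y Q \<le> k" "x Q \<le> g (y Q)" "f (y Q) \<le> x Q" using c d by auto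
    with nC have "x Q \<noteq> f (y Q)" "x Q \<noteq> g (y Q)" "y Q \<noteq> k" by (auto simp: C_def)
    moreover have "y Q \<noteq> 0" using * start \<open>x Q \<noteq> f (y Q)\<close> by auto
    ultimately show "Q \<in> ?F" using * by auto
  qed
  have oB: "open ?B"
    by (intro open_Collect_conj open_Collect_less continuous_intros
        continuous_on_compose2[OF contf'] continuous_on_compose2[OF contg']) auto
  have "measure lborel ?B = integral {0..k} (\<lambda>y. g y - f y)"
  proof (rule measure_between_graphs[OF k])
    show "((\<lambda>y. g y - f y) has_integral integral {0..k} (\<lambda>y. g y - f y)) {0..k}"
      by (intro integrable_integral integrable_continuous_real continuous_intros contf contg)
  qed (use oB le cl(2) in auto)
  moreover have "measure lebesgue ?F = measure lborel ?B"
    unfolding F_B using measure_affine_coords[OF e 1 _ bB, of P] oB by (simp add: x_def y_def)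
  ultimately show "measure lebesgue (inside C) = integral {0..k} (\<lambda>y. g y - f y)"
    by (simp add: ins)
qed

text \<open>The two parallel sides, from \<open>A\<^sub>1\<close> to \<open>A\<^sub>2\<close> and from \<open>B\<^sub>1\<close> to \<open>B\<^sub>2\<close>, have the same direction, so the hull
  is the trapezoid with these sides.\<close>

lemma measure_trapezoid:
  fixes u w P A\<^sub>1 A\<^sub>2 B\<^sub>1 B\<^sub>2 :: "real^2"
  assumes e: "e = 1 \<or> e = -1" and 1: "crs e u w = 1" and k: "0 < k"
  defines "x \<equiv> \<lambda>Q. crs e (Q - P) w" and "y \<equiv> \<lambda>Q. crs e u (Q - P)"
  assumes y: "y A\<^sub>1 = k" "y A\<^sub>2 = k" "y B\<^sub>1 = 0" "y B\<^sub>2 = 0"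
    and le: "x A\<^sub>1 \<le> x A\<^sub>2" "x B\<^sub>1 \<le> x B\<^sub>2"
  shows "measure lebesgue (convex hull {A\<^sub>1, A\<^sub>2, B\<^sub>2, B\<^sub>1}) = k * ((x A\<^sub>2 - x A\<^sub>1) + (x B\<^sub>2 - x B\<^sub>1)) / 2"
proof -
  define f g where "f = (\<lambda>s. (1 - s / k) * x B\<^sub>1 + s / k * x A\<^sub>1)"
    and "g = (\<lambda>s. (1 - s / k) * x B\<^sub>2 + s / k * x A\<^sub>2)"
  let ?T = "{p::real\<times>real. 0 \<le> snd p \<and> snd p \<le> k \<and> f (snd p) \<le> fst p \<and> fst p \<le> g (snd p)}"
  have fg: "f s \<le> g s" if "0 \<le> s" "s \<le> k" for s
    unfolding f_def g_def using that k le by (intro add_mono mult_left_mono) auto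
  have fconv: "f (a * s + b * s') = a * f s + b * f s'" "g (a * s + b * s') = a * g s + b * g s'"
    if "a + b = 1" for a b s s'
    using that k unfolding f_def g_def by (simp_all add: field_simps) algebra+
  have xconv: "x (a *\<^sub>R Q + b *\<^sub>R Q') = a * x Q + b * x Q'" "y (a *\<^sub>R Q + b *\<^sub>R Q') = a * y Q + b * y Q'"
    if "a + b = 1" for a b Q Q'
  proof -
    have "P = a *\<^sub>R P + b *\<^sub>R P" using that by (metis scaleR_left_distrib scaleR_one)
    then have *: "a *\<^sub>R Q + b *\<^sub>R Q' - P = a *\<^sub>R (Q - P) + b *\<^sub>R (Q' - P)"
      by (simp add: algebra_simps)
    show "x (a *\<^sub>R Q + b *\<^sub>R Q') = a * x Q + b * x Q'" "y (a *\<^sub>R Q + b *\<^sub>R Q') = a * y Q + b * y Q'"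
      unfolding x_def y_def *
      by (simp_all add: crs.add_left crs.add_right crs.scaleR_left crs.scaleR_right)
  qed
  have inj: "Q = Q'" if "x Q = x Q'" "y Q = y Q'" for Q Q'
    using crs_expand[OF e 1, of "Q - P"] crs_expand[OF e 1, of "Q' - P"] that
    by (simp add: x_def y_def)
  have hull: "convex hull {A\<^sub>1, A\<^sub>2, B\<^sub>2, B\<^sub>1} = {Q. (x Q, y Q) \<in> ?T}"
  proof
    have "convex {Q. (x Q, y Q) \<in> ?T}"
    proof (rule convexI)
      fix Q Q' and a b :: real
      assume Q: "Q \<in> {Q. (x Q, y Q) \<in> ?T}" "Q' \<in> {Q. (x Q, y Q) \<in> ?T}" and ab: "0 \<le> a" "0 \<le> b" "a + b = 1"
      have "a * y Q + b * y Q' \<le> a * k + b * k"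
        using Q ab by (intro add_mono mult_left_mono) auto
      also have "\<dots> = k" using ab by (simp flip: distrib_right)
      finally show "a *\<^sub>R Q + b *\<^sub>R Q' \<in> {Q. (x Q, y Q) \<in> ?T}"
        using Q ab by (auto simp: xconv fconv intro!: add_mono mult_left_mono)
    qed
    moreover have "{A\<^sub>1, A\<^sub>2, B\<^sub>2, B\<^sub>1} \<subseteq> {Q. (x Q, y Q) \<in> ?T}"
      using y le k by (auto simp: f_def g_def)
    ultimately show "convex hull {A\<^sub>1, A\<^sub>2, B\<^sub>2, B\<^sub>1} \<subseteq> {Q. (x Q, y Q) \<in> ?T}"
      by (intro hull_minimal)
  next
    show "{Q. (x Q, y Q) \<in> ?T} \<subseteq> convex hull {A\<^sub>1, A\<^sub>2, B\<^sub>2, B\<^sub>1}"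
    proof
      fix Q assume "Q \<in> {Q. (x Q, y Q) \<in> ?T}"
      then have Q: "0 \<le> y Q" "y Q \<le> k" "f (y Q) \<le> x Q" "x Q \<le> g (y Q)" by auto
      let ?H = "convex hull {A\<^sub>1, A\<^sub>2, B\<^sub>2, B\<^sub>1}"
      define c where "c = y Q / k"
      have c: "0 \<le> c" "c \<le> 1" "c * k = y Q" using Q k by (auto simp: c_def)
      define L R where "L = (1 - c) *\<^sub>R B\<^sub>1 + c *\<^sub>R A\<^sub>1" and "R = (1 - c) *\<^sub>R B\<^sub>2 + c *\<^sub>R A\<^sub>2"
      have LR: "L \<in> ?H" "R \<in> ?H"
        unfolding L_def R_def using c
        by (auto intro!: convexD[OF convex_convex_hull] intro: hull_inc)
      have xy: "x L = f (y Q)" "x R = g (y Q)" "y L = y Q" "y R = y Q"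
        using y c by (simp_all add: L_def R_def xconv f_def g_def c_def)
      have "x Q \<in> closed_segment (x L) (x R)"
        using Q xy by (simp add: closed_segment_eq_real_ivl)
      then obtain m where m: "0 \<le> m" "m \<le> 1" "x Q = (1 - m) * x L + m * x R"
        by (auto simp: closed_segment_def)
      have "y Q = (1 - m) * y L + m * y R" using xy by (simp add: algebra_simps)
      then have "Q = (1 - m) *\<^sub>R L + m *\<^sub>R R"
        by (intro inj) (use m(3) in \<open>simp_all add: xconv\<close>)
      also have "\<dots> \<in> ?H"
        using m LR by (auto intro!: convexD[OF convex_convex_hull])
      finally show "Q \<in> ?H" .
    qed
  qed
  have cont: "continuous_on UNIV f" "continuous_on UNIV g"
    unfolding f_def g_def using k by (auto intro!: continuous_intros)
  have closed: "closed ?T"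
    by (intro closed_Collect_conj closed_Collect_le continuous_intros
        continuous_on_compose2[OF cont(1)] continuous_on_compose2[OF cont(2)]) auto
  have bT: "bounded ?T"
  proof -
    have "bounded (f ` {0..k})" "bounded (g ` {0..k})"
      by (auto intro!: compact_imp_bounded compact_continuous_image continuous_on_subset[OF cont(1)]
          continuous_on_subset[OF cont(2)])
    then obtain Mf Mg where M: "\<forall>s\<in>{0..k}. \<bar>f s\<bar> \<le> Mf" "\<forall>s\<in>{0..k}. \<bar>g s\<bar> \<le> Mg"
      unfolding bounded_iff by auto
    have "?T \<subseteq> {-Mf..Mg} \<times> {0..k}"
    proof clarify
      fix a b assume "0 \<le> snd (a, b)" "snd (a, b) \<le> k" "f (snd (a, b)) \<le> fst (a, b)" "fst (a, b) \<le> g (snd (a, b))"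
      then show "a \<in> {-Mf..Mg} \<and> b \<in> {0..k}" using bspec[OF M(1), of b] bspec[OF M(2), of b] by auto
    qed
    then show ?thesis by (rule bounded_subset[rotated]) (intro bounded_Times; simp)
  qed
  have area: "measure lborel ?T = k * ((x A\<^sub>2 - x A\<^sub>1) + (x B\<^sub>2 - x B\<^sub>1)) / 2"
  proof (rule measure_between_graphs[OF k])
    define G where "G = (\<lambda>s. (s - s^2 / (2 * k)) * (x B\<^sub>2 - x B\<^sub>1) + s^2 / (2 * k) * (x A\<^sub>2 - x A\<^sub>1))"
    have "(G has_vector_derivative g s - f s) (at s within {0..k})" for s
      unfolding has_real_derivative_iff_has_vector_derivative[symmetric] G_def f_def g_def
      using k by (auto intro!: derivative_eq_intros simp: field_simps)
    then have "((\<lambda>s. g s - f s) has_integral G k - G 0) {0..k}"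
      using k by (intro fundamental_theorem_of_calculus) auto
    moreover have "G k - G 0 = k * ((x A\<^sub>2 - x A\<^sub>1) + (x B\<^sub>2 - x B\<^sub>1)) / 2"
      using k by (simp add: G_def power2_eq_square field_simps)
    ultimately show "((\<lambda>s. g s - f s) has_integral k * ((x A\<^sub>2 - x A\<^sub>1) + (x B\<^sub>2 - x B\<^sub>1)) / 2) {0..k}"
      by simp
  qed (use fg closed in auto)
  have "measure lebesgue {Q. (x Q, y Q) \<in> ?T} = measure lborel ?T"
    unfolding x_def y_def
    by (rule measure_affine_coords[OF e 1 _ bT]) (use closed in auto)
  then show ?thesis unfolding hull area .
qed

section \<open>The segment and the trapezoid in affine coordinates\<close>

text \<open>The quarter turn in the direction given by \<open>e\<close>; it represents \<open>crs e\<close> by the inner product.\<close>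

definition rot :: "real \<Rightarrow> real^2 \<Rightarrow> real^2" where
  "rot e u = vector [- e * u$2, e * u$1]"

lemma inner_rot: "rot e u \<bullet> v = crs e u v"
  by (simp add: rot_def crs_def inner_vec_def sum_2 algebra_simps)

lemma norm_rot: "e = 1 \<or> e = -1 \<Longrightarrow> norm (rot e u) = norm u"
  by (auto simp: rot_def norm_vec_def L2_set_def sum_2 add.commute)

lemma unit_normal_cases:
  fixes n u :: "real^2"
  assumes e: "e = 1 \<or> e = -1" and u: "u \<noteq> 0" and n: "norm n = 1" "n \<bullet> u = 0"
  shows "n = rot e u /\<^sub>R norm u \<or> n = - (rot e u /\<^sub>R norm u)"
proof -
  have ee: "e * e = 1" using e by auto
  have nu: "n$1 * u$1 + n$2 * u$2 = 0" using n by (simp add: inner_vec_def sum_2)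
  define c where "c = crs e u n"
  have uu: "u \<bullet> u = u$1 * u$1 + u$2 * u$2" by (simp add: inner_vec_def sum_2)
  have "(u \<bullet> u) * n$1 = c * (- e * u$2)" "(u \<bullet> u) * n$2 = c * (e * u$1)"
    using ee nu unfolding uu c_def crs_def by algebra+
  then have eq: "(u \<bullet> u) *\<^sub>R n = c *\<^sub>R rot e u"
    by (simp add: vec_eq_iff forall_2 rot_def)
  then have "norm ((u \<bullet> u) *\<^sub>R n) = norm (c *\<^sub>R rot e u)" by simp
  then have "norm u ^ 2 = \<bar>c\<bar> * norm u"
    using n norm_rot[OF e, of u] by (simp add: power2_norm_eq_inner)
  then have "\<bar>c\<bar> = norm u" using u by (simp add: power2_eq_square)
  moreover have "n = (c / (u \<bullet> u)) *\<^sub>R rot e u"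
    using eq u by (metis divide_inverse_commute inner_eq_zero_iff left_inverse scaleR_one scaleR_scaleR)
  then have "n = (c / (norm u * norm u)) *\<^sub>R rot e u"
    by (simp add: power2_norm_eq_inner[symmetric] power2_eq_square)
  moreover from \<open>\<bar>c\<bar> = norm u\<close>
  have "c / (norm u * norm u) = inverse (norm u) \<or> c / (norm u * norm u) = - inverse (norm u)"
    using u by (auto simp: abs_if field_simps split: if_splits)
  ultimately show ?thesis by (metis scaleR_minus_left)
qed

context affine_frame_curve
begin

lemma velocity_eq: "t \<in> I \<Longrightarrow> velocity X t = r t *\<^sub>R V t"
  by (rule vector_derivative_at[OF X_deriv])

lemma convex_normal_eq:
  assumes t: "t \<in> I"
  shows "convex_normal X I t = rot e (V t) /\<^sub>R norm (V t)"
proof -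
  let ?n = "rot e (V t) /\<^sub>R norm (V t)"
  have "is_convex_side_normal X I t ?n"
    unfolding is_convex_side_normal_def velocity_eq[OF t]
    using norm_rot[OF sign, of "V t"] V_nonzero[OF t] support[OF t]
    by (auto simp: inner_rot inner_commute[of "X _ - X t"])
  moreover have "n = ?n" if n: "is_convex_side_normal X I t n" for n
  proof (rule ccontr)
    assume "n \<noteq> ?n"
    then have n': "n = - ?n"
      using unit_normal_cases[OF sign V_nonzero[OF t], of n] n r_pos[OF t]
      by (auto simp: is_convex_side_normal_def velocity_eq[OF t])
    obtain d where d: "d > 0" "ball t d \<subseteq> I" using open_I t open_contains_ball by blast
    have s: "t + d / 2 \<in> I" using d by (auto simp: subset_iff dist_real_def)
    have "0 < (X (t + d / 2) - X t) \<bullet> ?n"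
      using support_strict[OF t s] d V_nonzero[OF t]
      by (simp add: inner_commute[of "X _ - X t"] inner_rot)
    moreover have "0 \<le> (X (t + d / 2) - X t) \<bullet> n"
      using n s by (auto simp: is_convex_side_normal_def)
    ultimately show False by (simp add: n')
  qed
  ultimately show ?thesis
    unfolding convex_normal_def by (rule the_equality)
qed

lemma mem_line_V:
  assumes t: "t \<in> I" and c: "c \<noteq> 0"
  shows "Q \<in> line P (c *\<^sub>R V t) \<longleftrightarrow> crs e (V t) (Q - P) = 0"
proof
  assume "Q \<in> line P (c *\<^sub>R V t)"
  then show "crs e (V t) (Q - P) = 0" by (auto simp: line_def crs.scaleR_right)
next
  assume 0: "crs e (V t) (Q - P) = 0"
  have "Q = P + crs e (Q - P) (A t) *\<^sub>R V t"
    using crs_expand[OF sign crs_VA[OF t], of "Q - P"] 0 by simp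
  then have "Q = P + (crs e (Q - P) (A t) / c) *\<^sub>R (c *\<^sub>R V t)"
    using c by simp
  then show "Q \<in> line P (c *\<^sub>R V t)" unfolding line_def by blast
qed

lemma mem_parallel_line:
  assumes t: "t \<in> I"
  shows "Q \<in> parallel_line X I t h \<longleftrightarrow> crs e (V t) (Q - X t) = norm (V t) * h"
proof -
  have "crs e (V t) (rot e (V t)) = norm (V t) * norm (V t)"
    by (metis inner_rot norm_rot[OF sign] power2_eq_square power2_norm_eq_inner)
  then have "crs e (V t) (Q - (X t + h *\<^sub>R convex_normal X I t)) = crs e (V t) (Q - X t) - norm (V t) * h"
    using V_nonzero[OF t]
    by (simp add: convex_normal_eq[OF t] crs.diff_right crs.add_right crs.scaleR_right algebra_simps)
  then show ?thesis
    unfolding parallel_line_def velocity_eq[OF t] using mem_line_V[OF t, of "r t"] r_pos[OF t] by simp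
qed

text \<open>For \<open>h > 0\<close> the point \<open>t\<close> itself is not on the parallel line, so it makes no difference that \<open>sl\<close> and
  \<open>sr\<close> admit it.\<close>

lemma param_eq:
  assumes t: "t \<in> I" and h: "0 < h"
  shows "param1 X I t h = sl t (norm (V t) * h)" "param2 X I t h = sr t (norm (V t) * h)"
proof -
  have k: "0 < norm (V t) * h" using V_nonzero[OF t] h by simp
  have *: "yc t a = norm (V t) * h \<Longrightarrow> a \<noteq> t" for a using k by auto
  show "param1 X I t h = sl t (norm (V t) * h)"
    unfolding param1_def sl_def mem_parallel_line[OF t] yc_def[symmetric]
    by (intro arg_cong[where f = The] ext) (use * in \<open>auto simp: less_le\<close>)
  show "param2 X I t h = sr t (norm (V t) * h)"
    unfolding param2_def sr_def mem_parallel_line[OF t] yc_def[symmetric]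
    by (intro arg_cong[where f = The] ext) (use * in \<open>auto simp: less_le\<close>)
qed

lemma mem_tangent_line: "s \<in> I \<Longrightarrow> Q \<in> tangent_line X s \<longleftrightarrow> crs e (V s) (Q - X s) = 0"
  unfolding tangent_line_def by (simp add: velocity_eq) (metis less_irrefl mem_line_V r_pos)

lemma tangent_point_coords:
  "crs e (V t) (X s - c *\<^sub>R V s - X t) = yc t s - c * dc t s"
  "crs e (X s - c *\<^sub>R V s - X t) (A t) = xc t s - c * vc t s"
proof -
  have *: "X s - c *\<^sub>R V s - X t = (X s - X t) - c *\<^sub>R V s" by simp
  show "crs e (V t) (X s - c *\<^sub>R V s - X t) = yc t s - c * dc t s"
    unfolding * crs.diff_right[of e _ "X s - X t"] by (simp add: yc_def dc_def crs.scaleR_right)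
  show "crs e (X s - c *\<^sub>R V s - X t) (A t) = xc t s - c * vc t s"
    unfolding * crs.diff_left[of e "X s - X t"] by (simp add: xc_def vc_def crs.scaleR_left)
qed

lemma tangent_intersection_eq:
  assumes t: "t \<in> I" and s: "s \<in> I" and d: "dc t s \<noteq> 0"
  shows "tangent_intersection X t s = X s - (yc t s / dc t s) *\<^sub>R V s"
proof -
  let ?B = "X s - (yc t s / dc t s) *\<^sub>R V s"
  have B: "crs e (V t) (?B - X t) = 0"
    using d by (simp add: tangent_point_coords)
  have "tangent_line X t \<inter> tangent_line X s = {?B}"
  proof (intro set_eqI iffI)
    fix Q assume "Q \<in> tangent_line X t \<inter> tangent_line X s"
    then have Q: "crs e (V t) (Q - X t) = 0" "crs e (V s) (Q - X s) = 0"
      using mem_tangent_line[OF t] mem_tangent_line[OF s] by auto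
    define c where "c = crs e (Q - X s) (A s)"
    have c: "Q = X s + c *\<^sub>R V s"
      using crs_expand[OF sign crs_VA[OF s], of "Q - X s"] Q by (simp add: c_def algebra_simps)
    have "yc t s + c * dc t s = 0"
      using Q(1) by (simp add: c yc_def dc_def crs.diff_right crs.add_right crs.scaleR_right algebra_simps)
    then have "c = - (yc t s / dc t s)" using d by (simp add: field_simps)
    then show "Q \<in> {?B}" using c by simp
  next
    fix Q assume "Q \<in> {?B}"
    then show "Q \<in> tangent_line X t \<inter> tangent_line X s"
      using B mem_tangent_line[OF t] mem_tangent_line[OF s]
      by (auto simp: crs.minus_right crs.scaleR_right)
  qed
  then show ?thesis unfolding tangent_intersection_def by auto
qed

text \<open>The length of the chord at height \<open>k\<close>, measured in multiples of \<open>V t\<close>, and its derivative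
  with respect to \<open>k\<close>.\<close>

definition chord :: "real \<Rightarrow> real \<Rightarrow> real" where
  "chord t k = xc t (sr t k) - xc t (sl t k)"

definition chord' :: "real \<Rightarrow> real \<Rightarrow> real" where
  "chord' t k = vc t (sr t k) / dc t (sr t k) - vc t (sl t k) / dc t (sl t k)"

context
  fixes t K :: real
  assumes t: "t \<in> I" and bh: "branch_height t K"
begin

lemma branch_start: "sr t 0 = t" "sl t 0 = t"
  using sr_unique[OF t bh t] sl_unique[OF t bh t] branch_height_pos[OF t bh] by auto

lemma cont_branches: "continuous_on {0..<K} (\<lambda>k. xc t (sr t k))" "continuous_on {0..<K} (\<lambda>k. xc t (sl t k))"
  by (rule continuous_on_compose2[OF xc_cont sr_cont[OF t bh]],
      use sr_props[OF t bh] in force,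
      rule continuous_on_compose2[OF xc_cont sl_cont[OF t bh]],
      use sl_props[OF t bh] in force)

lemma chord_cont: "continuous_on {0..<K} (chord t)"
  unfolding chord_def[abs_def] by (intro continuous_intros cont_branches)

lemma along_branch_deriv:
  assumes k: "0 < k" "k < K" and F: "\<And>s. s \<in> I \<Longrightarrow> (F has_real_derivative r s * G s) (at s)"
  shows "((\<lambda>k. F (sr t k)) has_real_derivative G (sr t k) / dc t (sr t k)) (at k)"
    and "((\<lambda>k. F (sl t k)) has_real_derivative G (sl t k) / dc t (sl t k)) (at k)"
proof -
  have R: "sr t k \<in> I" "r (sr t k) > 0" and L: "sl t k \<in> I" "r (sl t k) > 0"
    using sr_props[OF t bh, of k] sl_props[OF t bh, of k] k r_pos by auto
  show "((\<lambda>k. F (sr t k)) has_real_derivative G (sr t k) / dc t (sr t k)) (at k)"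
    using DERIV_chain2[OF F[OF R(1)] sr_deriv[OF t bh k]] R(2) by (simp add: field_simps)
  show "((\<lambda>k. F (sl t k)) has_real_derivative G (sl t k) / dc t (sl t k)) (at k)"
    using DERIV_chain2[OF F[OF L(1)] sl_deriv[OF t bh k]] L(2) by (simp add: field_simps)
qed

lemma chord_deriv:
  assumes k: "0 < k" "k < K"
  shows "(chord t has_real_derivative chord' t k) (at k)"
  unfolding chord_def[abs_def] chord'_def
  by (intro DERIV_diff along_branch_deriv[OF k] xc_deriv)

text \<open>The boundary of the segment below height \<open>k\<close>, as a Jordan curve formed by two graphs and a chord.\<close>

lemma arc_coords:
  assumes k: "0 < k" "k < K"
  shows "X ` {sl t k..sr t k} \<union> closed_segment (X (sl t k)) (X (sr t k))
    = {Q. 0 \<le> crs e (V t) (Q - X t) \<and> crs e (V t) (Q - X t) \<le> k \<and>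
        xc t (sl t (crs e (V t) (Q - X t))) \<le> crs e (Q - X t) (A t) \<and>
        crs e (Q - X t) (A t) \<le> xc t (sr t (crs e (V t) (Q - X t))) \<and>
        (crs e (Q - X t) (A t) = xc t (sl t (crs e (V t) (Q - X t))) \<or>
         crs e (Q - X t) (A t) = xc t (sr t (crs e (V t) (Q - X t))) \<or>
         crs e (V t) (Q - X t) = k)}" (is "?L = ?R")
proof -
  have le: "xc t (sl t j) \<le> xc t (sr t j)" if "0 \<le> j" "j < K" for j
    using sl_signs[OF t bh, of j] sr_signs[OF t bh, of j] that branch_start
    by (cases "j = 0") auto
  have inj: "Q = Q'" if "crs e (Q - X t) (A t) = crs e (Q' - X t) (A t)"
    "crs e (V t) (Q - X t) = crs e (V t) (Q' - X t)" for Q Q'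
    using crs_expand[OF sign crs_VA[OF t], of "Q - X t"] crs_expand[OF sign crs_VA[OF t], of "Q' - X t"] that
    by simp
  have L: "sl t k \<in> I" "sl t k \<le> t" "yc t (sl t k) = k" and R: "sr t k \<in> I" "t \<le> sr t k" "yc t (sr t k) = k"
    using sl_props[OF t bh, of k] sr_props[OF t bh, of k] k by auto
  have onC: "X (sl t j) \<in> ?R" "X (sr t j) \<in> ?R" if j: "0 \<le> j" "j \<le> k" for j
    using sl_props[OF t bh, of j] sr_props[OF t bh, of j] le[of j] j k
    by (auto simp: xc_def[symmetric] yc_def[symmetric])
  have arc: "X s \<in> ?R" if s: "s \<in> {sl t k..sr t k}" for s
  proof (cases "t \<le> s")
    case True
    have "\<exists>j\<ge>0. j \<le> k \<and> sr t j = s"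
      by (rule IVT') (use True s k branch_start in \<open>auto intro: continuous_on_subset[OF sr_cont[OF t bh]]\<close>)
    then show ?thesis using onC by blast
  next
    case False
    have "\<exists>j\<ge>0. j \<le> k \<and> sl t j = s"
      by (rule IVT2') (use False s k branch_start in \<open>auto intro: continuous_on_subset[OF sl_cont[OF t bh]]\<close>)
    then show ?thesis using onC by blast
  qed
  have seg: "Q \<in> closed_segment (X (sl t k)) (X (sr t k)) \<longleftrightarrow>
      crs e (V t) (Q - X t) = k \<and> xc t (sl t k) \<le> crs e (Q - X t) (A t) \<and>
      crs e (Q - X t) (A t) \<le> xc t (sr t k)" for Q
  proof
    assume "Q \<in> closed_segment (X (sl t k)) (X (sr t k))"
    then obtain m where m: "0 \<le> m" "m \<le> 1" "Q = (1 - m) *\<^sub>R X (sl t k) + m *\<^sub>R X (sr t k)"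
      by (auto simp: closed_segment_def)
    have *: "Q - X t = (1 - m) *\<^sub>R (X (sl t k) - X t) + m *\<^sub>R (X (sr t k) - X t)"
      by (simp add: m(3) algebra_simps)
    have "crs e (V t) (Q - X t) = k"
      unfolding * crs.add_right crs.scaleR_right yc_def[symmetric] L(3) R(3)
      by (simp add: algebra_simps)
    moreover have **: "crs e (Q - X t) (A t) = (1 - m) * xc t (sl t k) + m * xc t (sr t k)"
      unfolding * by (simp add: crs.add_left crs.scaleR_left xc_def)
    moreover have "xc t (sl t k) \<le> (1 - m) * xc t (sl t k) + m * xc t (sr t k)"
      "(1 - m) * xc t (sl t k) + m * xc t (sr t k) \<le> xc t (sr t k)"
      using m le[of k] k convex_bound_le[of "xc t (sl t k)" "xc t (sr t k)" "xc t (sr t k)" "1 - m" m]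
        mult_left_mono[of "xc t (sl t k)" "xc t (sr t k)" m]
      by (auto simp: algebra_simps)
    ultimately show "crs e (V t) (Q - X t) = k \<and> xc t (sl t k) \<le> crs e (Q - X t) (A t) \<and>
      crs e (Q - X t) (A t) \<le> xc t (sr t k)" by simp
  next
    assume Q: "crs e (V t) (Q - X t) = k \<and> xc t (sl t k) \<le> crs e (Q - X t) (A t) \<and>
      crs e (Q - X t) (A t) \<le> xc t (sr t k)"
    then have "crs e (Q - X t) (A t) \<in> closed_segment (xc t (sl t k)) (xc t (sr t k))"
      by (simp add: closed_segment_eq_real_ivl)
    then obtain m where m: "0 \<le> m" "m \<le> 1"
      "crs e (Q - X t) (A t) = (1 - m) * xc t (sl t k) + m * xc t (sr t k)"
      by (auto simp: closed_segment_def)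
    let ?Q = "(1 - m) *\<^sub>R X (sl t k) + m *\<^sub>R X (sr t k)"
    have *: "?Q - X t = (1 - m) *\<^sub>R (X (sl t k) - X t) + m *\<^sub>R (X (sr t k) - X t)"
      by (simp add: algebra_simps)
    have "Q = ?Q"
    proof (rule inj)
      show "crs e (Q - X t) (A t) = crs e (?Q - X t) (A t)"
        unfolding * m(3) by (simp add: crs.add_left crs.scaleR_left xc_def)
      show "crs e (V t) (Q - X t) = crs e (V t) (?Q - X t)"
        unfolding * crs.add_right crs.scaleR_right yc_def[symmetric] L(3) R(3)
        using Q by (simp add: algebra_simps)
    qed
    then show "Q \<in> closed_segment (X (sl t k)) (X (sr t k))"
      using m by (auto simp: closed_segment_def)
  qed
  show ?thesis
  proof (intro equalityI subsetI)
    fix Q assume "Q \<in> ?L"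
    then show "Q \<in> ?R"
    proof
      assume "Q \<in> X ` {sl t k..sr t k}"
      then show ?thesis using arc by blast
    next
      assume "Q \<in> closed_segment (X (sl t k)) (X (sr t k))"
      then show ?thesis using seg[of Q] k by simp
    qed
  next
    fix Q assume Q: "Q \<in> ?R"
    define j where "j = crs e (V t) (Q - X t)"
    have j: "0 \<le> j" "j \<le> k" using Q by (auto simp: j_def)
    have Lj: "sl t j \<le> t" "yc t (sl t j) = j" and Rj: "t \<le> sr t j" "yc t (sr t j) = j"
      using sl_props[OF t bh, of j] sr_props[OF t bh, of j] j k by auto
    show "Q \<in> ?L"
    proof (cases "j = k")
      case True
      then show ?thesis using Q seg[of Q] by (auto simp: j_def)
    next
      case False
      then have "crs e (Q - X t) (A t) = xc t (sl t j) \<or> crs e (Q - X t) (A t) = xc t (sr t j)"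
        using Q by (auto simp: j_def)
      then have QX: "Q = X (sl t j) \<or> Q = X (sr t j)"
        using inj[of Q "X (sl t j)"] inj[of Q "X (sr t j)"] Lj(2) Rj(2) j_def
        unfolding xc_def yc_def by argo
      have "sl t k \<le> sl t j"
      proof (rule ccontr)
        assume "\<not> ?thesis"
        then have "\<exists>i\<ge>0. i \<le> j \<and> sl t i = sl t k"
          using Lj L j k branch_start
          by (intro IVT2') (auto intro: continuous_on_subset[OF sl_cont[OF t bh]])
        then obtain i where "0 \<le> i" "i \<le> j" "sl t i = sl t k" by blast
        then show False using sl_props[OF t bh, of i] L j k False by auto
      qed
      moreover have "sr t j \<le> sr t k"
      proof (rule ccontr)
        assume "\<not> ?thesis"
        then have "\<exists>i\<ge>0. i \<le> j \<and> sr t i = sr t k"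
          using Rj R j k branch_start
          by (intro IVT') (auto intro: continuous_on_subset[OF sr_cont[OF t bh]])
        then obtain i where "0 \<le> i" "i \<le> j" "sr t i = sr t k" by blast
        then show False using sr_props[OF t bh, of i] R j k False by auto
      qed
      ultimately show ?thesis using QX Lj Rj L R by auto
    qed
  qed
qed

lemma S_area_eq:
  assumes k: "0 < k" "k < K" and h: "k = norm (V t) * h"
  shows "S_area X I t h = integral {0..k} (chord t)"
proof -
  have "0 < h" using k h V_nonzero[OF t] by (simp add: zero_less_mult_iff)
  have le: "xc t (sl t j) \<le> xc t (sr t j)" if "0 \<le> j" "j \<le> k" for j
    using sl_signs[OF t bh, of j] sr_signs[OF t bh, of j] that branch_start k
    by (cases "j = 0") auto
  have sub: "{0..k} \<subseteq> {0..<K}" using k by auto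
  show ?thesis
    unfolding S_area_def Let_def param_eq[OF t \<open>0 < h\<close>] h[symmetric] arc_coords[OF k] chord_def[abs_def]
    by (rule measure_inside_between_graphs[OF sign crs_VA[OF t] k(1)
          continuous_on_subset[OF cont_branches(2) sub] continuous_on_subset[OF cont_branches(1) sub]])
      (use branch_start le in auto)
qed

lemma W_area_eq:
  assumes k: "0 < k" "k < K" and h: "k = norm (V t) * h"
  shows "W_area X I t h = k * chord t k - k^2 * chord' t k / 2"
proof -
  have "0 < h" using k h V_nonzero[OF t] by (simp add: zero_less_mult_iff)
  define p q where "p = sl t k" and "q = sr t k"
  have L: "p \<in> I" "yc t p = k" "dc t p < 0" "xc t p < 0" and R: "q \<in> I" "yc t q = k" "0 < dc t q" "0 < xc t q"
    using sl_props[OF t bh, of k] sr_props[OF t bh, of k] sl_signs[OF t bh k] sr_signs[OF t bh k] k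
    by (auto simp: p_def q_def)
  have B: "tangent_intersection X t p = X p - (k / dc t p) *\<^sub>R V p"
    "tangent_intersection X t q = X q - (k / dc t q) *\<^sub>R V q"
    using tangent_intersection_eq[OF t] L R by auto
  have yB: "crs e (V t) (X s - (k / dc t s) *\<^sub>R V s - X t) = 0" if "yc t s = k" "dc t s \<noteq> 0" for s
    using that by (simp add: tangent_point_coords)
  have xB: "crs e (X s - (k / dc t s) *\<^sub>R V s - X t) (A t) = xc t s - k * (vc t s / dc t s)" for s
    by (simp add: tangent_point_coords)
  \<comment> \<open>The point of tangency at \<open>t\<close> lies on the convex side of the tangents at the two end points.\<close>
  have supp: "0 \<le> xc t s * dc t s - k * vc t s" if s: "s \<in> I" "yc t s = k" for s
  proof -
    have "crs e (V s) (X t - X s) = crs e (vc t s *\<^sub>R V t + dc t s *\<^sub>R A t) (- (xc t s *\<^sub>R V t + k *\<^sub>R A t))"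
      using V_coords[OF t, of s] X_coords[OF t, of s] s(2) by (metis minus_diff_eq)
    also have "\<dots> = xc t s * dc t s - k * vc t s"
      using crs_VA[OF t] crs_skew[of e "A t" "V t"]
      by (simp add: crs.add_left crs.add_right crs.scaleR_left crs.scaleR_right crs.minus_right crs.diff_right algebra_simps)
    finally show ?thesis using support[OF s(1) t] by simp
  qed
  have "xc t p - k * (vc t p / dc t p) \<le> 0"
    using supp[OF L(1,2)] L(3) by (simp add: field_simps)
  moreover have "0 \<le> xc t q - k * (vc t q / dc t q)"
    using supp[OF R(1,2)] R(3) by (simp add: field_simps)
  ultimately have le: "xc t p - k * (vc t p / dc t p) \<le> xc t q - k * (vc t q / dc t q)" by linarith
  have "W_area X I t h = measure lebesgue (convex hull {X p, X q, X q - (k / dc t q) *\<^sub>R V q, X p - (k / dc t p) *\<^sub>R V p})"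
    unfolding W_area_def Let_def param_eq[OF t \<open>0 < h\<close>] h[symmetric] p_def[symmetric] q_def[symmetric] B ..
  also have "\<dots> = k * ((xc t q - xc t p) + ((xc t q - k * (vc t q / dc t q)) - (xc t p - k * (vc t p / dc t p)))) / 2"
    using measure_trapezoid[OF sign crs_VA[OF t] k(1), of "X p" "X t" "X q"
        "X p - (k / dc t p) *\<^sub>R V p" "X q - (k / dc t q) *\<^sub>R V q"] L R le yB
    by (simp add: xB yc_def[symmetric] xc_def[symmetric])
  also have "\<dots> = k * chord t k - k^2 * chord' t k / 2"
    by (simp add: chord_def chord'_def p_def q_def power2_eq_square field_simps)
  finally show ?thesis .
qed

end

end

section \<open>Expansion of the branches at small height\<close>

lemma eventually_at_right_0I:
  assumes "0 < b" "\<And>k. 0 < k \<Longrightarrow> k < b \<Longrightarrow> P k"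
  shows "eventually P (at_right (0::real))"
  unfolding eventually_at_right_field using assms by blast

lemma sqrt_height_expansion:
  fixes \<tau> \<kappa> \<eta> :: real
  assumes \<kappa>: "0 < \<kappa>" and \<tau>: "0 < \<tau>" "\<tau> \<le> 1" and \<eta>: "0 < \<eta>" "\<eta> \<le> 1 / 8"
    and y: "\<bar>\<kappa>^2 / 2 - \<tau>^2 / 2\<bar> \<le> \<eta> * \<tau>^3"
  shows "\<bar>\<tau> - \<kappa>\<bar> \<le> 4 * \<eta> * \<kappa>^2" "\<tau>^2 \<le> 2 * \<kappa>^2" "\<tau> \<le> 2 * \<kappa>"
proof -
  have "\<bar>\<tau> - \<kappa>\<bar> * \<tau> \<le> \<bar>\<tau> - \<kappa>\<bar> * (\<tau> + \<kappa>)"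
    using \<kappa> by (intro mult_left_mono) auto
  also have "\<dots> = \<bar>\<kappa>^2 - \<tau>^2\<bar>"
  proof -
    have "\<kappa>^2 - \<tau>^2 = - ((\<tau> - \<kappa>) * (\<tau> + \<kappa>))" by (simp add: power2_eq_square algebra_simps)
    then show ?thesis using \<kappa> \<tau> by (simp add: abs_mult)
  qed
  also have "\<dots> \<le> 2 * \<eta> * \<tau>^2 * \<tau>"
    using y by (simp add: power2_eq_square power3_eq_cube abs_if field_simps split: if_splits)
  finally have 1: "\<bar>\<tau> - \<kappa>\<bar> \<le> 2 * \<eta> * \<tau>^2" using \<tau> by simp
  have "\<tau>^2 \<le> \<tau>" using \<tau> by (simp add: power2_eq_square mult_left_le)
  then have "2 * \<eta> * \<tau>^2 \<le> 2 * (1 / 8) * \<tau>"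
    using \<eta> \<tau> by (intro mult_mono) auto
  with 1 have "\<tau> - \<kappa> \<le> \<tau> / 4" by linarith
  then have \<tau>\<kappa>: "\<tau> \<le> 4 / 3 * \<kappa>" by linarith
  then show "\<tau> \<le> 2 * \<kappa>" using \<kappa> by linarith
  have "\<tau>^2 \<le> (4 / 3 * \<kappa>)^2" using \<tau>\<kappa> \<tau> by (intro power_mono) auto
  then have "\<tau>^2 \<le> 16 / 9 * \<kappa>^2" by (simp add: power_mult_distrib power2_eq_square)
  then show 2: "\<tau>^2 \<le> 2 * \<kappa>^2" using zero_le_power2[of \<kappa>] by linarith
  have "2 * \<eta> * \<tau>^2 \<le> 2 * \<eta> * (2 * \<kappa>^2)" using 2 \<eta> by (intro mult_left_mono) auto
  with 1 show "\<bar>\<tau> - \<kappa>\<bar> \<le> 4 * \<eta> * \<kappa>^2" by linarith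
qed

context affine_frame_curve
begin

context
  fixes t K :: real
  assumes t: "t \<in> I" and bh: "branch_height t K"
begin

lemma branches_near:
  assumes \<delta>: "0 < \<delta>"
  shows "\<exists>k1>0. k1 \<le> K \<and> (\<forall>k. 0 < k \<and> k < k1 \<longrightarrow> \<bar>sr t k - t\<bar> < \<delta> \<and> \<bar>sl t k - t\<bar> < \<delta>)"
proof -
  have K: "0 < K" by (rule branch_height_pos[OF t bh])
  have "\<exists>d>0. \<forall>k\<in>{0..<K}. dist k 0 < d \<longrightarrow> dist (sr t k) (sr t 0) < \<delta>"
    by (rule bspec[OF sr_cont[OF t bh, unfolded continuous_on_iff], rule_format, of 0]) (use K \<delta> in auto)
  then obtain d where d: "d > 0" "\<And>k. 0 \<le> k \<Longrightarrow> k < K \<Longrightarrow> k < d \<Longrightarrow> \<bar>sr t k - t\<bar> < \<delta>"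
    using branch_start[OF t bh] by (auto simp: dist_real_def)
  have "\<exists>d>0. \<forall>k\<in>{0..<K}. dist k 0 < d \<longrightarrow> dist (sl t k) (sl t 0) < \<delta>"
    by (rule bspec[OF sl_cont[OF t bh, unfolded continuous_on_iff], rule_format, of 0]) (use K \<delta> in auto)
  then obtain d' where d': "d' > 0" "\<And>k. 0 \<le> k \<Longrightarrow> k < K \<Longrightarrow> k < d' \<Longrightarrow> \<bar>sl t k - t\<bar> < \<delta>"
    using branch_start[OF t bh] by (auto simp: dist_real_def)
  show ?thesis using d d' K by (intro exI[of _ "min K (min d d')"]) auto
qed

text \<open>With \<open>\<kappa> = sqrt (2 * k)\<close> the end points of the chord at height \<open>k\<close> have \<open>\<sigma> - \<sigma> t\<close>, \<open>dc\<close> and \<open>xc\<close> equal to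
  \<open>\<plusminus>\<kappa> + o(\<kappa>\<^sup>2)\<close> and \<open>vc\<close> equal to \<open>1 + o(\<kappa>)\<close>.\<close>

lemma branch_expansion:
  assumes \<epsilon>: "0 < \<epsilon>" and \<delta>: "0 < \<delta>"
  shows "\<exists>k1>0. k1 \<le> K \<and> (\<forall>k. 0 < k \<and> k < k1 \<longrightarrow>
    \<bar>sr t k - t\<bar> < \<delta> \<and> \<bar>sl t k - t\<bar> < \<delta> \<and>
    \<bar>\<sigma> (sr t k) - \<sigma> t - sqrt (2 * k)\<bar> \<le> \<epsilon> * (2 * k) \<and> \<bar>\<sigma> (sl t k) - \<sigma> t + sqrt (2 * k)\<bar> \<le> \<epsilon> * (2 * k) \<and>
    \<bar>dc t (sr t k) - sqrt (2 * k)\<bar> \<le> \<epsilon> * (2 * k) \<and> \<bar>dc t (sl t k) + sqrt (2 * k)\<bar> \<le> \<epsilon> * (2 * k) \<and>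
    \<bar>xc t (sr t k) - sqrt (2 * k)\<bar> \<le> \<epsilon> * (2 * k) \<and> \<bar>xc t (sl t k) + sqrt (2 * k)\<bar> \<le> \<epsilon> * (2 * k) \<and>
    \<bar>vc t (sr t k) - 1\<bar> \<le> \<epsilon> * sqrt (2 * k) \<and> \<bar>vc t (sl t k) - 1\<bar> \<le> \<epsilon> * sqrt (2 * k))"
proof -
  define \<eta> where "\<eta> = min (\<epsilon> / 8) (1 / 8)"
  have \<eta>: "0 < \<eta>" "\<eta> \<le> 1 / 8" "8 * \<eta> \<le> \<epsilon>" using \<epsilon> by (auto simp: \<eta>_def)
  obtain \<delta>1 where \<delta>1: "\<delta>1 > 0" and est: "\<And>s. \<bar>s - t\<bar> < \<delta>1 \<Longrightarrow> s \<in> I \<and>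
    \<bar>vc t s - 1\<bar> \<le> \<eta> * \<bar>\<sigma> s - \<sigma> t\<bar> \<and> \<bar>dc t s - (\<sigma> s - \<sigma> t)\<bar> \<le> \<eta> * \<bar>\<sigma> s - \<sigma> t\<bar>^2 \<and>
    \<bar>xc t s - (\<sigma> s - \<sigma> t)\<bar> \<le> \<eta> * \<bar>\<sigma> s - \<sigma> t\<bar>^2 \<and>
    \<bar>yc t s - (\<sigma> s - \<sigma> t)^2 / 2\<bar> \<le> \<eta> * \<bar>\<sigma> s - \<sigma> t\<bar>^3"
    using local_expansion[OF t \<eta>(1)] by blast
  have "isCont \<sigma> t" using \<sigma>_deriv[OF t] by (rule DERIV_isCont)
  then obtain \<delta>2 where \<delta>2: "\<delta>2 > 0" "\<And>s. \<bar>s - t\<bar> < \<delta>2 \<Longrightarrow> \<bar>\<sigma> s - \<sigma> t\<bar> < 1"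
    unfolding continuous_at_eps_delta dist_real_def by (meson zero_less_one)
  obtain k1 where k1: "k1 > 0" "k1 \<le> K" "\<And>k. 0 < k \<Longrightarrow> k < k1 \<Longrightarrow>
      \<bar>sr t k - t\<bar> < min \<delta> (min \<delta>1 \<delta>2) \<and> \<bar>sl t k - t\<bar> < min \<delta> (min \<delta>1 \<delta>2)"
    using branches_near[of "min \<delta> (min \<delta>1 \<delta>2)"] \<delta> \<delta>1 \<delta>2 by auto
  have main: "\<bar>\<bar>\<sigma> s - \<sigma> t\<bar> - sqrt (2 * k)\<bar> \<le> \<epsilon> * (2 * k) \<and>
      \<bar>sgn (\<sigma> s - \<sigma> t) * dc t s - sqrt (2 * k)\<bar> \<le> \<epsilon> * (2 * k) \<and>
      \<bar>sgn (\<sigma> s - \<sigma> t) * xc t s - sqrt (2 * k)\<bar> \<le> \<epsilon> * (2 * k) \<and> \<bar>vc t s - 1\<bar> \<le> \<epsilon> * sqrt (2 * k)"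
    if k: "0 < k" and s: "\<bar>s - t\<bar> < \<delta>1" "\<bar>s - t\<bar> < \<delta>2" "yc t s = k" "\<sigma> s \<noteq> \<sigma> t" for s k
  proof -
    define \<kappa> \<tau> where "\<kappa> = sqrt (2 * k)" and "\<tau> = \<bar>\<sigma> s - \<sigma> t\<bar>"
    have \<kappa>: "0 < \<kappa>" "\<kappa>^2 = 2 * k" using k by (auto simp: \<kappa>_def)
    have \<tau>: "0 < \<tau>" "\<tau> \<le> 1" "\<tau>^2 = (\<sigma> s - \<sigma> t)^2"
      using s(4) \<delta>2(2)[OF s(2)] by (auto simp: \<tau>_def)
    have E: "\<bar>vc t s - 1\<bar> \<le> \<eta> * \<tau>" "\<bar>dc t s - (\<sigma> s - \<sigma> t)\<bar> \<le> \<eta> * \<tau>^2"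
      "\<bar>xc t s - (\<sigma> s - \<sigma> t)\<bar> \<le> \<eta> * \<tau>^2" "\<bar>\<kappa>^2 / 2 - \<tau>^2 / 2\<bar> \<le> \<eta> * \<tau>^3"
      using est[OF s(1)] s(3) \<kappa>(2) \<tau>(3) by (auto simp: \<tau>_def)
    note a = sqrt_height_expansion[OF \<kappa>(1) \<tau>(1,2) \<eta>(1,2) E(4)]
    have "\<eta> * \<tau>^2 \<le> \<eta> * (2 * \<kappa>^2)" using a(2) \<eta>(1) by (intro mult_left_mono) auto
    then have b: "\<eta> * \<tau>^2 \<le> 2 * (\<eta> * \<kappa>^2)" by simp
    have "8 * \<eta> * \<kappa>^2 \<le> \<epsilon> * \<kappa>^2" using \<eta>(3) by (intro mult_right_mono) auto
    then have c: "8 * (\<eta> * \<kappa>^2) \<le> \<epsilon> * \<kappa>^2" by simp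
    have pos: "0 \<le> \<eta> * \<kappa>^2" using \<eta>(1) by simp
    have sg: "\<bar>sgn (\<sigma> s - \<sigma> t) * z - \<tau>\<bar> = \<bar>z - (\<sigma> s - \<sigma> t)\<bar>" for z
      using s(4) by (cases "\<sigma> s < \<sigma> t") (auto simp: \<tau>_def sgn_if)
    have "\<eta> * \<tau> \<le> \<eta> * (2 * \<kappa>)" using a(3) \<eta>(1) by (intro mult_left_mono) auto
    also have "\<dots> \<le> (8 * \<eta>) * \<kappa>" using \<eta>(1) \<kappa>(1) by simp
    also have "\<dots> \<le> \<epsilon> * \<kappa>" using \<eta>(3) \<kappa>(1) by (intro mult_right_mono) auto
    finally have "\<bar>vc t s - 1\<bar> \<le> \<epsilon> * \<kappa>" using E(1) by linarith
    moreover have "\<bar>\<tau> - \<kappa>\<bar> \<le> \<epsilon> * \<kappa>^2" using a(1) c pos by linarith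
    moreover have "\<bar>sgn (\<sigma> s - \<sigma> t) * dc t s - \<kappa>\<bar> \<le> \<epsilon> * \<kappa>^2"
      using a(1) b c pos E(2) sg[of "dc t s"] by linarith
    moreover have "\<bar>sgn (\<sigma> s - \<sigma> t) * xc t s - \<kappa>\<bar> \<le> \<epsilon> * \<kappa>^2"
      using a(1) b c pos E(3) sg[of "xc t s"] by linarith
    ultimately show ?thesis unfolding \<kappa>(2) unfolding \<kappa>_def \<tau>_def by blast
  qed
  show ?thesis
  proof (rule exI[of _ k1], rule conjI[OF k1(1)], rule conjI[OF k1(2)], intro allI impI, elim conjE,
      intro conjI)
    fix k assume k: "0 < k" "k < k1"
    then have kK: "k < K" using k1(2) by simp
    note near = k1(3)[OF k]
    show "\<bar>sr t k - t\<bar> < \<delta>" "\<bar>sl t k - t\<bar> < \<delta>" using near by auto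
    have R: "\<sigma> t < \<sigma> (sr t k)" "yc t (sr t k) = k"
      using sr_props[OF t bh _ kK] sr_signs[OF t bh k(1) kK] \<sigma>_mono[OF t, of "sr t k"] k by auto
    have L: "\<sigma> (sl t k) < \<sigma> t" "yc t (sl t k) = k"
      using sl_props[OF t bh _ kK] sl_signs[OF t bh k(1) kK] \<sigma>_mono[OF _ t, of "sl t k"] k by auto
    note mR = main[OF k(1), of "sr t k"] and mL = main[OF k(1), of "sl t k"]
    show "\<bar>\<sigma> (sr t k) - \<sigma> t - sqrt (2 * k)\<bar> \<le> \<epsilon> * (2 * k)" "\<bar>dc t (sr t k) - sqrt (2 * k)\<bar> \<le> \<epsilon> * (2 * k)"
      "\<bar>xc t (sr t k) - sqrt (2 * k)\<bar> \<le> \<epsilon> * (2 * k)" "\<bar>vc t (sr t k) - 1\<bar> \<le> \<epsilon> * sqrt (2 * k)"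
      using mR near R by auto
    have L': "\<bar>\<bar>\<sigma> (sl t k) - \<sigma> t\<bar> - sqrt (2 * k)\<bar> \<le> \<epsilon> * (2 * k)"
      "\<bar>sgn (\<sigma> (sl t k) - \<sigma> t) * dc t (sl t k) - sqrt (2 * k)\<bar> \<le> \<epsilon> * (2 * k)"
      "\<bar>sgn (\<sigma> (sl t k) - \<sigma> t) * xc t (sl t k) - sqrt (2 * k)\<bar> \<le> \<epsilon> * (2 * k)"
      "\<bar>vc t (sl t k) - 1\<bar> \<le> \<epsilon> * sqrt (2 * k)"
      using mL near L by auto
    have sg: "\<bar>\<sigma> (sl t k) - \<sigma> t\<bar> = - (\<sigma> (sl t k) - \<sigma> t)" "sgn (\<sigma> (sl t k) - \<sigma> t) = -1"
      using L(1) by auto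
    show "\<bar>\<sigma> (sl t k) - \<sigma> t + sqrt (2 * k)\<bar> \<le> \<epsilon> * (2 * k)" "\<bar>dc t (sl t k) + sqrt (2 * k)\<bar> \<le> \<epsilon> * (2 * k)"
      "\<bar>xc t (sl t k) + sqrt (2 * k)\<bar> \<le> \<epsilon> * (2 * k)" "\<bar>vc t (sl t k) - 1\<bar> \<le> \<epsilon> * sqrt (2 * k)"
      using L' unfolding sg by (auto simp: abs_le_iff)
  qed
qed

end

end

section \<open>The area equation\<close>

lemma tendsto_of_sqrt_bound:
  assumes "0 < k1" "\<And>k. 0 < k \<Longrightarrow> k < k1 \<Longrightarrow> \<bar>F k - L\<bar> \<le> sqrt (2 * k)"
  shows "(F \<longlongrightarrow> (L::real)) (at_right 0)"
proof -
  have "((\<lambda>k. sqrt (2 * k)) \<longlongrightarrow> sqrt (2 * 0)) (at_right 0)"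
    by (intro tendsto_intros)
  then have lim0: "((\<lambda>k. sqrt (2 * k)) \<longlongrightarrow> 0) (at_right 0)" by simp
  have "\<forall>\<^sub>F k in at_right 0. norm (F k - L) \<le> sqrt (2 * k)"
    by (rule eventually_at_right_0I[OF assms(1)]) (simp only: real_norm_def assms(2))
  from Lim_null_comparison[OF this lim0]
  have "((\<lambda>k. F k - L) \<longlongrightarrow> 0) (at_right 0)" .
  then show ?thesis by (simp add: LIM_zero_iff)
qed

lemma zero_deriv_limit:
  fixes F :: "real \<Rightarrow> real"
  assumes k0: "0 < k0" and F: "\<And>k. 0 < k \<Longrightarrow> k < k0 \<Longrightarrow> (F has_real_derivative 0) (at k)"
    and lim: "(F \<longlongrightarrow> L) (at_right 0)" and k: "0 < k" "k < k0"
  shows "F k = L"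
proof -
  have "\<exists>c. \<forall>x\<in>{0<..<k0}. F x = c"
    by (rule has_field_derivative_zero_constant) (use F in \<open>auto intro: has_field_derivative_at_within\<close>)
  then obtain c where c: "\<And>x. 0 < x \<Longrightarrow> x < k0 \<Longrightarrow> F x = c" by auto
  have "\<forall>\<^sub>F x in at_right 0. c = F x"
    by (rule eventually_at_right_0I[OF k0]) (use c in auto)
  then have "(F \<longlongrightarrow> c) (at_right 0)"
    by (rule Lim_transform_eventually[OF tendsto_const])
  then have "c = L" by (rule tendsto_unique[OF trivial_limit_at_right_real _ lim])
  then show ?thesis using c k by simp
qed

context affine_frame_curve
begin

text \<open>The areas of the segment and of the trapezoid cut off at height \<open>k\<close> over the tangent at \<open>t\<close>, as
  functionals of the chord length.\<close>

definition seg_area :: "real \<Rightarrow> real \<Rightarrow> real" where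
  "seg_area t k = integral {0..k} (chord t)"

definition trap_area :: "real \<Rightarrow> real \<Rightarrow> real" where
  "trap_area t k = k * chord t k - k^2 * chord' t k / 2"

context
  fixes t K :: real
  assumes t: "t \<in> I" and bh: "branch_height t K"
begin

lemma seg_area_deriv:
  assumes k: "0 < k" "k < K"
  shows "(seg_area t has_real_derivative chord t k) (at k)"
proof -
  let ?b = "(k + K) / 2"
  have "continuous_on {0..?b} (chord t)"
    by (rule continuous_on_subset[OF chord_cont[OF t bh]]) (use k in auto)
  then have "(seg_area t has_real_derivative chord t k) (at k within {0..?b})"
    unfolding seg_area_def[abs_def] by (rule integral_has_real_derivative) (use k in auto)
  then have "(seg_area t has_real_derivative chord t k) (at k within {0<..<?b})"
    by (rule DERIV_subset) auto
  moreover have "at k within {0<..<?b} = at k"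
    by (rule at_within_open) (use k in auto)
  ultimately show ?thesis by simp
qed

lemma seg_area_tendsto_0: "(seg_area t \<longlongrightarrow> 0) (at_right 0)"
proof -
  have K: "0 < K" by (rule branch_height_pos[OF t bh])
  have "chord t integrable_on {0..K / 2}"
    by (intro integrable_continuous_real continuous_on_subset[OF chord_cont[OF t bh]]) (use K in auto)
  then have "continuous_on {0..K / 2} (seg_area t)"
    unfolding seg_area_def[abs_def] by (rule indefinite_integral_continuous_1)
  then have "(seg_area t \<longlongrightarrow> seg_area t 0) (at 0 within {0..K / 2})"
    using K by (auto simp: continuous_on_def)
  then show ?thesis
    using K by (simp add: at_within_Icc_at_right seg_area_def)
qed

text \<open>By \<open>branch_expansion\<close> also \<open>sqrt (2 * k) * chord' t k\<close> tends to 2. The limit for the segment then is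
  l'Hospital's rule, where \<open>sqrt (2 * k)^3\<close> has derivative \<open>3 * sqrt (2 * k)\<close>.\<close>

lemma limits:
  shows chord_limit: "((\<lambda>k. chord t k / sqrt (2 * k)) \<longlongrightarrow> 2) (at_right 0)"
    and seg_area_limit: "((\<lambda>k. seg_area t k / sqrt (2 * k)^3) \<longlongrightarrow> 2 / 3) (at_right 0)"
    and trap_area_limit: "((\<lambda>k. trap_area t k / sqrt (2 * k)^3) \<longlongrightarrow> 3 / 4) (at_right 0)"
proof -
  obtain k1 where k1: "k1 > 0" "k1 \<le> K" and ex: "\<And>k. 0 < k \<Longrightarrow> k < k1 \<Longrightarrow>
    \<bar>dc t (sr t k) - sqrt (2 * k)\<bar> \<le> 2 * k \<and> \<bar>dc t (sl t k) + sqrt (2 * k)\<bar> \<le> 2 * k \<and>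
    \<bar>xc t (sr t k) - sqrt (2 * k)\<bar> \<le> 2 * k \<and> \<bar>xc t (sl t k) + sqrt (2 * k)\<bar> \<le> 2 * k \<and>
    \<bar>vc t (sr t k) - 1\<bar> \<le> sqrt (2 * k) \<and> \<bar>vc t (sl t k) - 1\<bar> \<le> sqrt (2 * k)"
    using branch_expansion[OF t bh zero_less_one zero_less_one] by auto
  have div: "\<bar>F / sqrt (2 * k) - c\<bar> \<le> sqrt (2 * k)"
    if "0 < k" "\<bar>F - c * sqrt (2 * k)\<bar> \<le> 2 * k" for F c k :: real
  proof -
    have s: "0 < sqrt (2 * k)" "sqrt (2 * k) * sqrt (2 * k) = 2 * k" using that by auto
    have "\<bar>F / sqrt (2 * k) - c\<bar> = \<bar>F - c * sqrt (2 * k)\<bar> / sqrt (2 * k)"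
    proof -
      have "F / sqrt (2 * k) - c = (F - c * sqrt (2 * k)) / sqrt (2 * k)"
        using s(1) by (simp only: diff_divide_distrib) simp
      then show ?thesis using s(1) by (simp add: abs_divide)
    qed
    also have "\<dots> \<le> 2 * k / sqrt (2 * k)" using that s by (intro divide_right_mono) auto
    also have "\<dots> = sqrt (2 * k)" using s by (simp add: field_simps)
    finally show ?thesis .
  qed
  have "((\<lambda>k. dc t (sr t k) / sqrt (2 * k)) \<longlongrightarrow> 1) (at_right 0)"
    by (rule tendsto_of_sqrt_bound[OF k1(1)], rule div) (use ex in auto)
  moreover have "((\<lambda>k. dc t (sl t k) / sqrt (2 * k)) \<longlongrightarrow> -1) (at_right 0)"
    by (rule tendsto_of_sqrt_bound[OF k1(1)], rule div) (use ex in auto)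
  moreover have v: "((\<lambda>k. vc t (sr t k)) \<longlongrightarrow> 1) (at_right 0)" "((\<lambda>k. vc t (sl t k)) \<longlongrightarrow> 1) (at_right 0)"
    by (rule tendsto_of_sqrt_bound[OF k1(1)]; use ex in auto)+
  ultimately have "((\<lambda>k. vc t (sr t k) / (dc t (sr t k) / sqrt (2 * k))
      - vc t (sl t k) / (dc t (sl t k) / sqrt (2 * k))) \<longlongrightarrow> 1 / 1 - 1 / (-1)) (at_right 0)"
    by (intro tendsto_intros) auto
  then have c': "((\<lambda>k. sqrt (2 * k) * chord' t k) \<longlongrightarrow> 2) (at_right 0)"
    by (simp add: chord'_def algebra_simps)
  have "((\<lambda>k. xc t (sr t k) / sqrt (2 * k)) \<longlongrightarrow> 1) (at_right 0)"
    by (rule tendsto_of_sqrt_bound[OF k1(1)], rule div) (use ex in auto)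
  moreover have "((\<lambda>k. xc t (sl t k) / sqrt (2 * k)) \<longlongrightarrow> -1) (at_right 0)"
    by (rule tendsto_of_sqrt_bound[OF k1(1)], rule div) (use ex in auto)
  ultimately have "((\<lambda>k. xc t (sr t k) / sqrt (2 * k) - xc t (sl t k) / sqrt (2 * k)) \<longlongrightarrow> 1 - (-1)) (at_right 0)"
    by (intro tendsto_intros)
  then show c: "((\<lambda>k. chord t k / sqrt (2 * k)) \<longlongrightarrow> 2) (at_right 0)"
    by (simp add: chord_def diff_divide_distrib)
  have pos: "\<forall>\<^sub>F k in at_right 0. 0 < (k::real)"
    by (simp add: eventually_at_right_less)
  have posK: "\<forall>\<^sub>F k in at_right 0. 0 < k \<and> k < K"
    by (rule eventually_at_right_0I[OF branch_height_pos[OF t bh]]) auto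
  show "((\<lambda>k. seg_area t k / sqrt (2 * k)^3) \<longlongrightarrow> 2 / 3) (at_right 0)"
  proof (rule lhopital_right_0[where f' = "chord t" and g' = "\<lambda>k. 3 * sqrt (2 * k)"])
    have "((\<lambda>k. sqrt (2 * k)^3) \<longlongrightarrow> sqrt (2 * 0)^3) (at_right 0)"
      by (intro tendsto_intros)
    then show "((\<lambda>k. sqrt (2 * k)^3) \<longlongrightarrow> 0) (at_right 0)" by simp
    show "\<forall>\<^sub>F k in at_right 0. (seg_area t has_real_derivative chord t k) (at k)"
      using posK by eventually_elim (rule seg_area_deriv; simp)
    show "\<forall>\<^sub>F k in at_right 0. ((\<lambda>k. sqrt (2 * k)^3) has_real_derivative 3 * sqrt (2 * k)) (at k)"
      using pos
    proof eventually_elim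
      case (elim k)
      then show ?case
        by (auto intro!: derivative_eq_intros simp: field_simps power2_eq_square)
    qed
    have "((\<lambda>k. (chord t k / sqrt (2 * k)) / 3) \<longlongrightarrow> 2 / 3) (at_right 0)"
      by (intro tendsto_intros c) simp
    then show "((\<lambda>k. chord t k / (3 * sqrt (2 * k))) \<longlongrightarrow> 2 / 3) (at_right 0)"
      by (simp add: mult.commute)
    show "\<forall>\<^sub>F k in at_right 0. sqrt (2 * k)^3 \<noteq> (0::real)" "\<forall>\<^sub>F k in at_right 0. 3 * sqrt (2 * k) \<noteq> (0::real)"
      using pos by (eventually_elim; simp)+
  qed (rule seg_area_tendsto_0)
  have "((\<lambda>k. (chord t k / sqrt (2 * k)) / 2 - (sqrt (2 * k) * chord' t k) / 8) \<longlongrightarrow> 2 / 2 - 2 / 8) (at_right 0)"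
    by (intro tendsto_intros c c') simp_all
  moreover have "\<forall>\<^sub>F k in at_right 0. (chord t k / sqrt (2 * k)) / 2 - (sqrt (2 * k) * chord' t k) / 8
      = trap_area t k / sqrt (2 * k)^3"
    using pos
  proof eventually_elim
    case (elim k)
    define \<kappa> where "\<kappa> = sqrt (2 * k)"
    have \<kappa>: "0 < \<kappa>" "k = \<kappa>^2 / 2" using elim by (auto simp: \<kappa>_def)
    have "(chord t k / \<kappa>) / 2 - (\<kappa> * chord' t k) / 8 = (\<kappa>^2 / 2 * chord t k - (\<kappa>^2 / 2)^2 * chord' t k / 2) / \<kappa>^3"
      using \<kappa>(1) by (simp add: field_simps power2_eq_square power3_eq_cube)
    then show ?case unfolding \<kappa>_def[symmetric] trap_area_def \<kappa>(2)[symmetric] .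
  qed
  ultimately show "((\<lambda>k. trap_area t k / sqrt (2 * k)^3) \<longlongrightarrow> 3 / 4) (at_right 0)"
    by (simp add: tendsto_cong)
qed

lemma area_ratio:
  assumes k0: "0 < k0" and eq: "\<And>k. 0 < k \<Longrightarrow> k < k0 \<Longrightarrow> seg_area t k = lam * trap_area t k"
  shows "lam = 8 / 9"
proof -
  have "\<forall>\<^sub>F k in at_right 0. lam * (trap_area t k / sqrt (2 * k)^3) = seg_area t k / sqrt (2 * k)^3"
    by (rule eventually_at_right_0I[OF k0]) (use eq in auto)
  moreover have "((\<lambda>k. lam * (trap_area t k / sqrt (2 * k)^3)) \<longlongrightarrow> lam * (3 / 4)) (at_right 0)"
    by (intro tendsto_intros trap_area_limit)
  ultimately have "((\<lambda>k. seg_area t k / sqrt (2 * k)^3) \<longlongrightarrow> lam * (3 / 4)) (at_right 0)"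
    by (rule Lim_transform_eventually[rotated])
  then have "lam * (3 / 4) = 2 / 3"
    by (rule tendsto_unique[OF trivial_limit_at_right_real _ seg_area_limit])
  then show ?thesis by simp
qed

text \<open>With \<open>S' = chord\<close> the area equation is an Euler equation for \<open>S\<close> with the double exponent
  \<open>3/2\<close>; the limits exclude the logarithmic solution and fix the constant.\<close>

lemma chord_of_area_equation:
  assumes k0: "0 < k0" "k0 \<le> K" and eq: "\<And>k. 0 < k \<Longrightarrow> k < k0 \<Longrightarrow> seg_area t k = 8 / 9 * trap_area t k"
    and k: "0 < k" "k < k0"
  shows "chord t k = 2 * sqrt (2 * k)"
proof -
  have sq: "((\<lambda>k. sqrt (2 * k)^3) has_real_derivative 3 * sqrt (2 * k)) (at k)" if "0 < k" for k
    using that by (auto intro!: derivative_eq_intros simp: field_simps power2_eq_square)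
  \<comment> \<open>\<open>R = k * S' - 3/2 * S\<close> satisfies the first-order equation \<open>k * R' = 3/2 * R\<close>.\<close>
  define R where "R = (\<lambda>k. k * chord t k - 3 / 2 * seg_area t k)"
  have R0: "R k / sqrt (2 * k)^3 = 0" if k: "0 < k" "k < k0" for k
  proof (rule zero_deriv_limit[OF k0(1) _ _ k])
    fix k assume k: "0 < k" "k < k0"
    define \<kappa> where "\<kappa> = sqrt (2 * k)"
    have \<kappa>: "0 < \<kappa>" "\<kappa>^2 = 2 * k" using k by (auto simp: \<kappa>_def)
    have R': "(R has_real_derivative k * chord' t k - chord t k / 2) (at k)"
      unfolding R_def using k k0(2)
      by (auto intro!: derivative_eq_intros chord_deriv[OF t bh] seg_area_deriv)
    have "(k * chord' t k - chord t k / 2) * \<kappa>^2 = 3 * R k"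
      using eq[OF k] unfolding \<kappa>(2) R_def trap_area_def by (simp add: power2_eq_square algebra_simps)
    then have z: "(k * chord' t k - chord t k / 2) * \<kappa>^3 - R k * (3 * \<kappa>) = 0"
      by (simp add: power2_eq_square power3_eq_cube)
    have "((\<lambda>k. R k / sqrt (2 * k)^3) has_real_derivative
        ((k * chord' t k - chord t k / 2) * \<kappa>^3 - R k * (3 * \<kappa>)) / (\<kappa>^3 * \<kappa>^3)) (at k)"
      using DERIV_divide[OF R' sq[OF k(1)]] \<kappa>(1) by (simp add: \<kappa>_def)
    then show "((\<lambda>k. R k / sqrt (2 * k)^3) has_real_derivative 0) (at k)" unfolding z by simp
  next
    have "((\<lambda>k. (chord t k / sqrt (2 * k)) / 2 - 3 / 2 * (seg_area t k / sqrt (2 * k)^3)) \<longlongrightarrow> 2 / 2 - 3 / 2 * (2 / 3)) (at_right 0)"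
      by (intro tendsto_intros chord_limit seg_area_limit) simp
    moreover have "\<forall>\<^sub>F k in at_right 0. (chord t k / sqrt (2 * k)) / 2 - 3 / 2 * (seg_area t k / sqrt (2 * k)^3)
       = R k / sqrt (2 * k)^3"
      by (rule eventually_at_right_0I[OF zero_less_one]) (simp add: R_def field_simps power3_eq_cube)
    ultimately show "((\<lambda>k. R k / sqrt (2 * k)^3) \<longlongrightarrow> 0) (at_right 0)"
      by (simp add: tendsto_cong)
  qed
  have R: "k * chord t k = 3 / 2 * seg_area t k" if k: "0 < k" "k < k0" for k
    using R0[OF k] k by (simp add: R_def)
  have S: "seg_area t k / sqrt (2 * k)^3 = 2 / 3"
  proof (rule zero_deriv_limit[OF k0(1) _ seg_area_limit k])
    fix k assume k: "0 < k" "k < k0"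
    define \<kappa> where "\<kappa> = sqrt (2 * k)"
    have \<kappa>: "0 < \<kappa>" "\<kappa>^2 = 2 * k" using k by (auto simp: \<kappa>_def)
    have "chord t k * \<kappa>^3 - seg_area t k * (3 * \<kappa>) = 2 * \<kappa> * (k * chord t k - 3 / 2 * seg_area t k)"
      using \<kappa>(2) by (simp add: power3_eq_cube power2_eq_square algebra_simps)
    then have z: "chord t k * \<kappa>^3 - seg_area t k * (3 * \<kappa>) = 0" using R[OF k] by simp
    have "((\<lambda>k. seg_area t k / sqrt (2 * k)^3) has_real_derivative
        (chord t k * \<kappa>^3 - seg_area t k * (3 * \<kappa>)) / (\<kappa>^3 * \<kappa>^3)) (at k)"
      using DERIV_divide[OF seg_area_deriv sq[OF k(1)]] \<kappa>(1) k k0(2) by (simp add: \<kappa>_def)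
    then show "((\<lambda>k. seg_area t k / sqrt (2 * k)^3) has_real_derivative 0) (at k)" unfolding z by simp
  qed
  have "sqrt (2 * k)^3 = 2 * k * sqrt (2 * k)" using k by (simp add: power3_eq_cube)
  then have "seg_area t k = 2 / 3 * (2 * k * sqrt (2 * k))" using S k by (simp add: field_simps)
  then have "k * chord t k = k * (2 * sqrt (2 * k))" using R[OF k] by argo
  then show ?thesis using k by simp
qed

end

end

section \<open>Second differences of the affine tangent field\<close>

text \<open>The cubic relation controls \<open>a + b\<close> for \<open>a = \<kappa> / d - 1\<close> and \<open>b = \<kappa> / (- d') - 1\<close> to second order,
  although \<open>a\<close> and \<open>b\<close> are only known to first order.\<close>

lemma second_difference_bound:
  fixes \<kappa> \<eta> v v' d d' :: real
  assumes \<kappa>: "0 < \<kappa>" and \<eta>: "0 < \<eta>" "\<eta> \<le> 1" "\<eta> * \<kappa> \<le> 1 / 2"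
    and d: "\<bar>d - \<kappa>\<bar> \<le> \<eta> * \<kappa>^2" "\<bar>d' + \<kappa>\<bar> \<le> \<eta> * \<kappa>^2"
    and v: "\<bar>v - 1\<bar> \<le> \<eta> * \<kappa>" "\<bar>v' - 1\<bar> \<le> \<eta> * \<kappa>"
    and 1: "v / d - v' / d' = 2 / \<kappa>" and 2: "1 / d^3 - 1 / d'^3 = 2 / \<kappa>^3"
  shows "\<bar>v + v' - 2\<bar> \<le> 15 * \<eta> * \<kappa>^2"
proof -
  define p where "p = \<eta> * \<kappa>"
  have p: "0 < p" "p \<le> 1 / 2" "\<eta> * \<kappa>^2 = p * \<kappa>" using \<kappa> \<eta> by (auto simp: p_def power2_eq_square)
  have "p * \<kappa> \<le> 1 / 2 * \<kappa>" using p \<kappa> by (intro mult_right_mono) auto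
  then have dd: "\<kappa> / 2 \<le> d" "\<kappa> / 2 \<le> - d'" using d p(3) by (auto simp: abs_le_iff)
  define a b where "a = \<kappa> / d - 1" and "b = \<kappa> / (- d') - 1"
  have q: "\<bar>\<kappa> / u - 1\<bar> \<le> 2 * p" if "\<kappa> / 2 \<le> u" "\<bar>u - \<kappa>\<bar> \<le> p * \<kappa>" for u
  proof -
    have u: "0 < u" using that \<kappa> by linarith
    have "\<bar>\<kappa> / u - 1\<bar> = \<bar>u - \<kappa>\<bar> / u"
    proof -
      have "\<kappa> / u - 1 = - ((u - \<kappa>) / u)" using u by (simp add: field_simps)
      then show ?thesis using u by (simp add: abs_divide)
    qed
    also have "\<dots> \<le> 2 * p"
    proof -
      have "p * \<kappa> \<le> p * (2 * u)" using that p by (intro mult_left_mono) auto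
      then have "\<bar>u - \<kappa>\<bar> \<le> 2 * p * u" using that(2) by simp
      then show ?thesis using u by (simp add: divide_le_eq)
    qed
    finally show ?thesis .
  qed
  have ab: "\<bar>a\<bar> \<le> 2 * p" "\<bar>b\<bar> \<le> 2 * p"
    unfolding a_def b_def using q[of d] q[of "- d'"] dd d p(3) by (auto simp: abs_le_iff)
  have ka: "\<kappa> / d = 1 + a" "\<kappa> / d' = - (1 + b)" by (simp_all add: a_def b_def)
  have "v * (\<kappa> / d) - v' * (\<kappa> / d') = \<kappa> * (v / d - v' / d')" by (simp add: algebra_simps)
  also have "\<dots> = 2" using 1 \<kappa> by simp
  finally have e1: "v * (1 + a) + v' * (1 + b) = 2" unfolding ka by (simp add: algebra_simps)
  have "(\<kappa> / d)^3 - (\<kappa> / d')^3 = \<kappa>^3 * (1 / d^3 - 1 / d'^3)"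
    by (simp add: power_divide right_diff_distrib)
  then have "(1 + a)^3 + (1 + b)^3 = 2"
    unfolding 2 ka using \<kappa> by (simp add: power3_eq_cube algebra_simps)
  then have e2: "3 * (a + b) + 3 * (a^2 + b^2) + (a * a^2 + b * b^2) = 0"
    by (simp add: power3_eq_cube power2_eq_square algebra_simps)
  have sqb: "a^2 \<le> 4 * p^2" "b^2 \<le> 4 * p^2"
    using power_mono[OF ab(1), of 2] power_mono[OF ab(2), of 2] by (auto simp: power_mult_distrib)
  have "\<bar>a * a^2\<bar> \<le> 1 * a^2" "\<bar>b * b^2\<bar> \<le> 1 * b^2"
    unfolding abs_mult abs_power2 using ab p by (intro mult_right_mono; simp)+
  moreover define S T where "S = a^2 + b^2" and "T = a * a^2 + b * b^2"
  ultimately have T: "\<bar>T\<bar> \<le> S" by linarith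
  have S: "0 \<le> S" "S \<le> 8 * p^2" using sqb by (auto simp: S_def)
  have "3 * (a + b) = - (3 * S + T)" using e2 unfolding S_def T_def by linarith
  then have "\<bar>3 * (a + b)\<bar> = \<bar>3 * S + T\<bar>" by (simp only: abs_minus_cancel)
  also have "\<dots> \<le> \<bar>3 * S\<bar> + \<bar>T\<bar>" by (rule abs_triangle_ineq)
  also have "\<dots> \<le> 3 * S + S" using S T by (intro add_mono) auto
  also have "\<dots> \<le> 33 * p^2" using S zero_le_power2[of p] by linarith
  finally have "\<bar>a + b\<bar> \<le> 11 * p^2" by (simp add: abs_mult)
  moreover have "\<bar>(v - 1) * a\<bar> \<le> p * (2 * p)" "\<bar>(v' - 1) * b\<bar> \<le> p * (2 * p)"
    unfolding abs_mult using ab v p by (intro mult_mono; simp add: p_def)+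
  moreover have "v + v' - 2 = - (a + b) - (v - 1) * a - (v' - 1) * b"
    using e1 by (simp add: algebra_simps)
  ultimately have "\<bar>v + v' - 2\<bar> \<le> 15 * p^2" by (simp add: power2_eq_square)
  also have "15 * p^2 \<le> 15 * \<eta> * \<kappa>^2"
  proof -
    have "\<eta> * (\<eta> * \<kappa>^2) \<le> 1 * (\<eta> * \<kappa>^2)" using \<eta> by (intro mult_right_mono) auto
    then show ?thesis by (simp add: p_def power2_eq_square mult_ac)
  qed
  finally show ?thesis .
qed

context affine_frame_curve
begin

text \<open>The first two derivatives of \<open>chord t k = 2 * sqrt (2 * k)\<close> with respect to \<open>k\<close>. By the normalization
  \<open>crs e V A = 1\<close> the second one involves only the first-order quantity \<open>dc\<close>.\<close>

lemma chord_derivative_identities: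
  assumes t: "t \<in> I" and bh: "branch_height t K" and k0: "k0 \<le> K"
    and eq: "\<And>k. 0 < k \<Longrightarrow> k < k0 \<Longrightarrow> chord t k = 2 * sqrt (2 * k)"
    and k: "0 < k" "k < k0"
  shows "chord' t k = 2 / sqrt (2 * k)"
    and "1 / dc t (sr t k)^3 - 1 / dc t (sl t k)^3 = 2 / sqrt (2 * k)^3"
proof -
  have c': "chord' t k = 2 / sqrt (2 * k)" if k: "0 < k" "k < k0" for k
  proof -
    have "((\<lambda>k. 2 * sqrt (2 * k)) has_real_derivative 2 / sqrt (2 * k)) (at k)"
      using k by (auto intro!: derivative_eq_intros simp: field_simps)
    then have "(chord t has_real_derivative 2 / sqrt (2 * k)) (at k)"
      by (rule has_field_derivative_transform_within_open[where S = "{0<..<k0}"]) (use k eq in auto)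
    then show ?thesis using chord_deriv[OF t bh, of k] k k0 DERIV_unique by auto
  qed
  show "chord' t k = 2 / sqrt (2 * k)" by (rule c'[OF k])
  have kK: "k < K" using k k0 by simp
  define p q where "p = sl t k" and "q = sr t k"
  have L: "dc t p < 0" "p \<in> I" and R: "0 < dc t q" "q \<in> I"
    using sl_props[OF t bh _ kK] sr_props[OF t bh _ kK] sl_signs[OF t bh k(1) kK] sr_signs[OF t bh k(1) kK] k
    by (auto simp: p_def q_def)
  have num: "(crs e (A s) (A t) / dc t s) * dc t s - vc t s * (crs e (V t) (A s) / dc t s) = - 1 / dc t s"
    if s: "s \<in> I" "dc t s \<noteq> 0" for s
  proof -
    have "crs e (A s) (A t) * dc t s - vc t s * crs e (V t) (A s) = - (crs e (V s) (A s) * crs e (V t) (A t))"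
      unfolding dc_def vc_def crs_def by algebra
    also have "\<dots> = - 1" using crs_VA s t by simp
    finally have "(crs e (A s) (A t) * dc t s - vc t s * crs e (V t) (A s)) / dc t s = - 1 / dc t s" by simp
    then show ?thesis using s(2) by (simp add: diff_divide_distrib)
  qed
  have "((\<lambda>k. vc t (sr t k) / dc t (sr t k)) has_real_derivative
      ((crs e (A q) (A t) / dc t q) * dc t q - vc t q * (crs e (V t) (A q) / dc t q)) / (dc t q * dc t q)) (at k)"
    unfolding q_def
    by (rule DERIV_divide[OF along_branch_deriv(1)[OF t bh k(1) kK vc_deriv]
          along_branch_deriv(1)[OF t bh k(1) kK dc_deriv]]) (use R in \<open>simp_all add: q_def\<close>)
  then have dq: "((\<lambda>k. vc t (sr t k) / dc t (sr t k)) has_real_derivative (- 1 / dc t q) / (dc t q * dc t q)) (at k)"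
    using num[of q] R by simp
  have "((\<lambda>k. vc t (sl t k) / dc t (sl t k)) has_real_derivative
      ((crs e (A p) (A t) / dc t p) * dc t p - vc t p * (crs e (V t) (A p) / dc t p)) / (dc t p * dc t p)) (at k)"
    unfolding p_def
    by (rule DERIV_divide[OF along_branch_deriv(2)[OF t bh k(1) kK vc_deriv]
          along_branch_deriv(2)[OF t bh k(1) kK dc_deriv]]) (use L in \<open>simp_all add: p_def\<close>)
  then have dp: "((\<lambda>k. vc t (sl t k) / dc t (sl t k)) has_real_derivative (- 1 / dc t p) / (dc t p * dc t p)) (at k)"
    using num[of p] L by simp
  have 1: "(chord' t has_real_derivative
      (- 1 / dc t q) / (dc t q * dc t q) - (- 1 / dc t p) / (dc t p * dc t p)) (at k)"
    unfolding chord'_def[abs_def] by (rule DERIV_diff[OF dq dp])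
  have "((\<lambda>k. 2 / sqrt (2 * k)) has_real_derivative - (2 / sqrt (2 * k)^3)) (at k)"
    using k by (auto intro!: derivative_eq_intros simp: field_simps power3_eq_cube)
  then have 2: "(chord' t has_real_derivative - (2 / sqrt (2 * k)^3)) (at k)"
    by (rule has_field_derivative_transform_within_open[where S = "{0<..<k0}"]) (use k c' in auto)
  have "(- 1 / dc t q) / (dc t q * dc t q) - (- 1 / dc t p) / (dc t p * dc t p) = - (2 / sqrt (2 * k)^3)"
    by (rule DERIV_unique[OF 1 2])
  then show "1 / dc t (sr t k)^3 - 1 / dc t (sl t k)^3 = 2 / sqrt (2 * k)^3"
    by (simp add: p_def q_def power3_eq_cube)
qed

text \<open>At a point where all small chords have the length they have for a parabola, \<open>V\<close> and \<open>\<sigma>\<close> have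
  vanishing generalized second derivative.\<close>

lemma second_differences:
  assumes t: "t \<in> I" and bh: "branch_height t K" and k0: "0 < k0" "k0 \<le> K"
    and eq: "\<And>k. 0 < k \<Longrightarrow> k < k0 \<Longrightarrow> chord t k = 2 * sqrt (2 * k)"
    and \<epsilon>: "0 < \<epsilon>" and \<delta>: "0 < \<delta>"
  shows "\<exists>p\<in>I. \<exists>q\<in>I. \<exists>\<kappa>>0. \<bar>p - t\<bar> < \<delta> \<and> \<bar>q - t\<bar> < \<delta> \<and>
    \<bar>\<sigma> p + \<sigma> q - 2 * \<sigma> t\<bar> \<le> \<epsilon> * \<kappa>^2 \<and> \<kappa>^2 \<le> (\<sigma> p - \<sigma> t)^2 + (\<sigma> q - \<sigma> t)^2 \<and>
    (\<forall>i. \<bar>V p $ i + V q $ i - 2 * V t $ i\<bar> \<le> \<epsilon> * \<kappa>^2)"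
proof -
  define M where "M = 15 * norm (V t) + 2 * norm (A t) + 2"
  have M: "0 < M" by (simp add: M_def add_nonneg_pos)
  \<comment> \<open>The error terms below add up to at most \<open>\<eta> * M * \<kappa>\<^sup>2\<close>.\<close>
  define \<eta> where "\<eta> = min (1 / 4) (\<epsilon> / M)"
  have \<eta>: "0 < \<eta>" "\<eta> \<le> 1 / 4" "\<eta> * M \<le> \<epsilon>"
    using \<epsilon> M by (auto simp: \<eta>_def min_def field_simps)
  obtain k1 where k1: "k1 > 0" "k1 \<le> K" and ex: "\<And>k. 0 < k \<Longrightarrow> k < k1 \<Longrightarrow>
    \<bar>sr t k - t\<bar> < \<delta> \<and> \<bar>sl t k - t\<bar> < \<delta> \<and>
    \<bar>\<sigma> (sr t k) - \<sigma> t - sqrt (2 * k)\<bar> \<le> \<eta> * (2 * k) \<and> \<bar>\<sigma> (sl t k) - \<sigma> t + sqrt (2 * k)\<bar> \<le> \<eta> * (2 * k) \<and>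
    \<bar>dc t (sr t k) - sqrt (2 * k)\<bar> \<le> \<eta> * (2 * k) \<and> \<bar>dc t (sl t k) + sqrt (2 * k)\<bar> \<le> \<eta> * (2 * k) \<and>
    \<bar>vc t (sr t k) - 1\<bar> \<le> \<eta> * sqrt (2 * k) \<and> \<bar>vc t (sl t k) - 1\<bar> \<le> \<eta> * sqrt (2 * k)"
    using branch_expansion[OF t bh \<eta>(1) \<delta>] by blast
  define k where "k = min (min k0 k1 / 2) (1 / 2)"
  have k: "0 < k" "k < k0" "k < k1" "2 * k \<le> 1" using k0 k1 by (auto simp: k_def)
  define \<kappa> where "\<kappa> = sqrt (2 * k)"
  have \<kappa>: "0 < \<kappa>" "2 * k = \<kappa>^2" "\<kappa> \<le> 1" using k by (auto simp: \<kappa>_def)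
  define p q where "p = sl t k" and "q = sr t k"
  note E = ex[OF k(1,3), folded \<kappa>_def p_def q_def, unfolded \<kappa>(2)]
  have inI: "p \<in> I" "q \<in> I"
    using sl_props[OF t bh, of k] sr_props[OF t bh, of k] k k0 by (auto simp: p_def q_def)
  have \<eta>\<kappa>: "\<eta> * \<kappa> \<le> 1 / 4"
    using mult_mono[OF \<eta>(2) \<kappa>(3)] \<eta>(1) \<kappa>(1) by simp
  have v: "\<bar>vc t q + vc t p - 2\<bar> \<le> 15 * \<eta> * \<kappa>^2"
    using second_difference_bound[OF \<kappa>(1) \<eta>(1), of "dc t q" "dc t p" "vc t q" "vc t p"] E \<eta>(2) \<eta>\<kappa>
      chord_derivative_identities[OF t bh k0(2) eq k(1,2), folded \<kappa>_def p_def q_def]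
    by (simp add: chord'_def p_def q_def)
  have d: "\<bar>dc t q + dc t p\<bar> \<le> 2 * \<eta> * \<kappa>^2" and s: "\<bar>\<sigma> p + \<sigma> q - 2 * \<sigma> t\<bar> \<le> 2 * \<eta> * \<kappa>^2"
  proof -
    have "\<bar>dc t q - \<kappa>\<bar> \<le> \<eta> * \<kappa>^2" "\<bar>dc t p + \<kappa>\<bar> \<le> \<eta> * \<kappa>^2" using E by simp_all
    then show "\<bar>dc t q + dc t p\<bar> \<le> 2 * \<eta> * \<kappa>^2" by linarith
    have "\<bar>\<sigma> q - \<sigma> t - \<kappa>\<bar> \<le> \<eta> * \<kappa>^2" "\<bar>\<sigma> p - \<sigma> t + \<kappa>\<bar> \<le> \<eta> * \<kappa>^2" using E by simp_all
    then show "\<bar>\<sigma> p + \<sigma> q - 2 * \<sigma> t\<bar> \<le> 2 * \<eta> * \<kappa>^2" by linarith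
  qed
  have \<eta>M: "\<eta> * \<kappa>^2 * M \<le> \<epsilon> * \<kappa>^2"
    using mult_right_mono[OF \<eta>(3), of "\<kappa>^2"] by (simp add: mult_ac)
  have "\<bar>V p $ i + V q $ i - 2 * V t $ i\<bar> \<le> \<epsilon> * \<kappa>^2" for i
  proof -
    have comp: "V u $ i = vc t u * V t $ i + dc t u * A t $ i" for u
      using arg_cong[OF V_coords[OF t, of u], of "\<lambda>z. z $ i"] by simp
    have "V p $ i + V q $ i - 2 * V t $ i = (vc t q + vc t p - 2) * V t $ i + (dc t q + dc t p) * A t $ i"
      unfolding comp[of p] comp[of q] by (simp add: algebra_simps)
    also have "\<bar>\<dots>\<bar> \<le> \<bar>vc t q + vc t p - 2\<bar> * \<bar>V t $ i\<bar> + \<bar>dc t q + dc t p\<bar> * \<bar>A t $ i\<bar>"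
      by (rule order_trans[OF abs_triangle_ineq]) (simp add: abs_mult)
    also have "\<dots> \<le> (15 * \<eta> * \<kappa>^2) * norm (V t) + (2 * \<eta> * \<kappa>^2) * norm (A t)"
      by (intro add_mono mult_mono v d component_le_norm_cart) (use \<eta> in auto)
    also have "\<dots> \<le> \<eta> * \<kappa>^2 * M"
      using \<eta>(1) by (simp add: M_def algebra_simps)
    finally show ?thesis using \<eta>M by linarith
  qed
  moreover have "\<bar>\<sigma> p + \<sigma> q - 2 * \<sigma> t\<bar> \<le> \<epsilon> * \<kappa>^2"
  proof -
    have "\<eta> * \<kappa>^2 * 2 \<le> \<eta> * \<kappa>^2 * M" using \<eta>(1) by (intro mult_left_mono) (auto simp: M_def)
    then show ?thesis using s \<eta>M by linarith
  qed
  moreover have "\<kappa>^2 \<le> (\<sigma> p - \<sigma> t)^2 + (\<sigma> q - \<sigma> t)^2"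
  proof -
    have "\<eta> * \<kappa>^2 \<le> 1 / 4 * \<kappa>"
      using mult_right_mono[OF \<eta>\<kappa>, of \<kappa>] \<kappa>(1) by (simp add: power2_eq_square mult_ac)
    then have "3 / 4 * \<kappa> \<le> \<sigma> q - \<sigma> t" "3 / 4 * \<kappa> \<le> - (\<sigma> p - \<sigma> t)" using E by (auto simp: abs_le_iff)
    then have "(3 / 4 * \<kappa>)^2 \<le> (\<sigma> q - \<sigma> t)^2" "(3 / 4 * \<kappa>)^2 \<le> (- (\<sigma> p - \<sigma> t))^2"
      using \<kappa>(1) by (intro power_mono; simp)+
    moreover have "(3 / 4 * \<kappa>)^2 = 9 / 16 * \<kappa>^2" by (simp add: power_mult_distrib power2_eq_square)
    ultimately show ?thesis using zero_le_power2[of \<kappa>] by (simp only: power2_minus)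
  qed
  ultimately show ?thesis using inI \<kappa>(1) E by blast
qed

end

text \<open>Schwarz's theorem on functions with vanishing generalized second derivative, relative to a
  second function \<open>\<sigma>\<close>: perturbing \<open>g\<close> by a convex quadratic in \<open>\<sigma>\<close> rules out an interior
  maximum.\<close>

lemma schwarz_le:
  fixes g \<sigma> :: "real \<Rightarrow> real"
  assumes ab: "a < b" and cont: "continuous_on {a..b} g" "continuous_on {a..b} \<sigma>"
    and mono: "\<And>s. a \<le> s \<Longrightarrow> s \<le> b \<Longrightarrow> \<sigma> a \<le> \<sigma> s \<and> \<sigma> s \<le> \<sigma> b" and \<sigma>ab: "\<sigma> a < \<sigma> b"
    and sd: "\<And>t \<epsilon> \<delta>. a < t \<Longrightarrow> t < b \<Longrightarrow> 0 < \<epsilon> \<Longrightarrow> 0 < \<delta> \<Longrightarrow>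
      \<exists>p q \<kappa>. 0 < \<kappa> \<and> \<bar>p - t\<bar> < \<delta> \<and> \<bar>q - t\<bar> < \<delta> \<and> \<bar>\<sigma> p + \<sigma> q - 2 * \<sigma> t\<bar> \<le> \<epsilon> * \<kappa>^2 \<and>
        \<kappa>^2 \<le> (\<sigma> p - \<sigma> t)^2 + (\<sigma> q - \<sigma> t)^2 \<and> \<bar>g p + g q - 2 * g t\<bar> \<le> \<epsilon> * \<kappa>^2"
    and s: "a \<le> s" "s \<le> b"
  shows "g s \<le> g a + (g b - g a) / (\<sigma> b - \<sigma> a) * (\<sigma> s - \<sigma> a)"
proof (rule ccontr)
  assume contra: "\<not> ?thesis"
  define m where "m = (g b - g a) / (\<sigma> b - \<sigma> a)"
  define c where "c = g s - (g a + m * (\<sigma> s - \<sigma> a))"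
  have c: "0 < c" using contra by (simp add: c_def m_def)
  define D where "D = \<sigma> b - \<sigma> a"
  have D: "0 < D" "m * D = g b - g a" using \<sigma>ab by (auto simp: D_def m_def)
  define \<eta> where "\<eta> = c / (2 * D^2)"
  have \<eta>: "0 < \<eta>" "\<eta> * D^2 = c / 2" using c D by (auto simp: \<eta>_def)
  define Q where "Q = (\<lambda>u. (\<sigma> u - \<sigma> a) * (\<sigma> u - \<sigma> b))"
  \<comment> \<open>\<open>Q\<close> vanishes at \<open>a\<close> and \<open>b\<close>, and \<open>\<eta>\<close> is so small that \<open>M s\<close> stays positive; hence \<open>M\<close> has an
    interior maximum, at which its second differences cannot be positive.\<close>
  define M where "M = (\<lambda>u. g u - (g a + m * (\<sigma> u - \<sigma> a)) + \<eta> * Q u)"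
  have "continuous_on {a..b} M" unfolding M_def Q_def by (intro continuous_intros cont)
  then obtain t where t: "t \<in> {a..b}" "\<And>u. u \<in> {a..b} \<Longrightarrow> M u \<le> M t"
    using continuous_attains_sup[of "{a..b}" M] ab by auto
  have "(\<sigma> s - \<sigma> a) * (\<sigma> b - \<sigma> s) \<le> D * D"
    unfolding D_def using mono[OF s] by (intro mult_mono) auto
  then have "- (D^2) \<le> Q s" by (simp add: Q_def power2_eq_square algebra_simps)
  then have "\<eta> * (- (D^2)) \<le> \<eta> * Q s" using \<eta>(1) by (intro mult_left_mono) auto
  then have "- (c / 2) \<le> \<eta> * Q s" using \<eta>(2) by simp
  moreover have "M s = c + \<eta> * Q s" by (simp add: M_def c_def)
  ultimately have "0 < M s" using c by linarith
  then have Mt: "0 < M t" using t(2)[of s] s by auto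
  have "M a = 0" "M b = 0" using D by (simp_all add: M_def Q_def D_def)
  then have tab: "a < t" "t < b" using Mt t(1) by (auto simp: less_le)
  define B where "B = 1 + \<bar>m\<bar> + \<eta> * \<bar>2 * \<sigma> t - \<sigma> a - \<sigma> b\<bar>"
  have B: "0 < B" using \<eta> by (simp add: B_def add_pos_nonneg)
  define \<epsilon> where "\<epsilon> = \<eta> / (2 * B)"
  have \<epsilon>: "0 < \<epsilon>" "\<epsilon> * B = \<eta> / 2" using \<eta> B by (auto simp: \<epsilon>_def)
  obtain p q \<kappa> where \<kappa>: "0 < \<kappa>" and near: "\<bar>p - t\<bar> < min (t - a) (b - t)" "\<bar>q - t\<bar> < min (t - a) (b - t)"
    and 1: "\<bar>\<sigma> p + \<sigma> q - 2 * \<sigma> t\<bar> \<le> \<epsilon> * \<kappa>^2" and 2: "\<kappa>^2 \<le> (\<sigma> p - \<sigma> t)^2 + (\<sigma> q - \<sigma> t)^2"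
    and 3: "\<bar>g p + g q - 2 * g t\<bar> \<le> \<epsilon> * \<kappa>^2"
    using sd[OF tab \<epsilon>(1), of "min (t - a) (b - t)"] tab by auto
  define w where "w = \<sigma> p + \<sigma> q - 2 * \<sigma> t"
  define l where "l = 2 * \<sigma> t - \<sigma> a - \<sigma> b"
  have pq: "p \<in> {a..b}" "q \<in> {a..b}" using near by auto
  have "M p + M q - 2 * M t \<le> 0" using t(2)[OF pq(1)] t(2)[OF pq(2)] by simp
  moreover have "M p + M q - 2 * M t = (g p + g q - 2 * g t) - m * w
      + (\<eta> * l) * w + \<eta> * ((\<sigma> p - \<sigma> t)^2 + (\<sigma> q - \<sigma> t)^2)"
    by (simp add: M_def Q_def w_def l_def power2_eq_square algebra_simps)
  moreover have "\<bar>m * w\<bar> \<le> \<bar>m\<bar> * (\<epsilon> * \<kappa>^2)"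
    unfolding abs_mult using 1 by (intro mult_left_mono) (auto simp: w_def)
  moreover have "\<bar>(\<eta> * l) * w\<bar> \<le> \<bar>\<eta> * l\<bar> * (\<epsilon> * \<kappa>^2)"
    unfolding abs_mult[of "\<eta> * l"] using 1 by (intro mult_left_mono) (auto simp: w_def)
  moreover have "\<eta> * \<kappa>^2 \<le> \<eta> * ((\<sigma> p - \<sigma> t)^2 + (\<sigma> q - \<sigma> t)^2)"
    using 2 \<eta>(1) by (intro mult_left_mono) auto
  moreover have "\<epsilon> * \<kappa>^2 + \<bar>m\<bar> * (\<epsilon> * \<kappa>^2) + \<bar>\<eta> * l\<bar> * (\<epsilon> * \<kappa>^2) = \<eta> * \<kappa>^2 / 2"
  proof -
    have "\<epsilon> * \<kappa>^2 + \<bar>m\<bar> * (\<epsilon> * \<kappa>^2) + \<bar>\<eta> * l\<bar> * (\<epsilon> * \<kappa>^2) = (\<epsilon> * B) * \<kappa>^2"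
    proof -
      have "\<bar>\<eta> * l\<bar> = \<eta> * \<bar>l\<bar>" using \<eta>(1) by (simp add: abs_mult)
      moreover have "B = 1 + \<bar>m\<bar> + \<eta> * \<bar>l\<bar>" by (simp add: B_def l_def)
      ultimately show ?thesis by (simp add: algebra_simps)
    qed
    then show ?thesis by (simp add: \<epsilon>(2))
  qed
  moreover have "0 < \<eta> * \<kappa>^2" using \<eta>(1) \<kappa> by simp
  ultimately show False using 3 by linarith
qed

lemma schwarz_affine:
  fixes g \<sigma> :: "real \<Rightarrow> real"
  assumes ab: "a < b" and cont: "continuous_on {a..b} g" "continuous_on {a..b} \<sigma>"
    and mono: "\<And>s. a \<le> s \<Longrightarrow> s \<le> b \<Longrightarrow> \<sigma> a \<le> \<sigma> s \<and> \<sigma> s \<le> \<sigma> b" and \<sigma>ab: "\<sigma> a < \<sigma> b"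
    and sd: "\<And>t \<epsilon> \<delta>. a < t \<Longrightarrow> t < b \<Longrightarrow> 0 < \<epsilon> \<Longrightarrow> 0 < \<delta> \<Longrightarrow>
      \<exists>p q \<kappa>. 0 < \<kappa> \<and> \<bar>p - t\<bar> < \<delta> \<and> \<bar>q - t\<bar> < \<delta> \<and> \<bar>\<sigma> p + \<sigma> q - 2 * \<sigma> t\<bar> \<le> \<epsilon> * \<kappa>^2 \<and>
        \<kappa>^2 \<le> (\<sigma> p - \<sigma> t)^2 + (\<sigma> q - \<sigma> t)^2 \<and> \<bar>g p + g q - 2 * g t\<bar> \<le> \<epsilon> * \<kappa>^2"
    and s: "a \<le> s" "s \<le> b"
  shows "g s = g a + (g b - g a) / (\<sigma> b - \<sigma> a) * (\<sigma> s - \<sigma> a)"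
proof (rule antisym)
  show "g s \<le> g a + (g b - g a) / (\<sigma> b - \<sigma> a) * (\<sigma> s - \<sigma> a)"
    by (rule schwarz_le[OF assms])
  have "\<bar>- g p + - g q - 2 * - g t\<bar> = \<bar>g p + g q - 2 * g t\<bar>" for p q t
    by (simp add: abs_if)
  then have "- g s \<le> - g a + (- g b - - g a) / (\<sigma> b - \<sigma> a) * (\<sigma> s - \<sigma> a)"
    by (intro schwarz_le[OF ab _ cont(2) mono \<sigma>ab _ s]) (auto intro!: continuous_intros cont sd)
  moreover have "- g b - - g a = - (g b - g a)" by simp
  ultimately show "g a + (g b - g a) / (\<sigma> b - \<sigma> a) * (\<sigma> s - \<sigma> a) \<le> g s"
    by (simp only: minus_divide_left[symmetric] mult_minus_left)
qed

section \<open>Curves with constant affine normal are parabolic arcs\<close>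

context affine_frame_curve
begin

lemma A_constant:
  assumes eq: "\<And>t. t \<in> I \<Longrightarrow> \<exists>K k0. branch_height t K \<and> 0 < k0 \<and> k0 \<le> K \<and>
      (\<forall>k. 0 < k \<and> k < k0 \<longrightarrow> chord t k = 2 * sqrt (2 * k))"
    and I: "p \<in> I" "q \<in> I"
  shows "A p = A q"
proof -
  obtain a where a: "a \<in> I" "a < min p q" using open_real_between[OF open_I, of "min p q"] I by (metis min_def)
  obtain b where b: "b \<in> I" "max p q < b" using open_real_between[OF open_I, of "max p q"] I by (metis max_def)
  have ab: "a < b" using a b by auto
  have inI: "s \<in> I" if "a \<le> s" "s \<le> b" for s using between_in_I[OF a(1) b(1) that] .
  have sub: "{a..b} \<subseteq> I" using inI by auto
  have V_cont: "continuous_on {a..b} V"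
  proof (rule continuous_at_imp_continuous_on, rule ballI)
    fix s assume "s \<in> {a..b}"
    then show "isCont V s" using has_vector_derivative_continuous[OF V_deriv[OF inI]] by auto
  qed
  have "A s $ i = (V b $ i - V a $ i) / (\<sigma> b - \<sigma> a)" if s: "a < s" "s < b" for s i
  proof -
    let ?m = "(V b $ i - V a $ i) / (\<sigma> b - \<sigma> a)"
    have aff: "V u $ i = V a $ i + ?m * (\<sigma> u - \<sigma> a)" if "a \<le> u" "u \<le> b" for u
    proof (rule schwarz_affine[OF ab _ _ _ _ _ that])
      show "continuous_on {a..b} (\<lambda>u. V u $ i)" by (intro continuous_intros V_cont)
      show "continuous_on {a..b} \<sigma>" by (rule continuous_on_subset[OF \<sigma>_cont sub])
      show "\<sigma> a < \<sigma> b" by (rule \<sigma>_mono[OF a(1) b(1) ab])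
      show "\<sigma> a \<le> \<sigma> s \<and> \<sigma> s \<le> \<sigma> b" if "a \<le> s" "s \<le> b" for s
        using \<sigma>_mono[OF a(1) inI[OF that]] \<sigma>_mono[OF inI[OF that] b(1)] that by (auto simp: le_less)
      fix t \<epsilon> \<delta> :: real assume t: "a < t" "t < b" and \<epsilon>: "0 < \<epsilon>" and \<delta>: "0 < \<delta>"
      have tI: "t \<in> I" using inI t by simp
      obtain K k0 where K: "branch_height t K" "0 < k0" "k0 \<le> K"
        "\<And>k. 0 < k \<Longrightarrow> k < k0 \<Longrightarrow> chord t k = 2 * sqrt (2 * k)"
        using eq[OF tI] by blast
      show "\<exists>p q \<kappa>. 0 < \<kappa> \<and> \<bar>p - t\<bar> < \<delta> \<and> \<bar>q - t\<bar> < \<delta> \<and> \<bar>\<sigma> p + \<sigma> q - 2 * \<sigma> t\<bar> \<le> \<epsilon> * \<kappa>^2 \<and>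
        \<kappa>^2 \<le> (\<sigma> p - \<sigma> t)^2 + (\<sigma> q - \<sigma> t)^2 \<and> \<bar>V p $ i + V q $ i - 2 * V t $ i\<bar> \<le> \<epsilon> * \<kappa>^2"
        using second_differences[OF tI K \<epsilon> \<delta>] by blast
    qed
    have sI: "s \<in> I" using inI s by simp
    have der: "((\<lambda>u. V a $ i + ?m * (\<sigma> u - \<sigma> a)) has_real_derivative ?m * r s) (at s)"
      using \<sigma>_mono[OF a(1) b(1) ab] by (auto intro!: derivative_eq_intros \<sigma>_deriv sI)
    have cong: "V a $ i + ?m * (\<sigma> u - \<sigma> a) = V u $ i" if "u \<in> {a<..<b}" for u
      by (rule aff[symmetric]) (use that in auto)
    have s': "s \<in> {a<..<b}" using s by simp
    have 1: "((\<lambda>u. V u $ i) has_real_derivative ?m * r s) (at s)"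
      by (rule has_field_derivative_transform_within_open[OF der open_greaterThanLessThan s' cong])
    have "((\<lambda>u. V u $ i) has_vector_derivative (r s *\<^sub>R A s) $ i) (at s)"
      using bounded_linear.has_vector_derivative[OF bounded_linear_vec_nth V_deriv[OF sI]] .
    then have 2: "((\<lambda>u. V u $ i) has_real_derivative r s * A s $ i) (at s)"
      by (simp add: has_real_derivative_iff_has_vector_derivative)
    have "A s $ i = z" if "z * r s = r s * A s $ i" for z using that r_pos[OF sI] by simp
    then show ?thesis using DERIV_unique[OF 1 2] .
  qed
  then show ?thesis using a b by (simp add: vec_eq_iff)
qed

lemma quadratic_of_A_constant:
  assumes A: "\<And>s. s \<in> I \<Longrightarrow> A s = A t" and t: "t \<in> I" and s: "s \<in> I"
  shows "X s = X t + (\<sigma> s - \<sigma> t) *\<^sub>R V t + ((\<sigma> s - \<sigma> t)^2 / 2) *\<^sub>R A t"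
proof -
  have conv: "convex I" using interval_I is_interval_convex by blast
  have scale: "((\<lambda>s. f s *\<^sub>R w) has_vector_derivative f' *\<^sub>R w) (at u)"
    if "(f has_real_derivative f') (at u)" for f f' u and w :: "real^2"
    using bounded_linear.has_vector_derivative[OF bounded_linear_scaleR_left
        that[unfolded has_real_derivative_iff_has_vector_derivative]] .
  have "\<exists>c. \<forall>s\<in>I. V s - \<sigma> s *\<^sub>R A t = c"
  proof (rule has_vector_derivative_zero_constant[OF conv, of "\<lambda>s. V s - \<sigma> s *\<^sub>R A t"])
    fix u assume u: "u \<in> I"
    have "((\<lambda>s. \<sigma> s *\<^sub>R A t) has_vector_derivative r u *\<^sub>R A t) (at u)"
      by (rule scale[OF \<sigma>_deriv[OF u]])
    then have "((\<lambda>s. V s - \<sigma> s *\<^sub>R A t) has_vector_derivative (r u *\<^sub>R A u - r u *\<^sub>R A t)) (at u)"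
      by (rule has_vector_derivative_diff[OF V_deriv[OF u]])
    then show "((\<lambda>s. V s - \<sigma> s *\<^sub>R A t) has_vector_derivative 0) (at u within I)"
      using A[OF u] by (simp add: has_vector_derivative_at_within)
  qed blast
  then obtain c where c: "\<And>s. s \<in> I \<Longrightarrow> V s - \<sigma> s *\<^sub>R A t = c" by blast
  have V: "V u = V t + (\<sigma> u - \<sigma> t) *\<^sub>R A t" if "u \<in> I" for u
  proof -
    have "V u - \<sigma> u *\<^sub>R A t = V t - \<sigma> t *\<^sub>R A t" using c[OF that] c[OF t] by simp
    then show ?thesis by (simp add: algebra_simps)
  qed
  have "\<exists>c. \<forall>s\<in>I. X s - ((\<sigma> s - \<sigma> t) *\<^sub>R V t + ((\<sigma> s - \<sigma> t)^2 / 2) *\<^sub>R A t) = c"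
  proof (rule has_vector_derivative_zero_constant[OF conv,
        of "\<lambda>s. X s - ((\<sigma> s - \<sigma> t) *\<^sub>R V t + ((\<sigma> s - \<sigma> t)^2 / 2) *\<^sub>R A t)"])
    fix u assume u: "u \<in> I"
    have "((\<lambda>s. (\<sigma> s - \<sigma> t) *\<^sub>R V t) has_vector_derivative r u *\<^sub>R V t) (at u)"
      by (rule scale) (auto intro!: derivative_eq_intros \<sigma>_deriv u)
    moreover have "((\<lambda>s. (\<sigma> s - \<sigma> t)^2 / 2) has_real_derivative (\<sigma> u - \<sigma> t) * r u) (at u)"
      using \<sigma>_deriv[OF u] by (auto intro!: derivative_eq_intros)
    then have "((\<lambda>s. ((\<sigma> s - \<sigma> t)^2 / 2) *\<^sub>R A t) has_vector_derivative ((\<sigma> u - \<sigma> t) * r u) *\<^sub>R A t) (at u)"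
      by (rule scale)
    ultimately have "((\<lambda>s. X s - ((\<sigma> s - \<sigma> t) *\<^sub>R V t + ((\<sigma> s - \<sigma> t)^2 / 2) *\<^sub>R A t)) has_vector_derivative
        r u *\<^sub>R V u - (r u *\<^sub>R V t + ((\<sigma> u - \<sigma> t) * r u) *\<^sub>R A t)) (at u)"
      by (intro has_vector_derivative_diff has_vector_derivative_add X_deriv u)
    moreover have "r u *\<^sub>R V u - (r u *\<^sub>R V t + ((\<sigma> u - \<sigma> t) * r u) *\<^sub>R A t) = 0"
      by (simp add: V[OF u] algebra_simps)
    ultimately show "((\<lambda>s. X s - ((\<sigma> s - \<sigma> t) *\<^sub>R V t + ((\<sigma> s - \<sigma> t)^2 / 2) *\<^sub>R A t)) has_vector_derivative 0) (at u within I)"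
      by (simp add: has_vector_derivative_at_within)
  qed blast
  then obtain c where c: "\<And>s. s \<in> I \<Longrightarrow> X s - ((\<sigma> s - \<sigma> t) *\<^sub>R V t + ((\<sigma> s - \<sigma> t)^2 / 2) *\<^sub>R A t) = c"
    by blast
  from c[OF t] c[OF s] show ?thesis by (simp add: algebra_simps)
qed

end

section \<open>Parabolas\<close>

lemma inner_crs_pythagoras:
  assumes "e = 1 \<or> e = -1"
  shows "(u \<bullet> z)^2 + (crs e u z)^2 = (u \<bullet> u) * (z \<bullet> z)"
proof -
  have "e * e = 1" using assms by auto
  then show ?thesis unfolding inner_vec_def crs_def sum_2 inner_real_def by algebra
qed

lemma infdist_line:
  fixes v :: "real^2"
  assumes v: "v \<noteq> 0" and e: "e = 1 \<or> e = -1"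
  shows "infdist Q (line p v) = \<bar>crs e v (Q - p)\<bar> / norm v"
proof (rule antisym)
  have diff: "crs e v (Q - (p + c *\<^sub>R v)) = crs e v (Q - p)" for c
    by (simp add: crs.diff_right crs.add_right crs.scaleR_right)
  define a where "a = p + (((Q - p) \<bullet> v) / (v \<bullet> v)) *\<^sub>R v"
  have a: "a \<in> line p v" unfolding a_def line_def by blast
  have "(Q - a) \<bullet> v = 0"
    using v by (simp add: a_def inner_diff_left inner_add_left field_simps)
  then have "(crs e v (Q - a))^2 = (norm v * norm (Q - a))^2"
    using inner_crs_pythagoras[OF e, of v "Q - a"]
    by (simp add: inner_commute power_mult_distrib power2_norm_eq_inner)
  then have "\<bar>crs e v (Q - a)\<bar> = \<bar>norm v * norm (Q - a)\<bar>"
    by (simp only: power2_eq_iff) auto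
  then have "\<bar>crs e v (Q - a)\<bar> = norm v * norm (Q - a)" by simp
  moreover have "crs e v (Q - a) = crs e v (Q - p)" unfolding a_def by (rule diff)
  ultimately have "dist Q a = \<bar>crs e v (Q - p)\<bar> / norm v"
    using v by (simp add: dist_norm)
  then show "infdist Q (line p v) \<le> \<bar>crs e v (Q - p)\<bar> / norm v"
    using infdist_le[OF a, of Q] by simp
  have "\<bar>crs e v (Q - p)\<bar> / norm v \<le> dist Q b" if b: "b \<in> line p v" for b
  proof -
    obtain c where c: "b = p + c *\<^sub>R v" using b by (auto simp: line_def)
    have "\<bar>crs e v (Q - p)\<bar> = \<bar>rot e v \<bullet> (Q - b)\<bar>" unfolding inner_rot c diff ..
    also have "\<dots> \<le> norm v * dist Q b"
      using Cauchy_Schwarz_ineq2[of "rot e v" "Q - b"] by (simp add: norm_rot[OF e] dist_norm)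
    finally show ?thesis using v by (simp add: divide_le_eq mult.commute)
  qed
  then show "\<bar>crs e v (Q - p)\<bar> / norm v \<le> infdist Q (line p v)"
    using a by (auto simp: infdist_def intro!: cINF_greatest)
qed

text \<open>In the affine frame at the vertex, in which \<open>W\<close> and \<open>A\<close> are orthogonal, the focus and the
  foot of the directrix are \<open>P \<plusminus> (1 / (2 |A|\<^sup>4)) A\<close>.\<close>

lemma vertex_parabola:
  fixes P W A :: "real^2"
  assumes e: "e = 1 \<or> e = -1" and WA: "crs e W A = 1" and orth: "W \<bullet> A = 0"
  shows "is_parabola {P + u *\<^sub>R W + (u^2 / 2) *\<^sub>R A | u. True}"
proof -
  define \<alpha> where "\<alpha> = A \<bullet> A"
  have "A \<noteq> 0" "W \<noteq> 0" using WA by (auto simp: crs.zero_left crs.zero_right)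
  then have \<alpha>: "0 < \<alpha>" by (simp add: \<alpha>_def)
  have WW: "W \<bullet> W = 1 / \<alpha>"
    using inner_crs_pythagoras[OF e, of W A] WA orth \<alpha> by (simp add: \<alpha>_def field_simps)
  define g where "g = 1 / (2 * \<alpha>^2)"
  have g: "0 < g" "4 * g * \<alpha> = 2 / \<alpha>" using \<alpha> by (auto simp: g_def power2_eq_square)
  define F p where "F = P + g *\<^sub>R A" and "p = P - g *\<^sub>R A"
  have coords: "Q = P + crs e (Q - P) A *\<^sub>R W + crs e W (Q - P) *\<^sub>R A" for Q
    using crs_expand[OF e WA, of "Q - P"] by (simp add: algebra_simps)
  have crsp: "crs e W (Q - p) = crs e W (Q - P) + g" for Q
    using WA by (simp add: p_def crs.diff_right crs.scaleR_right)
  have "F \<notin> line p W"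
  proof
    assume "F \<in> line p W"
    then have "crs e W (F - p) = 0" by (auto simp: line_def crs.scaleR_right)
    then show False using crsp[of F] WA g by (simp add: F_def crs.scaleR_right)
  qed
  moreover have "dist Q F = infdist Q (line p W) \<longleftrightarrow> (\<exists>u. Q = P + u *\<^sub>R W + (u^2 / 2) *\<^sub>R A)" for Q
  proof -
    define x y where "x = crs e (Q - P) A" and "y = crs e W (Q - P)"
    have Q: "Q = P + x *\<^sub>R W + y *\<^sub>R A" using coords[of Q] by (simp add: x_def y_def)
    have "(dist Q F)^2 = (x *\<^sub>R W + (y - g) *\<^sub>R A) \<bullet> (x *\<^sub>R W + (y - g) *\<^sub>R A)"
    proof -
      have "Q - F = x *\<^sub>R W + (y - g) *\<^sub>R A" by (simp add: Q F_def algebra_simps)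
      then show ?thesis by (simp only: dist_norm power2_norm_eq_inner)
    qed
    also have "\<dots> = x^2 / \<alpha> + (y - g)^2 * \<alpha>"
      using orth by (simp add: inner_add_left inner_add_right inner_commute WW \<alpha>_def[symmetric] power2_eq_square)
    finally have d: "(dist Q F)^2 = x^2 / \<alpha> + (y - g)^2 * \<alpha>" .
    have "(infdist Q (line p W))^2 = (y + g)^2 / (W \<bullet> W)"
      unfolding infdist_line[OF \<open>W \<noteq> 0\<close> e] crsp y_def[symmetric]
      by (simp add: power_divide power2_norm_eq_inner)
    then have i: "(infdist Q (line p W))^2 = (y + g)^2 * \<alpha>" by (simp add: WW)
    have "dist Q F = infdist Q (line p W) \<longleftrightarrow> (dist Q F)^2 = (infdist Q (line p W))^2"
      by (simp add: power2_eq_iff_nonneg infdist_nonneg)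
    also have "\<dots> \<longleftrightarrow> x^2 / \<alpha> = (4 * g * \<alpha>) * y"
      unfolding d i by (simp add: power2_eq_square algebra_simps)
    also have "\<dots> \<longleftrightarrow> y = x^2 / 2" unfolding g(2) using \<alpha> by (auto simp: field_simps)
    also have "\<dots> \<longleftrightarrow> (\<exists>u. Q = P + u *\<^sub>R W + (u^2 / 2) *\<^sub>R A)"
    proof
      assume "\<exists>u. Q = P + u *\<^sub>R W + (u^2 / 2) *\<^sub>R A"
      then obtain u where u: "Q - P = u *\<^sub>R W + (u^2 / 2) *\<^sub>R A" by auto
      show "y = x^2 / 2"
        unfolding x_def y_def u using WA
        by (simp add: crs.add_left crs.add_right crs.scaleR_left crs.scaleR_right)
    next
      assume "y = x^2 / 2"
      then show "\<exists>u. Q = P + u *\<^sub>R W + (u^2 / 2) *\<^sub>R A" using Q by blast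
    qed
    finally show ?thesis .
  qed
  ultimately show ?thesis
    unfolding is_parabola_def using \<open>W \<noteq> 0\<close> by (intro exI[of _ F] exI[of _ p] exI[of _ W]) auto
qed

text \<open>Shifting the parameter to the vertex, where the tangent is orthogonal to \<open>A\<close>.\<close>

lemma quadratic_parabola:
  fixes P V A :: "real^2"
  assumes e: "e = 1 \<or> e = -1" and VA: "crs e V A = 1"
  shows "is_parabola {P + u *\<^sub>R V + (u^2 / 2) *\<^sub>R A | u. True}"
proof -
  have "A \<noteq> 0" using VA by (auto simp: crs.zero_right)
  define u0 where "u0 = - (V \<bullet> A) / (A \<bullet> A)"
  define W where "W = V + u0 *\<^sub>R A"
  define P0 where "P0 = P + u0 *\<^sub>R V + (u0^2 / 2) *\<^sub>R A"
  have "W \<bullet> A = 0" using \<open>A \<noteq> 0\<close> by (simp add: W_def u0_def inner_add_left inner_diff_left)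
  moreover have "crs e W A = 1" using VA by (simp add: W_def crs.add_left crs.scaleR_left)
  moreover have shift: "P0 + u *\<^sub>R W + (u^2 / 2) *\<^sub>R A = P + (u0 + u) *\<^sub>R V + ((u0 + u)^2 / 2) *\<^sub>R A" for u
  proof -
    have "(u0 + u)^2 / 2 = u0^2 / 2 + u * u0 + u^2 / 2" by (simp add: power2_eq_square field_simps)
    then show ?thesis
      by (simp only: P0_def W_def scaleR_left_distrib scaleR_right_distrib scaleR_scaleR add_ac)
  qed
  have "{P + u *\<^sub>R V + (u^2 / 2) *\<^sub>R A | u. True} = {P0 + u *\<^sub>R W + (u^2 / 2) *\<^sub>R A | u. True}"
  proof (intro set_eqI iffI)
    fix Q assume "Q \<in> {P + u *\<^sub>R V + (u^2 / 2) *\<^sub>R A | u. True}"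
    then obtain u where "Q = P + (u0 + (u - u0)) *\<^sub>R V + ((u0 + (u - u0))^2 / 2) *\<^sub>R A" by auto
    then show "Q \<in> {P0 + u *\<^sub>R W + (u^2 / 2) *\<^sub>R A | u. True}" unfolding shift[symmetric] by blast
  qed (unfold shift, blast)
  ultimately show ?thesis using vertex_parabola[OF e] by simp
qed

context affine_frame_curve
begin

lemma open_part_of_parabola_if_A_constant:
  assumes A: "\<And>s. s \<in> I \<Longrightarrow> A s = A t" and t: "t \<in> I"
  shows "open_part_of_parabola (X ` I)"
proof -
  define C where "C = {X t + u *\<^sub>R V t + (u^2 / 2) *\<^sub>R A t | u. True}"
  define S where "S = (\<lambda>s. \<sigma> s - \<sigma> t) ` I"
  have quad: "X s = X t + (\<sigma> s - \<sigma> t) *\<^sub>R V t + ((\<sigma> s - \<sigma> t)^2 / 2) *\<^sub>R A t" if "s \<in> I" for s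
    by (rule quadratic_of_A_constant[OF A t that])
  have "inj_on (\<lambda>s. \<sigma> s - \<sigma> t) I"
    by (rule linorder_inj_onI') (use \<sigma>_mono in force)
  then have openS: "open S"
    unfolding S_def by (intro invariance_of_domain open_I continuous_intros \<sigma>_cont)
  have par: "crs e (X t + u *\<^sub>R V t + (u^2 / 2) *\<^sub>R A t - X t) (A t) = u" for u
  proof -
    have *: "X t + u *\<^sub>R V t + (u^2 / 2) *\<^sub>R A t - X t = u *\<^sub>R V t + (u^2 / 2) *\<^sub>R A t" by simp
    show ?thesis unfolding * using crs_VA[OF t] by (simp add: crs.add_left crs.scaleR_left)
  qed
  have "X ` I = C \<inter> (\<lambda>Q. crs e (Q - X t) (A t)) -` S"
  proof (intro set_eqI iffI)
    fix Q assume "Q \<in> X ` I"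
    then obtain s where s: "s \<in> I" "Q = X s" by blast
    have "crs e (Q - X t) (A t) = \<sigma> s - \<sigma> t" unfolding s(2) quad[OF s(1)] by (rule par)
    moreover have "Q \<in> C" unfolding C_def s(2) using quad[OF s(1)] by blast
    ultimately show "Q \<in> C \<inter> (\<lambda>Q. crs e (Q - X t) (A t)) -` S" using s by (auto simp: S_def)
  next
    fix Q assume Q: "Q \<in> C \<inter> (\<lambda>Q. crs e (Q - X t) (A t)) -` S"
    then obtain u where u: "Q = X t + u *\<^sub>R V t + (u^2 / 2) *\<^sub>R A t" by (auto simp: C_def)
    have "u \<in> S" using Q par[of u] unfolding u by simp
    then obtain s where "s \<in> I" "u = \<sigma> s - \<sigma> t" by (auto simp: S_def)
    then have "s \<in> I" "Q = X s" using quad[of s] u by auto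
    then show "Q \<in> X ` I" by blast
  qed
  moreover have "open ((\<lambda>Q. crs e (Q - X t) (A t)) -` S)"
    by (intro open_vimage openS crs.continuous_on continuous_intros)
  ultimately have "openin (top_of_set C) (X ` I)" by (auto simp: openin_open)
  moreover have "connected (X ` I)"
  proof (rule connected_continuous_image)
    show "continuous_on I X"
      by (meson X_deriv continuous_at_imp_continuous_on has_vector_derivative_continuous)
    show "connected I" using interval_I is_interval_connected by blast
  qed
  moreover have "is_parabola C" unfolding C_def by (rule quadratic_parabola[OF sign crs_VA[OF t]])
  ultimately show ?thesis using t unfolding open_part_of_parabola_def by blast
qed

text \<open>Conversely, a curve on a parabola satisfies a quadratic equation in the affine coordinates at
  \<open>t\<close>, and tangency removes its term linear in \<open>xc\<close>.\<close>

lemma parabola_equation: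
  assumes t: "t \<in> I" and C: "is_parabola C" and sub: "X ` I \<subseteq> C"
  shows "\<exists>\<alpha> \<beta> \<mu>. (\<alpha> \<noteq> 0 \<or> \<beta> \<noteq> 0) \<and> (\<forall>s\<in>I. (\<alpha> * xc t s + \<beta> * yc t s)^2 + \<mu> * yc t s = 0)"
proof -
  obtain F p v where v: "v \<noteq> 0" and C_def: "C = {Q. dist Q F = infdist Q (line p v)}"
    using C unfolding is_parabola_def by blast
  define i where "i = v /\<^sub>R norm v"
  have ii: "i \<bullet> i = 1" using v by (simp add: i_def power2_norm_eq_inner[symmetric] power2_eq_square flip: norm_eq_sqrt_inner)
  have on: "(X s - F) \<bullet> (X s - F) = (crs e i (X s - p))^2" if "s \<in> I" for s
  proof -
    have "dist (X s) F = \<bar>crs e v (X s - p)\<bar> / norm v"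
      using sub that infdist_line[OF v sign] by (auto simp: C_def)
    also have "\<dots> = \<bar>crs e i (X s - p)\<bar>"
      by (simp add: i_def crs.scaleR_left abs_mult divide_inverse mult.commute)
    finally have "(dist (X s) F)^2 = (crs e i (X s - p))^2" by simp
    then show ?thesis by (simp add: dist_norm power2_norm_eq_inner)
  qed
  define L where "L = (\<lambda>z. 2 * (z \<bullet> (X t - F)) - 2 * crs e i z * crs e i (X t - p))"
  have key: "(i \<bullet> (X s - X t))^2 + L (X s - X t) = 0" if s: "s \<in> I" for s
  proof -
    define z where "z = X s - X t"
    have z: "X s - F = (X t - F) + z" "X s - p = (X t - p) + z" by (simp_all add: z_def)
    have "(X s - F) \<bullet> (X s - F) - (crs e i (X s - p))^2 = z \<bullet> z - (crs e i z)^2 + L z"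
    proof -
      define w c where "w = X t - F" and "c = crs e i (X t - p)"
      have "w \<bullet> w = c^2" using on[OF t] by (simp add: w_def c_def)
      then have "(w + z) \<bullet> (w + z) - (c + crs e i z)^2
          = z \<bullet> z - (crs e i z)^2 + (2 * (z \<bullet> w) - 2 * crs e i z * c)"
        by (simp add: inner_add_left inner_add_right inner_commute[of w z] power2_eq_square algebra_simps)
      then show ?thesis unfolding z L_def crs.add_right w_def c_def .
    qed
    moreover have "z \<bullet> z = (i \<bullet> z)^2 + (crs e i z)^2"
      using inner_crs_pythagoras[OF sign, of i z] ii by simp
    ultimately show ?thesis using on[OF s] by (simp add: z_def)
  qed
  have Llin: "L (a *\<^sub>R z + b *\<^sub>R z') = a * L z + b * L z'" for a b z z'
    by (simp add: L_def inner_add_left crs.add_right crs.scaleR_right algebra_simps)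
  have "L (V t) = 0"
  proof -
    have z': "((\<lambda>s. X s - X t) has_vector_derivative r t *\<^sub>R V t) (at t)"
      by (auto intro!: derivative_eq_intros X_deriv t)
    have in': "((\<lambda>s. u \<bullet> (X s - X t)) has_real_derivative u \<bullet> (r t *\<^sub>R V t)) (at t)" for u
      using bounded_linear.has_vector_derivative[OF bounded_linear_inner_right z', of u]
      by (simp add: has_real_derivative_iff_has_vector_derivative)
    have "((\<lambda>s. (i \<bullet> (X s - X t))^2 + (2 * ((X t - F) \<bullet> (X s - X t)) - 2 * crs e i (X s - X t) * crs e i (X t - p)))
        has_real_derivative 2 * ((X t - F) \<bullet> (r t *\<^sub>R V t)) - 2 * crs e i (r t *\<^sub>R V t) * crs e i (X t - p)) (at t)"
      by (auto intro!: derivative_eq_intros in' crs_right_deriv z')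
    then have "((\<lambda>s. 0) has_real_derivative 2 * ((X t - F) \<bullet> (r t *\<^sub>R V t)) - 2 * crs e i (r t *\<^sub>R V t) * crs e i (X t - p)) (at t)"
      by (rule has_field_derivative_transform_within_open[OF _ open_I t])
        (use key in \<open>simp add: L_def inner_commute\<close>)
    then have "2 * ((X t - F) \<bullet> (r t *\<^sub>R V t)) - 2 * crs e i (r t *\<^sub>R V t) * crs e i (X t - p) = 0"
      by (rule DERIV_unique[OF _ DERIV_const])
    then have "r t * L (V t) = 0"
      by (simp add: L_def crs.scaleR_right inner_commute algebra_simps)
    then show ?thesis using r_pos[OF t] by simp
  qed
  then have "(i \<bullet> V t * xc t s + i \<bullet> A t * yc t s)^2 + L (A t) * yc t s = 0" if s: "s \<in> I" for s
    using key[OF s] unfolding X_coords[OF t, of s] Llin by (simp add: inner_add_right mult.commute)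
  moreover have "i \<bullet> V t \<noteq> 0 \<or> i \<bullet> A t \<noteq> 0"
  proof (rule ccontr)
    assume "\<not> ?thesis"
    moreover have "i \<bullet> i = i \<bullet> (crs e i (A t) *\<^sub>R V t + crs e (V t) i *\<^sub>R A t)"
      using crs_expand[OF sign crs_VA[OF t], of i] by simp
    ultimately show False using ii by (simp add: inner_add_right)
  qed
  ultimately show ?thesis by blast
qed

context
  fixes t K :: real
  assumes t: "t \<in> I" and bh: "branch_height t K"
begin

text \<open>The two end points of the chord give \<open>\<alpha> * xc + \<beta> * k\<close> opposite values, of square \<open>- \<mu> * k\<close>.\<close>

lemma sqrt_chord_of_quadratic_equation:
  assumes nz: "\<alpha> \<noteq> 0 \<or> \<beta> \<noteq> 0" and eq: "\<And>s. s \<in> I \<Longrightarrow> (\<alpha> * xc t s + \<beta> * yc t s)^2 + \<mu> * yc t s = 0"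
  shows "\<exists>c. \<forall>k. 0 < k \<and> k < K \<longrightarrow> chord t k = c * sqrt k"
proof -
  have K: "0 < K" by (rule branch_height_pos[OF t bh])
  have ends: "(\<alpha> * xc t (sr t k) + \<beta> * k)^2 = - \<mu> * k \<and> (\<alpha> * xc t (sl t k) + \<beta> * k)^2 = - \<mu> * k"
    if k: "0 < k" "k < K" for k
    using eq[of "sr t k"] eq[of "sl t k"] sr_props[OF t bh, of k] sl_props[OF t bh, of k] k by auto
  have \<alpha>: "\<alpha> \<noteq> 0"
  proof
    assume 0: "\<alpha> = 0"
    have "\<beta>^2 * k = - \<mu>" if "0 < k" "k < K" for k
    proof -
      have "k * (\<beta>^2 * k) = k * (- \<mu>)"
        using ends[OF that] 0 by (simp add: power_mult_distrib power2_eq_square mult_ac)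
      then show ?thesis using that by (simp only: mult_left_cancel[OF less_imp_neq[OF that(1), symmetric]])
    qed
    from this[of "K / 2"] this[of "K / 4"] have "\<beta>^2 * K = 0" using K by simp
    then show False using 0 nz K by simp
  qed
  have "chord t k = 2 * sqrt (- \<mu>) / \<bar>\<alpha>\<bar> * sqrt k" if k: "0 < k" "k < K" for k
  proof -
    let ?a = "\<alpha> * xc t (sr t k) + \<beta> * k" and ?b = "\<alpha> * xc t (sl t k) + \<beta> * k"
    have x: "xc t (sl t k) < 0" "0 < xc t (sr t k)"
      using sl_signs[OF t bh k] sr_signs[OF t bh k] by auto
    have "?a^2 = ?b^2" "?a \<noteq> ?b" using ends[OF k] \<alpha> x by auto
    then have "?a = - ?b" using power2_eq_iff by blast
    then have "\<alpha> * chord t k = 2 * ?a" by (simp add: chord_def algebra_simps)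
    moreover have "0 < chord t k" using x by (simp add: chord_def)
    ultimately have "\<bar>\<alpha>\<bar> * chord t k = 2 * \<bar>?a\<bar>"
      by (metis abs_mult abs_numeral abs_of_pos)
    moreover have "\<bar>?a\<bar> = sqrt (- \<mu>) * sqrt k"
      using ends[OF k] by (metis real_sqrt_abs real_sqrt_mult)
    ultimately show ?thesis using \<alpha> by (simp add: field_simps)
  qed
  then show ?thesis by blast
qed

lemma area_equation_of_sqrt_chord:
  assumes eq: "\<And>k. 0 < k \<Longrightarrow> k < K \<Longrightarrow> chord t k = c * sqrt k" and k: "0 < k" "k < K"
  shows "seg_area t k = 8 / 9 * trap_area t k"
proof -
  have K: "0 < K" by (rule branch_height_pos[OF t bh])
  have "seg_area t k - 2 / 3 * c * (k * sqrt k) = 0"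
  proof (rule zero_deriv_limit[OF K _ _ k])
    fix k assume k: "0 < k" "k < K"
    have "((\<lambda>k. k * sqrt k) has_real_derivative 3 / 2 * sqrt k) (at k)"
      using k by (auto intro!: derivative_eq_intros simp: field_simps)
    then have "((\<lambda>k. seg_area t k - 2 / 3 * c * (k * sqrt k)) has_real_derivative
        chord t k - 2 / 3 * c * (3 / 2 * sqrt k)) (at k)"
      by (intro DERIV_diff DERIV_cmult seg_area_deriv[OF t bh k])
    then show "((\<lambda>k. seg_area t k - 2 / 3 * c * (k * sqrt k)) has_real_derivative 0) (at k)"
      using eq[OF k] by simp
  next
    have "((\<lambda>k. seg_area t k - 2 / 3 * c * (k * sqrt k)) \<longlongrightarrow> 0 - 2 / 3 * c * (0 * sqrt 0)) (at_right 0)"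
      by (intro tendsto_intros seg_area_tendsto_0[OF t bh])
    then show "((\<lambda>k. seg_area t k - 2 / 3 * c * (k * sqrt k)) \<longlongrightarrow> 0) (at_right 0)" by simp
  qed
  then have S: "seg_area t k = 2 / 3 * c * (k * sqrt k)" by simp
  have "((\<lambda>k. c * sqrt k) has_real_derivative c / (2 * sqrt k)) (at k)"
    using k by (auto intro!: derivative_eq_intros simp: field_simps)
  then have "(chord t has_real_derivative c / (2 * sqrt k)) (at k)"
    by (rule has_field_derivative_transform_within_open[where S = "{0<..<K}"]) (use k eq in auto)
  then have "chord' t k = c / (2 * sqrt k)" using chord_deriv[OF t bh k] DERIV_unique by blast
  moreover define q where "q = sqrt k"
  have q: "0 < q" "k = q^2" using k by (auto simp: q_def)
  ultimately have "trap_area t k = 3 / 4 * c * (k * sqrt k)"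
    using eq[OF k] unfolding trap_area_def q_def[symmetric] by (simp add: q(2) power2_eq_square field_simps)
  then show ?thesis using S by simp
qed

end

end

section \<open>The equivalences for a curve with an affine frame\<close>

context affine_frame_curve
begin

lemma areas_eq:
  assumes t: "t \<in> I" and bh: "branch_height t K" and h: "0 < h" "norm (V t) * h < K"
  shows "S_area X I t h = seg_area t (norm (V t) * h)" "W_area X I t h = trap_area t (norm (V t) * h)"
proof -
  have k: "0 < norm (V t) * h" using h V_nonzero[OF t] by simp
  show "S_area X I t h = seg_area t (norm (V t) * h)"
    unfolding seg_area_def by (rule S_area_eq[OF t bh k h(2) refl])
  show "W_area X I t h = trap_area t (norm (V t) * h)"
    unfolding trap_area_def by (rule W_area_eq[OF t bh k h(2) refl])
qed

text \<open>The substitution \<open>k = |V t| * h\<close>.\<close>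

lemma area_equation_in_k:
  assumes t: "t \<in> I" and bh: "branch_height t K" and h0: "0 < h0"
    and eq: "\<And>h. 0 < h \<Longrightarrow> h < h0 \<Longrightarrow> S_area X I t h = lam * W_area X I t h"
  shows "\<exists>k0>0. k0 \<le> K \<and> (\<forall>k. 0 < k \<and> k < k0 \<longrightarrow> seg_area t k = lam * trap_area t k)"
proof (intro exI[of _ "min K (norm (V t) * h0)"] conjI allI impI)
  have V: "0 < norm (V t)" using V_nonzero[OF t] by simp
  show "0 < min K (norm (V t) * h0)" using branch_height_pos[OF t bh] V h0 by simp
  fix k assume k: "0 < k \<and> k < min K (norm (V t) * h0)"
  define h where "h = k / norm (V t)"
  have h: "0 < h" "h < h0" "norm (V t) * h = k" using k V by (auto simp: h_def field_simps)
  show "seg_area t k = lam * trap_area t k"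
    using eq[OF h(1,2)] areas_eq[OF t bh h(1)] k h(3) by simp
qed simp

lemma area_ratio_h:
  assumes t: "t \<in> I" and h0: "0 < h0"
    and eq: "\<And>h. 0 < h \<Longrightarrow> h < h0 \<Longrightarrow> S_area X I t h = lam * W_area X I t h"
  shows "lam = 8 / 9"
proof -
  obtain K where bh: "branch_height t K" using branch_height_exists[OF t] by blast
  show ?thesis using area_equation_in_k[OF t bh h0 eq] area_ratio[OF t bh] by blast
qed

lemma parabola_if_area_equation:
  assumes ne: "I \<noteq> {}" and eq: "\<forall>t\<in>I. \<exists>h0>0. \<forall>h. 0 < h \<and> h < h0 \<longrightarrow> S_area X I t h = 8 / 9 * W_area X I t h"
  shows "open_part_of_parabola (X ` I)"
proof -
  have parab: "\<exists>K k0. branch_height t K \<and> 0 < k0 \<and> k0 \<le> K \<and>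
      (\<forall>k. 0 < k \<and> k < k0 \<longrightarrow> chord t k = 2 * sqrt (2 * k))" if t: "t \<in> I" for t
  proof -
    obtain K where bh: "branch_height t K" using branch_height_exists[OF t] by blast
    obtain h0 where h0: "0 < h0" "\<And>h. 0 < h \<Longrightarrow> h < h0 \<Longrightarrow> S_area X I t h = 8 / 9 * W_area X I t h"
      using eq t by blast
    obtain k0 where k0: "0 < k0" "k0 \<le> K" "\<And>k. 0 < k \<Longrightarrow> k < k0 \<Longrightarrow> seg_area t k = 8 / 9 * trap_area t k"
      using area_equation_in_k[OF t bh h0] by blast
    then show ?thesis using bh chord_of_area_equation[OF t bh k0] by blast
  qed
  obtain t where t: "t \<in> I" using ne by blast
  show ?thesis
    by (rule open_part_of_parabola_if_A_constant[OF A_constant[OF parab _ t] t])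
qed

lemma area_equation_if_parabola:
  assumes par: "open_part_of_parabola (X ` I)" and t: "t \<in> I"
  shows "\<exists>h0>0. \<forall>h. 0 < h \<and> h < h0 \<longrightarrow> S_area X I t h = 8 / 9 * W_area X I t h"
proof -
  obtain C where C: "is_parabola C" "X ` I \<subseteq> C"
    using par openin_imp_subset unfolding open_part_of_parabola_def by blast
  obtain K where bh: "branch_height t K" using branch_height_exists[OF t] by blast
  obtain \<alpha> \<beta> \<mu> where *: "\<alpha> \<noteq> 0 \<or> \<beta> \<noteq> 0"
    "\<And>s. s \<in> I \<Longrightarrow> (\<alpha> * xc t s + \<beta> * yc t s)^2 + \<mu> * yc t s = 0"
    using parabola_equation[OF t C] by blast
  obtain c where c: "\<And>k. 0 < k \<Longrightarrow> k < K \<Longrightarrow> chord t k = c * sqrt k"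
    using sqrt_chord_of_quadratic_equation[OF t bh *] by blast
  have V: "0 < norm (V t)" using V_nonzero[OF t] by simp
  show ?thesis
  proof (intro exI[of _ "K / norm (V t)"] conjI allI impI)
    show "0 < K / norm (V t)" using branch_height_pos[OF t bh] V by simp
    fix h assume h: "0 < h \<and> h < K / norm (V t)"
    then have k: "0 < norm (V t) * h" "norm (V t) * h < K" using V by (auto simp: field_simps)
    show "S_area X I t h = 8 / 9 * W_area X I t h"
      using areas_eq[OF t bh _ k(2)] area_equation_of_sqrt_chord[OF t bh c k] h by simp
  qed
qed

end

section \<open>The affine frame of a strictly convex curve\<close>

lemma antiderivative_on_open_interval:
  fixes f :: "real \<Rightarrow> real"
  assumes I: "open I" "is_interval I" and f: "continuous_on I f"
  shows "\<exists>F. \<forall>t\<in>I. (F has_real_derivative f t) (at t)"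
proof (cases "I = {}")
  case False
  then obtain c where c: "c \<in> I" by blast
  define F where "F = (\<lambda>u. integral {c..u} f - integral {u..c} f)"
  have "(F has_real_derivative f t) (at t)" if t: "t \<in> I" for t
  proof -
    obtain a where a: "a \<in> I" "a < min c t" using open_real_between[OF I(1), of "min c t"] c t by (metis min_def)
    obtain b where b: "b \<in> I" "max c t < b" using open_real_between[OF I(1), of "max c t"] c t by (metis max_def)
    have sub: "{a..b} \<subseteq> I" using I(2) a b unfolding is_interval_1 by (meson atLeastAtMost_iff subsetI)
    have int: "f integrable_on {u..v}" if "a \<le> u" "v \<le> b" for u v
      using that by (intro integrable_continuous_real continuous_on_subset[OF f] order_trans[OF _ sub]) auto
    have F: "integral {a..u} f - integral {a..c} f = F u" if u: "u \<in> {a<..<b}" for u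
    proof (cases "c \<le> u")
      case True
      have "integral {a..c} f + integral {c..u} f = integral {a..u} f"
        using True u a by (intro Henstock_Kurzweil_Integration.integral_combine int) auto
      moreover have "integral {u..c} f = 0"
        using True by (cases "u = c") auto
      ultimately show ?thesis by (simp add: F_def)
    next
      case False
      have "integral {a..u} f + integral {u..c} f = integral {a..c} f"
        using False u b by (intro Henstock_Kurzweil_Integration.integral_combine int) auto
      then show ?thesis using False by (simp add: F_def)
    qed
    have t': "t \<in> {a<..<b}" using a b by auto
    have "((\<lambda>u. integral {a..u} f) has_real_derivative f t) (at t within {a..b})"
      by (rule integral_has_real_derivative[OF continuous_on_subset[OF f sub]]) (use t' in auto)
    then have "((\<lambda>u. integral {a..u} f) has_real_derivative f t) (at t within {a<..<b})"
      by (rule DERIV_subset) auto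
    then have "((\<lambda>u. integral {a..u} f) has_real_derivative f t) (at t)"
      using at_within_open[OF t' open_greaterThanLessThan] by simp
    then have "((\<lambda>u. integral {a..u} f - integral {a..c} f) has_real_derivative f t) (at t)"
      using DERIV_diff[OF _ DERIV_const] by fastforce
    then show ?thesis
      by (rule has_field_derivative_transform_within_open[OF _ open_greaterThanLessThan t' F])
  qed
  then show ?thesis by blast
qed auto

text \<open>If the derivatives are linearly dependent at a point, then the second derivative with respect
  to arclength vanishes there, since it is orthogonal to the unit tangent. So the curvature vanishes
  for every choice of the normal.\<close>

lemma strictly_convex_imp_independent:
  assumes sc: "strictly_convex_curve X I"
    and X1: "\<And>t. t \<in> I \<Longrightarrow> (X has_vector_derivative X1 t) (at t)"
    and X2: "\<And>t. t \<in> I \<Longrightarrow> (X1 has_vector_derivative X2 t) (at t)"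
    and t: "t \<in> I"
  shows "crs 1 (X1 t) (X2 t) \<noteq> 0"
proof
  assume 0: "crs 1 (X1 t) (X2 t) = 0"
  obtain \<phi> J where arc: "arclength_reparametrization X I \<phi> J" and curv: "\<And>s. s \<in> J \<Longrightarrow> 0 < curvature (X \<circ> \<phi>) J s"
    using sc unfolding strictly_convex_curve_def by blast
  have J: "open J" and bij: "bij_betw \<phi> J I" and \<phi>C3: "C3_on \<phi> J"
    and unit: "\<And>s. s \<in> J \<Longrightarrow> norm (velocity (X \<circ> \<phi>) s) = 1"
    using arc unfolding arclength_reparametrization_def open_interval_def by auto
  obtain \<phi>1 \<phi>2 where \<phi>1: "\<And>s. s \<in> J \<Longrightarrow> (\<phi> has_vector_derivative \<phi>1 s) (at s)"
    and \<phi>2: "\<And>s. s \<in> J \<Longrightarrow> (\<phi>1 has_vector_derivative \<phi>2 s) (at s)"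
    using \<phi>C3 unfolding C3_on_def by blast
  obtain s where s: "s \<in> J" "\<phi> s = t" using bij t unfolding bij_betw_def by auto
  have inI: "\<phi> u \<in> I" if "u \<in> J" for u using bij that unfolding bij_betw_def by auto
  define Y1 where "Y1 = (\<lambda>u. \<phi>1 u *\<^sub>R X1 (\<phi> u))"
  define Y2 where "Y2 = \<phi>1 s *\<^sub>R (\<phi>1 s *\<^sub>R X2 t) + \<phi>2 s *\<^sub>R X1 t"
  have vel: "velocity (X \<circ> \<phi>) u = Y1 u" if "u \<in> J" for u
    unfolding Y1_def by (intro vector_derivative_at vector_diff_chain_at \<phi>1 X1 inI that)
  have "((X1 \<circ> \<phi>) has_vector_derivative \<phi>1 s *\<^sub>R X2 t) (at s)"
    using vector_diff_chain_at[OF \<phi>1[OF s(1)] X2[OF inI[OF s(1)]]] s(2) by simp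
  from has_vector_derivative_scaleR[OF \<phi>2[OF s(1), folded has_real_derivative_iff_has_vector_derivative] this]
  have Y1': "(Y1 has_vector_derivative Y2) (at s)"
    using s(2) by (simp add: Y1_def[abs_def] Y2_def comp_def)
  have "(velocity (X \<circ> \<phi>) has_vector_derivative Y2) (at s)"
    by (rule has_vector_derivative_transform_within_open[OF Y1' J s(1)]) (simp add: vel)
  then have acc: "velocity (velocity (X \<circ> \<phi>)) s = Y2" by (rule vector_derivative_at)
  have Y1n: "norm (Y1 u) = 1" if "u \<in> J" for u using unit[OF that] vel[OF that] by simp
  have "((\<lambda>u. Y1 u \<bullet> Y1 u) has_vector_derivative Y1 s \<bullet> Y2 + Y2 \<bullet> Y1 s) (at s)"
    by (rule bounded_bilinear.has_vector_derivative[OF bounded_bilinear_inner Y1' Y1'])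
  moreover have "((\<lambda>u. Y1 u \<bullet> Y1 u) has_vector_derivative 0) (at s)"
    by (rule has_vector_derivative_transform_within_open[OF has_vector_derivative_const[of 1] J s(1)])
      (simp add: dot_square_norm Y1n)
  ultimately have "Y1 s \<bullet> Y2 + Y2 \<bullet> Y1 s = 0" by (rule vector_derivative_unique_at)
  then have orth: "Y1 s \<bullet> Y2 = 0" by (simp add: inner_commute)
  have "crs 1 (Y1 s) Y2 = 0"
    using 0 s(2) by (simp add: Y1_def Y2_def crs.add_right crs.scaleR_left crs.scaleR_right)
  then have "(Y1 s \<bullet> Y1 s) * (Y2 \<bullet> Y2) = 0"
    using inner_crs_pythagoras[of 1 "Y1 s" Y2] orth by simp
  then have "Y2 = 0" using Y1n[OF s(1)] by auto
  then show False using curv[OF s(1)] acc by (simp add: curvature_def)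
qed

text \<open>The sign of the determinant of \<open>X'\<close> and \<open>X''\<close> is constant by connectedness. Since \<open>X\<close> is of class
  C3, this determinant, \<open>r\<close> and \<open>V\<close> are continuously differentiable.\<close>

lemma affine_frame_exists:
  assumes sc: "strictly_convex_curve X I"
  shows "\<exists>e V A r \<sigma>. affine_frame_curve e I X V A r \<sigma>"
proof -
  have reg: "open I" "is_interval I" "C3_on X I" "\<And>t. t \<in> I \<Longrightarrow> velocity X t \<noteq> 0"
    and inj: "inj_on X I" and conv: "convex_curve X I"
    using sc unfolding strictly_convex_curve_def regular_C3_curve_def open_interval_def by auto
  obtain X1 X2 X3 where X1: "\<And>t. t \<in> I \<Longrightarrow> (X has_vector_derivative X1 t) (at t)"
    and X2: "\<And>t. t \<in> I \<Longrightarrow> (X1 has_vector_derivative X2 t) (at t)"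
    and X3: "\<And>t. t \<in> I \<Longrightarrow> (X2 has_vector_derivative X3 t) (at t)"
    and X3c: "continuous_on I X3"
    using reg(3) unfolding C3_on_def by blast
  have vel: "velocity X t = X1 t" if "t \<in> I" for t by (rule vector_derivative_at[OF X1[OF that]])
  have cont1: "continuous_on I X1" and cont2: "continuous_on I X2"
    using X2 X3 by (auto intro!: continuous_at_imp_continuous_on has_vector_derivative_continuous)
  have "\<exists>e. (e = 1 \<or> e = -1) \<and> (\<forall>t\<in>I. 0 < crs e (X1 t) (X2 t))"
  proof -
    let ?w = "\<lambda>t. crs 1 (X1 t) (X2 t)"
    have nz: "?w t \<noteq> 0" if "t \<in> I" for t by (rule strictly_convex_imp_independent[OF sc X1 X2 that])
    have "connected (?w ` I)"
      using reg(2) by (intro connected_continuous_image crs.continuous_on cont1 cont2)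
        (auto simp: is_interval_connected)
    then have "\<not> (?w a < 0 \<and> 0 < ?w b)" if "a \<in> I" "b \<in> I" for a b
      using connectedD_interval[of "?w ` I" "?w a" "?w b" 0] nz that by fastforce
    then have "(\<forall>t\<in>I. 0 < ?w t) \<or> (\<forall>t\<in>I. 0 < - ?w t)"
      using nz by (meson linorder_neqE_linordered_idom neg_0_less_iff_less)
    moreover have "- ?w t = crs (-1) (X1 t) (X2 t)" for t by (simp add: crs_def)
    ultimately show ?thesis by auto
  qed
  then obtain e where e: "e = 1 \<or> e = -1" and w0: "\<And>t. t \<in> I \<Longrightarrow> 0 < crs e (X1 t) (X2 t)" by blast
  have supp: "0 \<le> crs e (X1 t) (X s - X t)" if t: "t \<in> I" and s: "s \<in> I" for t s
  proof -
    have nz: "X1 t \<noteq> 0" using reg(4)[OF t] vel[OF t] by simp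
    obtain n where n: "norm n = 1" "n \<bullet> X1 t = 0" "\<And>s. s \<in> I \<Longrightarrow> 0 \<le> (X s - X t) \<bullet> n"
      using conv t vel[OF t] unfolding convex_curve_def is_convex_side_normal_def by auto
    from unit_normal_cases[OF e nz n(1,2)] show ?thesis
    proof
      assume "n = rot e (X1 t) /\<^sub>R norm (X1 t)"
      then show ?thesis using n(3)[OF s] nz
        by (simp add: inner_commute[of "X _ - X t"] inner_rot zero_le_divide_iff field_simps)
    next
      \<comment> \<open>The other unit normal points away from the curve near \<open>t\<close>.\<close>
      assume nn: "n = - (rot e (X1 t) /\<^sub>R norm (X1 t))"
      have le: "crs e (X1 t) (X u - X t) \<le> 0" if "u \<in> I" for u
        using n(3)[OF that] nz
        by (simp add: nn inner_commute[of "X _ - X t"] inner_rot mult_le_0_iff)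
      have d1: "((\<lambda>u. crs e (X1 t) (X u - X t)) has_real_derivative crs e (X1 t) (X1 u)) (at u)" if "u \<in> I" for u
        by (rule crs_right_deriv) (auto intro!: derivative_eq_intros X1 that)
      have d2: "((\<lambda>u. crs e (X1 t) (X1 u)) has_real_derivative crs e (X1 t) (X2 t)) (at t)"
        by (rule crs_right_deriv[OF X2[OF t]])
      obtain d where d: "d > 0" "\<And>h. 0 < h \<Longrightarrow> h < d \<Longrightarrow> 0 < crs e (X1 t) (X1 (t + h))"
        using has_real_derivative_pos_inc_right[OF d2 w0[OF t]] by auto
      obtain d' where d': "d' > 0" "ball t d' \<subseteq> I" by (rule openE[OF reg(1) t])
      define b where "b = t + min d d' / 2"
      have b: "t < b" "b < t + d" "\<And>u. t \<le> u \<Longrightarrow> u \<le> b \<Longrightarrow> u \<in> I"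
        using d(1) d' by (auto simp: b_def subset_iff dist_real_def min_def split: if_splits)
      obtain z where z: "t < z" "z < b"
        "crs e (X1 t) (X b - X t) - crs e (X1 t) (X t - X t) = (b - t) * crs e (X1 t) (X1 z)"
        using MVT2[OF b(1), of "\<lambda>u. crs e (X1 t) (X u - X t)" "\<lambda>u. crs e (X1 t) (X1 u)"] d1 b(3) by blast
      have "0 < (b - t) * crs e (X1 t) (X1 z)"
        using d(2)[of "z - t"] z b by simp
      then have "0 < crs e (X1 t) (X b - X t)" using z(3) by (simp add: crs.zero_right)
      then show ?thesis using le[of b] b by simp
    qed
  qed
  define w where "w = (\<lambda>t. crs e (X1 t) (X2 t))"
  define r where "r = (\<lambda>t. w t powr (1 / 3))"
  define r' where "r' = (\<lambda>t. 1 / 3 * w t powr (1 / 3 - 1) * crs e (X1 t) (X3 t))"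
  define V where "V = (\<lambda>t. (1 / r t) *\<^sub>R X1 t)"
  define A where "A = (\<lambda>t. (1 / r t) *\<^sub>R ((1 / r t) *\<^sub>R X2 t + (- r' t / (r t * r t)) *\<^sub>R X1 t))"
  have w: "0 < w t" if "t \<in> I" for t using w0[OF that] by (simp add: w_def)
  have r: "0 < r t" if "t \<in> I" for t using w[OF that] by (simp add: r_def)
  have r3: "r t * r t * r t = w t" if "t \<in> I" for t
    using w[OF that] by (simp add: r_def flip: powr_add)
  have w': "(w has_real_derivative crs e (X1 t) (X3 t)) (at t)" if "t \<in> I" for t
    using crs_deriv[OF X2[OF that] X3[OF that], of e] by (simp add: w_def)
  have r'_deriv: "(r has_real_derivative r' t) (at t)" if "t \<in> I" for t
    unfolding r_def r'_def using DERIV_fun_powr[OF w'[OF that] w[OF that], of "1 / 3"] by simp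
  have rc: "continuous_on I r"
    by (rule DERIV_continuous_on[OF has_field_derivative_at_within[OF r'_deriv]])
  have wc: "continuous_on I w"
    by (rule DERIV_continuous_on[OF has_field_derivative_at_within[OF w']])
  have r'c: "continuous_on I r'"
    unfolding r'_def using w by (intro continuous_intros crs.continuous_on wc cont1 X3c) fastforce
  obtain \<sigma> where \<sigma>: "\<And>t. t \<in> I \<Longrightarrow> (\<sigma> has_real_derivative r t) (at t)"
    using antiderivative_on_open_interval[OF reg(1,2) rc] by blast
  have "affine_frame_curve e I X V A r \<sigma>"
  proof
    fix t assume t: "t \<in> I"
    note rt = r[OF t]
    show "(X has_vector_derivative r t *\<^sub>R V t) (at t)"
      using X1[OF t] rt by (simp add: V_def)
    have "((\<lambda>t. 1 / r t) has_real_derivative - r' t / (r t * r t)) (at t)"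
      using DERIV_divide[OF DERIV_const r'_deriv[OF t], of 1] rt by simp
    from has_vector_derivative_scaleR[OF this X2[OF t]]
    show "(V has_vector_derivative r t *\<^sub>R A t) (at t)"
      using rt by (simp add: V_def A_def)
    show "crs e (V t) (A t) = 1"
    proof -
      have "crs e (V t) (A t) = crs e (X1 t) (X2 t) / (r t * r t * r t)"
        by (simp add: V_def A_def crs.scaleR_left crs.scaleR_right crs.add_right crs.diff_right)
      also have "\<dots> = 1" using r3[OF t] w[OF t] by (simp add: w_def)
      finally show ?thesis .
    qed
    fix s assume s: "s \<in> I"
    show "0 \<le> crs e (V t) (X s - X t)"
      using supp[OF t s] rt by (simp add: V_def crs.scaleR_left)
  next
    have "\<forall>x\<in>I. r x \<noteq> 0" "\<forall>x\<in>I. r x * r x \<noteq> 0" using r by fastforce+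
    then show "continuous_on I A"
      unfolding A_def by (intro continuous_intros cont1 cont2 rc r'c)
  qed (use e reg(1,2) \<sigma> r inj in auto)
  then show ?thesis by blast
qed

theorem theorem1p4:
  fixes X :: "real \<Rightarrow> real^2" and I :: "real set"
  assumes "strictly_convex_curve X I"
  shows "((\<exists>lam :: real^2 \<Rightarrow> real. \<forall>t\<in>I. \<exists>h0>0. \<forall>h. 0 < h \<and> h < h0 \<longrightarrow>
             S_area X I t h = lam (X t) * W_area X I t h)
          \<longleftrightarrow> (\<forall>t\<in>I. \<exists>h0>0. \<forall>h. 0 < h \<and> h < h0 \<longrightarrow>
             S_area X I t h = 8 / 9 * W_area X I t h))
       \<and> ((\<forall>t\<in>I. \<exists>h0>0. \<forall>h. 0 < h \<and> h < h0 \<longrightarrow>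
             S_area X I t h = 8 / 9 * W_area X I t h)
          \<longleftrightarrow> open_part_of_parabola (X ` I))"
    (is "(?one \<longleftrightarrow> ?two) \<and> (?two \<longleftrightarrow> ?three)")
proof -
  obtain e V A r \<sigma> where "affine_frame_curve e I X V A r \<sigma>"
    using affine_frame_exists[OF assms] by blast
  then interpret affine_frame_curve e I X V A r \<sigma> .
  have ne: "I \<noteq> {}"
    using assms unfolding strictly_convex_curve_def regular_C3_curve_def open_interval_def by blast
  have "?two" if one: "?one"
  proof -
    obtain lam :: "real^2 \<Rightarrow> real" where lam: "\<forall>t\<in>I. \<exists>h0>0. \<forall>h. 0 < h \<and> h < h0 \<longrightarrow>
        S_area X I t h = lam (X t) * W_area X I t h"
      using one by blast
    moreover have "lam (X t) = 8 / 9" if t: "t \<in> I" for t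
      using lam t area_ratio_h[OF t] by blast
    ultimately show ?thesis by simp
  qed
  moreover have "?one" if "?two"
    using that by (intro exI[of _ "\<lambda>_. 8 / 9"])
  moreover have "?two \<longleftrightarrow> ?three"
    using parabola_if_area_equation[OF ne] area_equation_if_parabola by blast
  ultimately show ?thesis by blast
qed

end
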